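(* Let $\alpha,\beta,\gamma\in\mathbb{C}$ with $\alpha\beta\gamma\neq0$. Consider the solutions $w(x)$ of ${\rm P}_{\rm V}(\alpha,\beta,\gamma,2)$ satisfying $w(x)=-1+o(1)$ as $x\to\infty$ in the right half plane (along $\arg x=-\phi$, $|\phi|<\tfrac{\pi}{2}$), and let $C_\pm$ be the constants for which $w(x)\sim-1+C_\pm x^{-1/2}e^{-x}$ as $x\to\pm i\infty$. The unique such solution with $C_+=0$ is analytic for large $|x|$ also in the left half-plane: for every $\epsilon>0$ there is $R_\epsilon>0$ such that it is analytic for $|x|>R_\epsilon$ with $\arg x\in(-\tfrac{\pi}{2}+\epsilon,\tfrac{3\pi}{2}-\epsilon)$. Similarly, for the unique such solution with $C_-=0$: for every $\epsilon>0$ there is $R_\epsilon>0$ such that it is analytic for $|x|>R_\epsilon$ with $\arg x\in(-\tfrac{3\pi}{2}+\epsilon,\tfrac{\pi}{2}-\epsilon)$.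
   Context: ${\rm P}_{\rm V}(\alpha,\beta,\gamma,\delta)$ is the fifth Painlevé equation $$w''=\left(\frac1{2w}+\frac1{w-1}\right)w'^2-\frac{w'}{x}+\frac{(w-1)^2}{x^2}\left(\alpha w+\frac{\beta}{w}\right)+\frac{\gamma w}{x}+\frac{\delta w(w+1)}{w-1}.$$ For every solution as in the claim there are unique constants $C_\pm$ with $w(x)+1-C_\pm x^{-1/2}e^{-x}=o(|x|^{-1/2})$ as $x\to\pm i\infty$ along the imaginary axis (with $\arg x=\pm\pi/2$); this is the meaning of $\sim$. Sectors with $\arg x$ outside $(-\pi,\pi]$ are understood via analytic continuation of $w$ from the right half plane. *)

theory Defs
  imports
    "HOL-Complex_Analysis.Complex_Analysis"
    "HOL-Library.Landau_Symbols"
begin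

definition PV_eq :: "complex \<Rightarrow> complex \<Rightarrow> complex \<Rightarrow> complex \<Rightarrow> (complex \<Rightarrow> complex) \<Rightarrow> complex \<Rightarrow> bool"
  where "PV_eq \<alpha> \<beta> \<gamma> \<delta> w x \<longleftrightarrow>
    deriv (deriv w) x =
        (1 / (2 * w x) + 1 / (w x - 1)) * (deriv w x)\<^sup>2
      - deriv w x / x
      + (w x - 1)\<^sup>2 / x\<^sup>2 * (\<alpha> * w x + \<beta> / w x)
      + \<gamma> * w x / x
      + \<delta> * w x * (w x + 1) / (w x - 1)"

text \<open>
  Solutions are meromorphic functions; the equation is imposed wherever its two sides make
  sense, that is, away from poles of \<open>w\<close> and from points where \<open>w\<close> takes the value
  \<open>0\<close> or \<open>1\<close>. The predicate \<open>nicely_meromorphic_on\<close> only fixes the values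
  at removable singularities and poles; for a set \<open>A\<close> that is not open it speaks about
  a neighbourhood of each point of \<open>A\<close>, so that the derivatives make sense on \<open>A\<close>.
\<close>
definition PV_solution_on ::
  "complex \<Rightarrow> complex \<Rightarrow> complex \<Rightarrow> complex \<Rightarrow> (complex \<Rightarrow> complex) \<Rightarrow> complex set \<Rightarrow> bool"
  where "PV_solution_on \<alpha> \<beta> \<gamma> \<delta> w A \<longleftrightarrow>
    w nicely_meromorphic_on A \<and>
    (\<forall>x\<in>A. \<not> is_pole w x \<and> w x \<noteq> 0 \<and> w x \<noteq> 1 \<longrightarrow> PV_eq \<alpha> \<beta> \<gamma> \<delta> w x)"

text \<open>
  Solutions near infinity in the closed right half plane (the imaginary axis is included because
  the constants \<open>C\<^sub>\<plusminus>\<close> are read off there) that tend to \<open>-1\<close> along every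
  ray \<open>arg x = -\<phi>\<close> of the open right half plane. The limit is not required to be
  uniform in \<open>\<phi>\<close>. Such a \<open>w\<close> is only meaningful as a germ at infinity: its
  values outside the closed half plane or for small \<open>|x|\<close> are arbitrary.
\<close>
definition PV_truncated ::
  "complex \<Rightarrow> complex \<Rightarrow> complex \<Rightarrow> complex \<Rightarrow> (complex \<Rightarrow> complex) \<Rightarrow> bool"
  where "PV_truncated \<alpha> \<beta> \<gamma> \<delta> w \<longleftrightarrow>
    (\<exists>R>0. PV_solution_on \<alpha> \<beta> \<gamma> \<delta> w {x. 0 \<le> Re x \<and> R < norm x}) \<and>
    (\<forall>\<phi>::real. \<bar>\<phi>\<bar> < pi / 2 \<longrightarrow> ((\<lambda>r. w (rcis r (- \<phi>))) \<longlongrightarrow> -1) at_top)"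

definition same_germ_right :: "(complex \<Rightarrow> complex) \<Rightarrow> (complex \<Rightarrow> complex) \<Rightarrow> bool"
  where "same_germ_right v w \<longleftrightarrow> (\<forall>\<^sub>F x in at_infinity. 0 \<le> Re x \<longrightarrow> v x = w x)"

text \<open>
  \<open>w(x) + 1 - C x\<^sup>-\<^sup>1\<^sup>/\<^sup>2 e\<^sup>-\<^sup>x = o(|x|\<^sup>-\<^sup>1\<^sup>/\<^sup>2)\<close> for
  \<open>x = d y\<close>, \<open>y\<close> tending to plus infinity. It is used with \<open>d = \<i>\<close>, giving
  \<open>C\<^sub>+\<close>, and \<open>d = -\<i>\<close>, giving \<open>C\<^sub>-\<close>; the principal branch of
  \<open>powr\<close> then has \<open>arg x = pi/2\<close> and \<open>arg x = -pi/2\<close>, respectively.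
\<close>
definition has_exp_constant :: "complex \<Rightarrow> (complex \<Rightarrow> complex) \<Rightarrow> complex \<Rightarrow> bool"
  where "has_exp_constant d w C \<longleftrightarrow>
    (\<lambda>y::real. let x = d * of_real y in w x + 1 - C * x powr (-1/2) * exp (- x))
      \<in> o[at_top](\<lambda>y. of_real (norm (d * of_real y) powr (-1/2)))"

abbreviation has_C_plus :: "(complex \<Rightarrow> complex) \<Rightarrow> complex \<Rightarrow> bool"
  where "has_C_plus \<equiv> has_exp_constant \<i>"

abbreviation has_C_minus :: "(complex \<Rightarrow> complex) \<Rightarrow> complex \<Rightarrow> bool"
  where "has_C_minus \<equiv> has_exp_constant (- \<i>)"

text \<open>
  The values of \<open>a\<close> and \<open>b\<close> need not lie in the range of the principal argument.
  As long as \<open>b - a \<le> 2 pi\<close>, polar coordinates are injective on the sector, so that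
  functions on this part of the Riemann surface of the logarithm are functions on a subset of the
  plane.
\<close>
definition sector :: "real \<Rightarrow> real \<Rightarrow> real \<Rightarrow> complex set"
  where "sector R a b = {rcis r \<theta> |r \<theta>. R < r \<and> a < \<theta> \<and> \<theta> < b}"

text \<open>
  Analyticity, for large \<open>|x|\<close>, of the continuation of \<open>w\<close> from the right half plane
  to \<open>a < arg x < b\<close>. It is meant for sectors with \<open>b - a \<le> 2 pi\<close> that meet the
  open right half plane in a single sector, with arguments in \<open>(-pi/2, pi/2)\<close>. On the rest
  of the sector \<open>w\<close> itself plays no role.
\<close>
definition continues_analytically :: "(complex \<Rightarrow> complex) \<Rightarrow> real \<Rightarrow> real \<Rightarrow> bool"
  where "continues_analytically w a b \<longleftrightarrow>
    (\<exists>R>0. \<exists>f. f analytic_on sector R a b \<and>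
      (\<forall>x \<in> sector R a b. 0 < Re x \<longrightarrow> f x = w x))"

end

theory Submission
  imports Defs "HOL-Real_Asymp.Real_Asymp"
begin

text \<open>
  The substitution \<open>w = (sin u + 1) / (sin u - 1)\<close> turns \<open>w = - 1\<close> into \<open>u = 0\<close> and the fifth
  Painleve equation with \<open>\<delta> = 2\<close> into a forced pendulum equation \<open>u'' + u' / x = N x u\<close>
  without a term in \<open>u'\<^sup>2\<close>, where \<open>N x u\<close> equals \<open>u + \<gamma> / (2 x)\<close> up to terms of higher
  order (\<open>PV_of_eq_iff\<close>). Near \<open>u = 0\<close> and for large \<open>x\<close> it is a perturbation of
  \<open>u'' = u\<close>, with solutions \<open>exp x\<close> and \<open>exp (- x)\<close>, and it forces a particular solution of
  order \<open>1 / x\<close>.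

  Let \<open>d\<close> be \<open>\<i>\<close> or \<open>- \<i>\<close>. In a half plane whose inner normal \<open>m\<close> satisfies
  \<open>m \<bullet> d > 0\<close>, every line parallel to the boundary has one end where \<open>exp (- x)\<close> decays and
  one end where \<open>exp x\<close> decays. Integrating the equation from these two ends gives a fixed point
  problem that has a solution of order \<open>1 / x\<close>, by contraction (\<open>half_plane_solution\<close>). All
  these half planes contain the end of the axis \<open>d\<close>. There both exponentials have modulus one, so
  that two solutions of order \<open>1 / x\<close> coincide (\<open>decaying_solution_unique_on_axis\<close>). Hence the
  solutions for different \<open>m\<close> are pieces of one function, which is analytic in every closed
  subsector of the sector with opening \<open>2 pi\<close> that has the axis \<open>d\<close> in the middle, for large
  \<open>|x|\<close>. This is the asserted continuation, and as the function is \<open>O(1 / x)\<close> on the axis \<open>d\<close>, its constant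
  \<open>C\<close> there is zero.

  Two things remain, and both are answered by the same analysis of solutions with \<open>u \<rightarrow> 0\<close> on
  the positive real axis. The solution constructed for \<open>d\<close> has to be continued to the opposite
  axis \<open>- d\<close>, on the boundary of the sector, and any other solution with \<open>C = 0\<close> has to be
  compared with it. The difference of two solutions that tend to zero on the real axis, multiplied by
  \<open>x\<^sup>1\<^sup>/\<^sup>2\<close>, is \<open>C exp (- x)\<close> asymptotically (\<open>recessive_difference_on_real_ray\<close>). On the
  other hand, for each \<open>C\<close> a solution with this behaviour relative to a given base solution
  exists in a region that contains the end of the axis \<open>d\<close> of the base solution (\<open>recessive_family\<close>), and it is
  determined by \<open>C\<close>; so the second solution is a member of this family
  (\<open>recessive_identification\<close>). Taking the solution for \<open>- d\<close> as base continues the solution for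
  \<open>d\<close> to the axis \<open>- d\<close>. Taking the solution for \<open>d\<close> as base represents an arbitrary
  solution, whose constant \<open>C\<close> can then be read off on the axis \<open>d\<close>; if it is zero, the
  solution is the base.
\<close>

section \<open>Contractions in weighted function spaces\<close>

text \<open>
  Banach's theorem with the weighted norm unfolded into pointwise estimates. The space is a bare set
  \<open>S\<close> of functions of which only the values on \<open>A\<close> are compared, so that no type of
  functions with a given domain and decay has to be set up.
\<close>
lemma weighted_contraction_fixpoint:
  fixes T :: "('a \<Rightarrow> 'b::banach) \<Rightarrow> 'a \<Rightarrow> 'b" and W :: "'a \<Rightarrow> real"
  assumes f0: "f0 \<in> S" and TS: "\<And>f. f \<in> S \<Longrightarrow> T f \<in> S"
    and bdd: "\<And>f g x. f \<in> S \<Longrightarrow> g \<in> S \<Longrightarrow> x \<in> A \<Longrightarrow> norm (f x - g x) \<le> B * W x"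
    and contr: "\<And>f g c x. f \<in> S \<Longrightarrow> g \<in> S \<Longrightarrow> (\<And>x. x \<in> A \<Longrightarrow> norm (f x - g x) \<le> c * W x)
          \<Longrightarrow> x \<in> A \<Longrightarrow> norm (T f x - T g x) \<le> c / 2 * W x"
    and closed: "\<And>F f. (\<And>n. F n \<in> S)
          \<Longrightarrow> (\<And>n x. x \<in> A \<Longrightarrow> norm (F n x - f x) \<le> 2 * B * (1/2) ^ n * W x) \<Longrightarrow> f \<in> S"
  obtains f where "f \<in> S" "\<And>x. x \<in> A \<Longrightarrow> T f x = f x"
proof -
  define F where "F n = (T ^^ n) f0" for n
  have FS: "F n \<in> S" for n
    by (induction n) (auto simp: F_def f0 TS)
  have FSuc: "F (Suc n) = T (F n)" for n
    by (simp add: F_def)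
  have step: "norm (F (Suc n) x - F n x) \<le> B * (1/2) ^ n * W x" if "x \<in> A" for n x
    using that
  proof (induction n arbitrary: x)
    case 0
    then show ?case using bdd[OF FS FS, of x 1 0] by simp
  next
    case (Suc n)
    have "norm (T (F (Suc n)) x - T (F n) x) \<le> (B * (1/2) ^ n) / 2 * W x"
      by (rule contr[OF FS FS Suc.IH Suc.prems])
    then show ?case
      by (simp only: FSuc power_Suc) (simp add: mult_ac)
  qed
  have far: "norm (F (n + k) x - F n x) \<le> 2 * B * ((1/2) ^ n - (1/2) ^ (n + k)) * W x"
    if "x \<in> A" for n k x
  proof (induction k)
    case (Suc k)
    have "norm (F (n + Suc k) x - F n x)
        \<le> norm (F (Suc (n + k)) x - F (n + k) x) + norm (F (n + k) x - F n x)"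
      by (metis add_Suc_right diff_add_cancel add_diff_eq norm_triangle_ineq)
    also have "\<dots> \<le> B * (1/2) ^ (n + k) * W x + 2 * B * ((1/2) ^ n - (1/2) ^ (n + k)) * W x"
      by (intro add_mono step Suc that)
    also have "\<dots> = 2 * B * ((1/2) ^ n - (1/2) ^ (n + Suc k)) * W x"
      by (simp add: algebra_simps)
    finally show ?case .
  qed auto
  have BW: "0 \<le> B * W x" if "x \<in> A" for x
    using bdd[OF f0 f0 that] by simp
  have near: "norm (F m x - F n x) \<le> 2 * B * (1/2) ^ n * W x" if "x \<in> A" "n \<le> m" for m n x
  proof -
    have "norm (F m x - F n x) \<le> 2 * B * ((1/2) ^ n - (1/2) ^ m) * W x"
      using far[OF that(1), of n "m - n"] that(2) by simp
    also have "\<dots> \<le> 2 * B * (1/2) ^ n * W x"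
      using BW[OF that(1)] mult_nonneg_nonneg[OF BW[OF that(1)], of "(1/2)^m"] by (simp add: algebra_simps)
    finally show ?thesis .
  qed
  have lim0: "(\<lambda>n. 2 * B * (1/2) ^ n * W x) \<longlonglongrightarrow> 0" for x
    by (intro tendsto_mult_left_zero tendsto_mult_right_zero LIMSEQ_realpow_zero) auto
  have conv: "convergent (\<lambda>n. F n x)" if "x \<in> A" for x
  proof -
    have "Cauchy (\<lambda>n. F n x)"
    proof (rule CauchyI')
      fix e :: real assume "e > 0"
      then obtain n0 where n0: "\<And>n. n \<ge> n0 \<Longrightarrow> 2 * B * (1/2) ^ n * W x < e"
        using order_tendstoD(2)[OF lim0, of e] by (auto simp: eventually_sequentially)
      show "\<exists>M. \<forall>m\<ge>M. \<forall>n>m. dist (F m x) (F n x) < e"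
      proof (intro exI allI impI)
        fix m n assume "n0 \<le> m" "m < n"
        then show "dist (F m x) (F n x) < e"
          using near[OF that, of m n] n0[of m] by (simp add: dist_norm norm_minus_commute)
      qed
    qed
    then show ?thesis by (rule Cauchy_convergent)
  qed
  define f where "f x = lim (\<lambda>n. F n x)" for x
  have lim: "(\<lambda>n. F n x) \<longlonglongrightarrow> f x" if "x \<in> A" for x
    using conv[OF that] by (simp add: f_def convergent_LIMSEQ_iff)
  have close: "norm (F n x - f x) \<le> 2 * B * (1/2) ^ n * W x" if "x \<in> A" for n x
  proof -
    have "(\<lambda>m. norm (F m x - F n x)) \<longlonglongrightarrow> norm (f x - F n x)"
      by (intro tendsto_intros lim that)
    then have "norm (f x - F n x) \<le> 2 * B * (1/2) ^ n * W x"
      by (rule LIMSEQ_le_const2) (use near[OF that] in blast)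
    then show ?thesis by (simp add: dist_norm norm_minus_commute)
  qed
  have fS: "f \<in> S"
    by (rule closed[OF FS close])
  have "T f x = f x" if "x \<in> A" for x
  proof -
    have "norm (F (Suc n) x - T f x) \<le> 2 * B * (1/2) ^ n * W x" for n
      using contr[OF FS fS close that, of n] BW[OF that]
        mult_nonneg_nonneg[OF BW[OF that], of "(1/2)^n"] by (simp add: FSuc mult_ac)
    then have "(\<lambda>n. F (Suc n) x - T f x) \<longlonglongrightarrow> 0"
      by (intro Lim_null_comparison[OF _ lim0[of x]]) auto
    then have "(\<lambda>n. F (Suc n) x) \<longlonglongrightarrow> T f x"
      by (rule LIM_zero_cancel)
    moreover have "(\<lambda>n. F (Suc n) x) \<longlonglongrightarrow> f x"
      by (rule LIMSEQ_Suc[OF lim[OF that]])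
    ultimately show ?thesis by (rule LIMSEQ_unique)
  qed
  with fS that show thesis by blast
qed

definition weighted_ball :: "complex set \<Rightarrow> real \<Rightarrow> (complex \<Rightarrow> real) \<Rightarrow> (complex \<Rightarrow> complex) set" where
  "weighted_ball A M W = {F. F holomorphic_on A \<and> (\<forall>x\<in>A. norm (F x) \<le> M * W x)}"

lemma weighted_ballD:
  assumes "F \<in> weighted_ball A M W"
  shows "F holomorphic_on A" "x \<in> A \<Longrightarrow> norm (F x) \<le> M * W x"
  using assms by (auto simp: weighted_ball_def)

text \<open>
  The closedness of the ball is the theorem of Weierstrass: as the weight is bounded on \<open>A\<close>,
  convergence in the weighted norm is uniform, so that limits stay holomorphic. That the ball is mapped
  to itself follows from the contraction property, as the image of \<open>0\<close> has at most half the radius.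
\<close>
lemma holomorphic_contraction_fixpoint:
  fixes T :: "(complex \<Rightarrow> complex) \<Rightarrow> complex \<Rightarrow> complex" and W :: "complex \<Rightarrow> real"
  assumes A: "open A" and W: "\<And>x. x \<in> A \<Longrightarrow> 0 < W x" "\<And>x. x \<in> A \<Longrightarrow> W x \<le> w" and M: "0 \<le> M"
    and Th: "\<And>F. F \<in> weighted_ball A M W \<Longrightarrow> T F holomorphic_on A"
    and T0: "\<And>x. x \<in> A \<Longrightarrow> norm (T (\<lambda>_. 0) x) \<le> M / 2 * W x"
    and Tc: "\<And>F G c x. F \<in> weighted_ball A M W \<Longrightarrow> G \<in> weighted_ball A M W \<Longrightarrow> 0 \<le> c
               \<Longrightarrow> (\<And>x. x \<in> A \<Longrightarrow> norm (F x - G x) \<le> c * W x) \<Longrightarrow> x \<in> A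
               \<Longrightarrow> norm (T F x - T G x) \<le> c / 2 * W x"
  obtains F where "F \<in> weighted_ball A M W" "\<And>x. x \<in> A \<Longrightarrow> T F x = F x"
proof -
  let ?S = "weighted_ball A M W"
  note S_def = weighted_ball_def
  have zero: "(\<lambda>_. 0) \<in> ?S"
    using W(1) M by (auto simp: S_def intro: mult_nonneg_nonneg less_imp_le)
  have Tb: "norm (T F x) \<le> M * W x" if F: "F \<in> ?S" and x: "x \<in> A" for F x
  proof -
    have "norm (T F x - T (\<lambda>_. 0) x) \<le> M / 2 * W x"
      by (rule Tc[OF F zero M _ x]) (use weighted_ballD(2)[OF F] in simp)
    then show ?thesis using norm_triangle_sub[of "T F x" "T (\<lambda>_. 0) x"] T0[OF x] by simp
  qed
  obtain F where F: "F \<in> ?S" "\<And>x. x \<in> A \<Longrightarrow> T F x = F x"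
  proof (rule weighted_contraction_fixpoint[of "\<lambda>_. 0" ?S T A "2 * M" W, OF zero])
    show "T f \<in> ?S" if "f \<in> ?S" for f
      using Th[OF that] Tb[OF that] by (simp add: S_def)
    show "norm (f x - g x) \<le> 2 * M * W x" if "f \<in> ?S" "g \<in> ?S" "x \<in> A" for f g x
      using norm_triangle_ineq4[of "f x" "g x"] weighted_ballD(2)[OF that(1,3)] weighted_ballD(2)[OF that(2,3)]
      by simp
    show "norm (T f x - T g x) \<le> c / 2 * W x"
      if fg: "f \<in> ?S" "g \<in> ?S" and le: "\<And>x. x \<in> A \<Longrightarrow> norm (f x - g x) \<le> c * W x" and x: "x \<in> A" for f g c x
    proof (rule Tc[OF fg _ le x])
      have "0 \<le> c * W x"
        using le[OF x] norm_ge_zero[of "f x - g x"] by linarith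
      then show "0 \<le> c"
        using W(1)[OF x] by (simp add: zero_le_mult_iff)
    qed
    show "f \<in> ?S" if FS: "\<And>n. F n \<in> ?S"
      and le: "\<And>n x. x \<in> A \<Longrightarrow> norm (F n x - f x) \<le> 2 * (2 * M) * (1/2) ^ n * W x" for F f
    proof -
      have lim0: "(\<lambda>n. 2 * (2 * M) * (1/2) ^ n * v) \<longlonglongrightarrow> 0" for v :: real
        by (intro tendsto_mult_left_zero tendsto_mult_right_zero LIMSEQ_realpow_zero) auto
      have ev: "\<forall>\<^sub>F n in sequentially. 2 * (2 * M) * (1/2) ^ n * w < \<epsilon>" if "\<epsilon> > 0" for \<epsilon>
        by (rule order_tendstoD(2)[OF lim0 that])
      have unif: "uniform_limit A F f sequentially"
      proof (rule uniform_limitI)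
        fix \<epsilon> :: real assume "\<epsilon> > 0"
        from ev[OF this] show "\<forall>\<^sub>F n in sequentially. \<forall>x\<in>A. dist (F n x) (f x) < \<epsilon>"
        proof eventually_elim
          case (elim n)
          show ?case
          proof
            fix x assume x: "x \<in> A"
            have "2 * (2 * M) * (1/2) ^ n * W x \<le> 2 * (2 * M) * (1/2) ^ n * w"
              by (rule mult_left_mono[OF W(2)[OF x]]) (use M in auto)
            with le[OF x, of n] elim show "dist (F n x) (f x) < \<epsilon>"
              by (simp add: dist_norm)
          qed
        qed
      qed
      have "f holomorphic_on A"
      proof (rule holomorphic_uniform_sequence[OF A, of F])
        show "F n holomorphic_on A" for n
          using FS[of n] by (simp add: S_def)
        show "\<exists>d>0. cball x d \<subseteq> A \<and> uniform_limit (cball x d) F f sequentially" if x: "x \<in> A" for x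
        proof -
          obtain d where d: "d > 0" "cball x d \<subseteq> A"
            using A x open_contains_cball by blast
          show ?thesis using d uniform_limit_on_subset[OF unif d(2)] by blast
        qed
      qed
      moreover have "norm (f x) \<le> M * W x" if x: "x \<in> A" for x
      proof -
        have "(\<lambda>n. F n x - f x) \<longlonglongrightarrow> 0"
          by (rule Lim_null_comparison[OF _ lim0[of "W x"]]) (use le[OF x] in auto)
        then have "(\<lambda>n. F n x) \<longlonglongrightarrow> f x"
          by (rule LIM_zero_cancel)
        then have "(\<lambda>n. norm (F n x)) \<longlonglongrightarrow> norm (f x)"
          by (rule tendsto_norm)
        then show ?thesis
          by (rule LIMSEQ_le_const2) (use FS x in \<open>auto simp: S_def\<close>)
      qed
      ultimately show ?thesis by (simp add: S_def)
    qed
  qed blast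
  then show thesis by (rule that)
qed

section \<open>Laplace integrals along rays\<close>

lemma decreasing_to_zero_nonneg:
  fixes k b :: "real \<Rightarrow> real"
  assumes "\<And>s. 0 \<le> s \<Longrightarrow> (k has_real_derivative - b s) (at s)" "\<And>s. 0 \<le> s \<Longrightarrow> 0 \<le> b s"
    and "(k \<longlongrightarrow> 0) at_top" and "0 \<le> s"
  shows "0 \<le> k s"
proof (rule tendsto_upperbound[OF assms(3)])
  show "\<forall>\<^sub>F t in at_top. k t \<le> k s"
    using eventually_ge_at_top[of s]
  proof eventually_elim
    case (elim t)
    show ?case
    proof (rule DERIV_nonpos_imp_nonincreasing[OF elim])
      fix x assume "s \<le> x" "x \<le> t"
      then show "\<exists>y. (k has_real_derivative y) (at x) \<and> y \<le> 0"
        using assms(1)[of x] assms(2)[of x] assms(4) by (intro exI[of _ "- b x"]) auto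
    qed
  qed
qed auto

text \<open>
  The majorant \<open>b\<close> is given together with a primitive \<open>- k\<close> that vanishes at infinity,
  so that \<open>k n\<close> is the value of its tail integral. All majorants below are elementary, and
  this form gives existence of the limit, the size of the remainder and a bound at once.
\<close>
lemma improper_integral_bound:
  fixes f :: "real \<Rightarrow> complex" and k b :: "real \<Rightarrow> real"
  assumes cont: "continuous_on {0..} f" and bnd: "\<And>s. 0 \<le> s \<Longrightarrow> norm (f s) \<le> b s"
    and k: "\<And>s. 0 \<le> s \<Longrightarrow> (k has_real_derivative - b s) (at s)" and k0: "(k \<longlongrightarrow> 0) at_top"
  shows "\<exists>L. (\<lambda>n. integral {0..real n} f) \<longlonglongrightarrow> L \<and>
            (\<forall>n. norm (L - integral {0..real n} f) \<le> k (real n))"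
proof -
  let ?I = "\<lambda>n. integral {0..real n} f"
  have b0: "0 \<le> b s" if "0 \<le> s" for s
    using bnd[OF that] norm_ge_zero[of "f s"] by linarith
  have kpos: "0 \<le> k s" if "0 \<le> s" for s
    by (rule decreasing_to_zero_nonneg[OF k b0 k0 that])
  have near: "norm (?I m - ?I n) \<le> k (real n)" if "n \<le> m" for m n
  proof -
    have int: "f integrable_on {0..real m}"
      by (intro integrable_continuous_real continuous_on_subset[OF cont]) auto
    have "?I m - ?I n = integral {real n..real m} f"
      using Henstock_Kurzweil_Integration.integral_combine[OF _ _ int, of "real n"] that
      by (simp add: algebra_simps)
    also have "norm \<dots> \<le> k (real n) - k (real m)"
    proof -
      have hi: "(b has_integral (- k (real m)) - (- k (real n))) {real n..real m}"
      proof (rule fundamental_theorem_of_calculus)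
        show "((\<lambda>s. - k s) has_vector_derivative b s) (at s within {real n..real m})"
          if "s \<in> {real n..real m}" for s
          using DERIV_minus[OF k[of s]] that
          by (auto simp: has_real_derivative_iff_has_vector_derivative[symmetric]
              intro: has_field_derivative_at_within)
      qed (use that in auto)
      have "norm (integral {real n..real m} f) \<le> integral {real n..real m} b"
        by (rule integral_norm_bound_integral[OF _ has_integral_integrable[OF hi]])
          (use bnd in \<open>auto intro!: integrable_continuous_real continuous_on_subset[OF cont]\<close>)
      then show ?thesis using integral_unique[OF hi] by simp
    qed
    finally show ?thesis using kpos[of "real m"] by simp
  qed
  have kn: "(\<lambda>n. k (real n)) \<longlonglongrightarrow> 0"
    using k0 filterlim_real_sequentially by (rule filterlim_compose)
  have "Cauchy ?I"
  proof (rule CauchyI')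
    fix e :: real assume "e > 0"
    then obtain n0 where n0: "\<And>n. n \<ge> n0 \<Longrightarrow> k (real n) < e"
      using order_tendstoD(2)[OF kn, of e] by (auto simp: eventually_sequentially)
    show "\<exists>M. \<forall>m\<ge>M. \<forall>n>m. dist (?I m) (?I n) < e"
    proof (intro exI allI impI)
      fix m n assume "n0 \<le> m" "m < n"
      then show "dist (?I m) (?I n) < e"
        using near[of m n] n0[of m] by (simp add: dist_norm norm_minus_commute)
    qed
  qed
  then obtain L where L: "?I \<longlonglongrightarrow> L"
    using Cauchy_convergent convergent_def by blast
  have "norm (L - ?I n) \<le> k (real n)" for n
  proof (rule LIMSEQ_le_const2)
    show "(\<lambda>m. norm (?I m - ?I n)) \<longlonglongrightarrow> norm (L - ?I n)"
      by (intro tendsto_intros L)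
  qed (use near in blast)
  with L show ?thesis by blast
qed

text \<open>
  The integral of \<open>exp (- \<mu> (t - x) / e) F t\<close> over the ray from \<open>x\<close> in direction
  \<open>e\<close>. Up to sign it is the solution of \<open>J' = (\<mu> / e) J - F\<close> that is singled out by its
  behaviour at the end of the ray.
\<close>
definition laplace_ray :: "complex \<Rightarrow> complex \<Rightarrow> (complex \<Rightarrow> complex) \<Rightarrow> complex \<Rightarrow> complex" where
  "laplace_ray \<mu> e F x =
     lim (\<lambda>n. e * integral {0..real n} (\<lambda>s. exp (- \<mu> * of_real s) * F (x + of_real s * e)))"

context
  fixes A :: "complex set" and e \<mu> :: complex
  assumes A: "open A" "convex A" and e: "norm e = 1"
    and shift: "\<And>x s. x \<in> A \<Longrightarrow> 0 \<le> s \<Longrightarrow> x + of_real s * e \<in> A"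
begin

lemma ray_integrand_continuous:
  assumes "F holomorphic_on A" "x \<in> A"
  shows "continuous_on {0..} (\<lambda>s. exp (- \<mu> * of_real s) * F (x + of_real s * e))"
  by (intro continuous_intros continuous_on_compose2[OF holomorphic_on_imp_continuous_on[OF assms(1)]])
    (use shift assms in auto)

lemma laplace_ray_lim:
  assumes "F holomorphic_on A" "x \<in> A"
    and bnd: "\<And>s. 0 \<le> s \<Longrightarrow> norm (exp (- \<mu> * of_real s) * F (x + of_real s * e)) \<le> b s"
    and k: "\<And>s. 0 \<le> s \<Longrightarrow> (k has_real_derivative - b s) (at s)" and k0: "(k \<longlongrightarrow> 0) at_top"
  shows "(\<lambda>n. e * integral {0..real n} (\<lambda>s. exp (- \<mu> * of_real s) * F (x + of_real s * e)))
            \<longlonglongrightarrow> laplace_ray \<mu> e F x" (is "?I \<longlonglongrightarrow> _")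
    and "norm (laplace_ray \<mu> e F x
           - e * integral {0..real n} (\<lambda>s. exp (- \<mu> * of_real s) * F (x + of_real s * e))) \<le> k (real n)"
    and "norm (laplace_ray \<mu> e F x) \<le> k 0"
proof -
  obtain L where L: "(\<lambda>n. integral {0..real n} (\<lambda>s. exp (- \<mu> * of_real s) * F (x + of_real s * e))) \<longlonglongrightarrow> L"
    "\<And>n. norm (L - integral {0..real n} (\<lambda>s. exp (- \<mu> * of_real s) * F (x + of_real s * e))) \<le> k (real n)"
    using improper_integral_bound[OF ray_integrand_continuous[OF assms(1,2)] bnd k k0] by blast
  have lim: "?I \<longlonglongrightarrow> e * L"
    by (intro tendsto_intros L)
  then have eq: "laplace_ray \<mu> e F x = e * L"
    unfolding laplace_ray_def by (rule limI)
  show "?I \<longlonglongrightarrow> laplace_ray \<mu> e F x"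
    using lim eq by simp
  show *: "norm (laplace_ray \<mu> e F x
           - e * integral {0..real n} (\<lambda>s. exp (- \<mu> * of_real s) * F (x + of_real s * e))) \<le> k (real n)" for n
    using L(2)[of n] e unfolding eq by (simp add: norm_mult flip: right_diff_distrib)
  show "norm (laplace_ray \<mu> e F x) \<le> k 0"
    using *[of 0] by simp
qed

lemma laplace_ray_diff:
  assumes F: "F holomorphic_on A" "G holomorphic_on A" and x: "x \<in> A"
    and "\<And>s. 0 \<le> s \<Longrightarrow> norm (exp (- \<mu> * of_real s) * F (x + of_real s * e)) \<le> b s"
    and "\<And>s. 0 \<le> s \<Longrightarrow> (k has_real_derivative - b s) (at s)" "(k \<longlongrightarrow> 0) at_top"
    and "\<And>s. 0 \<le> s \<Longrightarrow> norm (exp (- \<mu> * of_real s) * G (x + of_real s * e)) \<le> b' s"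
    and "\<And>s. 0 \<le> s \<Longrightarrow> (k' has_real_derivative - b' s) (at s)" "(k' \<longlongrightarrow> 0) at_top"
    and bnd: "\<And>s. 0 \<le> s \<Longrightarrow> norm (exp (- \<mu> * of_real s) * (F (x + of_real s * e) - G (x + of_real s * e))) \<le> c s"
    and "\<And>s. 0 \<le> s \<Longrightarrow> (l has_real_derivative - c s) (at s)" "(l \<longlongrightarrow> 0) at_top"
  shows "norm (laplace_ray \<mu> e F x - laplace_ray \<mu> e G x) \<le> l 0"
proof -
  let ?f = "\<lambda>F s. exp (- \<mu> * of_real s) * F (x + of_real s * e)"
  have hFG: "(\<lambda>y. F y - G y) holomorphic_on A"
    by (intro holomorphic_intros F)
  have int: "?f F integrable_on {0..real n}" if "F holomorphic_on A" for F n
    by (intro integrable_continuous_real continuous_on_subset[OF ray_integrand_continuous[OF that x]]) auto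
  have "(\<lambda>n. e * integral {0..real n} (?f F) - e * integral {0..real n} (?f G))
     \<longlonglongrightarrow> laplace_ray \<mu> e F x - laplace_ray \<mu> e G x"
    by (rule tendsto_diff[OF laplace_ray_lim(1)[OF F(1) x assms(4-6)] laplace_ray_lim(1)[OF F(2) x assms(7-9)]])
  moreover have "e * integral {0..real n} (?f F) - e * integral {0..real n} (?f G)
     = e * integral {0..real n} (?f (\<lambda>y. F y - G y))" for n
    using Henstock_Kurzweil_Integration.integral_diff[OF int[OF F(1)] int[OF F(2)], of n]
    by (simp add: right_diff_distrib)
  moreover have "(\<lambda>n. e * integral {0..real n} (?f (\<lambda>y. F y - G y))) \<longlonglongrightarrow> laplace_ray \<mu> e (\<lambda>y. F y - G y) x"
    by (rule laplace_ray_lim(1)[OF hFG x bnd assms(11,12)])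
  ultimately have eq: "laplace_ray \<mu> e F x - laplace_ray \<mu> e G x = laplace_ray \<mu> e (\<lambda>y. F y - G y) x"
    using LIMSEQ_unique by fastforce
  show ?thesis
    unfolding eq by (rule laplace_ray_lim(3)[OF hFG x bnd assms(11,12)])
qed

text \<open>
  On a convex set the integrand \<open>exp (- \<mu> t / e) F t\<close> has a primitive, so each truncated integral
  is an explicit holomorphic function with a known derivative. The truncated integrals converge
  uniformly, hence so do their derivatives, and the boundary term at the far end tends to zero.
\<close>
lemma laplace_ray_deriv:
  assumes F: "F holomorphic_on A"
    and bnd: "\<And>x s. x \<in> A \<Longrightarrow> 0 \<le> s \<Longrightarrow> norm (exp (- \<mu> * of_real s) * F (x + of_real s * e)) \<le> b s"
    and k: "\<And>s. 0 \<le> s \<Longrightarrow> (k has_real_derivative - b s) (at s)" and k0: "(k \<longlongrightarrow> 0) at_top"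
    and b0: "(b \<longlongrightarrow> 0) at_top" and x: "x \<in> A"
  shows "(laplace_ray \<mu> e F has_field_derivative \<mu> / e * laplace_ray \<mu> e F x - F x) (at x)"
proof -
  let ?I = "\<lambda>n x. e * integral {0..real n} (\<lambda>s. exp (- \<mu> * of_real s) * F (x + of_real s * e))"
  have e0: "e \<noteq> 0" using e by auto
  (* Factoring out exp (mu z / e) makes the integrand depend on the point of the ray only, not on its
     initial point. *)
  define g where "g z = exp (- \<mu> * z / e) * F z" for z
  have "g holomorphic_on A"
    unfolding g_def by (intro holomorphic_intros F) (use e0 in auto)
  then obtain \<Phi> where \<Phi>: "\<And>z. z \<in> A \<Longrightarrow> (\<Phi> has_field_derivative g z) (at z)"
    using holomorphic_convex_primitive'[OF A(2,1)] A(1) by (metis at_within_open)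
  have I_eq: "?I n z = exp (\<mu> * z / e) * (\<Phi> (z + of_nat n * e) - \<Phi> z)" if "z \<in> A" for n z
  proof -
    have "((\<lambda>s. e * exp (- \<mu> * z / e) * (exp (- \<mu> * of_real s) * F (z + of_real s * e)))
             has_integral \<Phi> (z + of_real (real n) * e) - \<Phi> (z + of_real 0 * e)) {0..real n}"
    proof (rule fundamental_theorem_of_calculus)
      fix s assume s: "s \<in> {0..real n}"
      have zs: "z + of_real s * e \<in> A" using shift that s by auto
      have "((\<lambda>s. z + of_real s * e) has_vector_derivative e) (at s within {0..real n})"
        by (auto intro!: derivative_eq_intros)
      from field_vector_diff_chain_within[OF this has_field_derivative_at_within[OF \<Phi>[OF zs]]]
      have "((\<lambda>s. \<Phi> (z + of_real s * e)) has_vector_derivative e * g (z + of_real s * e))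
            (at s within {0..real n})" by (simp add: o_def)
      also have "e * g (z + of_real s * e)
          = e * exp (- \<mu> * z / e) * (exp (- \<mu> * of_real s) * F (z + of_real s * e))"
      proof -
        have E: "- \<mu> * (z + of_real s * e) / e = - \<mu> * z / e + - \<mu> * of_real s"
          using e0 by (simp add: field_simps)
        show ?thesis unfolding g_def E exp_add by (simp only: mult_ac)
      qed
      finally show "((\<lambda>s. \<Phi> (z + of_real s * e)) has_vector_derivative
           e * exp (- \<mu> * z / e) * (exp (- \<mu> * of_real s) * F (z + of_real s * e)))
            (at s within {0..real n})" .
    qed auto
    then have "((\<lambda>s. exp (\<mu> * z / e) * (e * exp (- \<mu> * z / e) * (exp (- \<mu> * of_real s) * F (z + of_real s * e))))
             has_integral exp (\<mu> * z / e) * (\<Phi> (z + of_real (real n) * e) - \<Phi> (z + of_real 0 * e))) {0..real n}"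
      by (rule has_integral_mult_right)
    moreover have "exp (\<mu> * z / e) * (e * exp (- \<mu> * z / e) * w) = e * w" for w
    proof -
      have "exp (\<mu> * z / e) * exp (- \<mu> * z / e) = 1"
        by (simp flip: exp_add)
      then show ?thesis by algebra
    qed
    ultimately have "((\<lambda>s. e * (exp (- \<mu> * of_real s) * F (z + of_real s * e)))
             has_integral exp (\<mu> * z / e) * (\<Phi> (z + of_nat n * e) - \<Phi> z)) {0..real n}"
      by (simp only: of_real_0 mult_zero_left add_0_right of_real_of_nat_eq)
    from integral_unique[OF this] show ?thesis
      by (simp only: integral_mult_right)
  qed
  have I_deriv: "(?I n has_field_derivative
      (\<mu> / e * ?I n z + (exp (- \<mu> * of_nat n) * F (z + of_nat n * e) - F z))) (at z)" if z: "z \<in> A" for n z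
  proof -
    have zn: "z + of_nat n * e \<in> A" using shift[OF z, of "real n"] by simp
    have "((\<lambda>z. exp (\<mu> * z / e) * (\<Phi> (z + of_nat n * e) - \<Phi> z)) has_field_derivative
       exp (\<mu> * z / e) * (\<mu> / e) * (\<Phi> (z + of_nat n * e) - \<Phi> z)
        + exp (\<mu> * z / e) * (g (z + of_nat n * e) - g z)) (at z)"
    proof -
      have 1: "((\<lambda>z. exp (\<mu> * z / e)) has_field_derivative exp (\<mu> * z / e) * (\<mu> / e)) (at z)"
        using e0 by (auto intro!: derivative_eq_intros)
      have 2: "((\<lambda>z. \<Phi> (z + of_nat n * e)) has_field_derivative g (z + of_nat n * e)) (at z)"
        using \<Phi>[OF zn] by (simp only: DERIV_shift)
      from DERIV_mult[OF 1 DERIV_diff[OF 2 \<Phi>[OF z]]] show ?thesis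
        by (simp add: mult_ac add.commute)
    qed
    moreover have "exp (\<mu> * z / e) * (g (z + of_nat n * e) - g z)
        = exp (- \<mu> * of_nat n) * F (z + of_nat n * e) - F z"
    proof -
      have E: "- \<mu> * (z + of_nat n * e) / e = - \<mu> * z / e + - \<mu> * of_nat n"
        using e0 by (simp add: field_simps)
      have "exp (\<mu> * z / e) * exp (- \<mu> * z / e) = 1"
        by (simp flip: exp_add)
      then show ?thesis unfolding g_def E exp_add
        by algebra
    qed
    ultimately have "((\<lambda>z. exp (\<mu> * z / e) * (\<Phi> (z + of_nat n * e) - \<Phi> z)) has_field_derivative
       (\<mu> / e * ?I n z + (exp (- \<mu> * of_nat n) * F (z + of_nat n * e) - F z))) (at z)"
      using I_eq[OF z] by (simp add: mult_ac)
    then show ?thesis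
      by (rule has_field_derivative_transform_within_open[OF _ A(1) z]) (use I_eq in simp)
  qed
  have unif: "\<exists>d. 0 < d \<and> cball z d \<subseteq> A \<and> uniform_limit (cball z d) ?I (laplace_ray \<mu> e F) sequentially"
    if z: "z \<in> A" for z
  proof -
    obtain d where d: "d > 0" "cball z d \<subseteq> A"
      using A(1) z open_contains_cball by blast
    have kn: "(\<lambda>n. k (real n)) \<longlonglongrightarrow> 0"
      using k0 filterlim_real_sequentially by (rule filterlim_compose)
    have "uniform_limit (cball z d) ?I (laplace_ray \<mu> e F) sequentially"
    proof (rule uniform_limitI)
      fix \<epsilon> :: real assume "\<epsilon> > 0"
      then have ev: "\<forall>\<^sub>F n in sequentially. k (real n) < \<epsilon>"
        by (rule order_tendstoD(2)[OF kn])
      show "\<forall>\<^sub>F n in sequentially. \<forall>x\<in>cball z d. dist (?I n x) (laplace_ray \<mu> e F x) < \<epsilon>"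
        using ev
      proof eventually_elim
        case (elim n)
        show ?case
        proof
          fix y assume "y \<in> cball z d"
          then have y: "y \<in> A" using d(2) by blast
          show "dist (?I n y) (laplace_ray \<mu> e F y) < \<epsilon>"
            using laplace_ray_lim(2)[OF F y bnd[OF y] k k0, of n] elim
            by (simp add: dist_norm norm_minus_commute)
        qed
      qed
    qed
    with d show ?thesis by blast
  qed
  obtain g' where g': "\<And>x. x \<in> A \<Longrightarrow> (laplace_ray \<mu> e F has_field_derivative g' x) (at x)"
    "\<And>x. x \<in> A \<Longrightarrow> (\<lambda>n. \<mu> / e * ?I n x + (exp (- \<mu> * of_nat n) * F (x + of_nat n * e) - F x)) \<longlonglongrightarrow> g' x"
    using has_complex_derivative_uniform_sequence[OF A(1) I_deriv unif] by blast
  have bn: "(\<lambda>n. b (real n)) \<longlonglongrightarrow> 0"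
    using b0 filterlim_real_sequentially by (rule filterlim_compose)
  have "(\<lambda>n. exp (- \<mu> * of_nat n) * F (x + of_nat n * e)) \<longlonglongrightarrow> 0"
    by (rule Lim_null_comparison[OF _ bn]) (use bnd[OF x, of "real _"] in auto)
  then have "(\<lambda>n. \<mu> / e * ?I n x + (exp (- \<mu> * of_nat n) * F (x + of_nat n * e) - F x))
       \<longlonglongrightarrow> \<mu> / e * laplace_ray \<mu> e F x + (0 - F x)"
    by (intro tendsto_intros laplace_ray_lim(1)[OF F x bnd[OF x] k k0])
  with g'(2)[OF x] have "g' x = \<mu> / e * laplace_ray \<mu> e F x - F x"
    using LIMSEQ_unique by fastforce
  with g'(1)[OF x] show ?thesis by simp
qed

end

section \<open>Decaying solutions in half planes\<close>

definition half_plane :: "complex \<Rightarrow> real \<Rightarrow> complex set" where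
  "half_plane m R = {x. R < m \<bullet> x}"

lemma half_plane_open: "open (half_plane m R)"
  and half_plane_convex: "convex (half_plane m R)"
  unfolding half_plane_def by (simp_all add: open_halfspace_gt convex_halfspace_gt)

lemma half_plane_norm: "x \<in> half_plane m R \<Longrightarrow> norm m = 1 \<Longrightarrow> R < norm x"
  unfolding half_plane_def using norm_cauchy_schwarz[of m x] by simp

text \<open>
  The half plane \<open>half_plane (d e) R\<close> is bounded by a line in direction \<open>e\<close>, hence is invariant
  under translations by real multiples of \<open>e\<close>. As \<open>Re e > 0\<close>, the factor \<open>exp (- e s)\<close>
  decays, and a function that is \<open>O(1 / x)\<close> can be integrated along both rays of direction
  \<open>e\<close> and \<open>- e\<close>.
\<close>
context
  fixes e d e' :: complex and R \<kappa> c :: real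
  assumes e: "norm e = 1" and c: "c = Re e" "0 < c" and d: "d = \<i> \<or> d = -\<i>"
    and e': "e' = e \<or> e' = - e" and R: "1 \<le> R" and \<kappa>: "\<kappa> = 1 / c + 1 / c\<^sup>2"
begin

lemma half_plane_shift:
  assumes "x \<in> half_plane (d * e) R" "0 \<le> s" shows "x + of_real s * e' \<in> half_plane (d * e) R"
  using assms d e' by (auto simp: half_plane_def inner_complex_def algebra_simps)

lemma half_plane_norm1: "x \<in> half_plane (d * e) R \<Longrightarrow> 1 < norm x"
proof -
  assume x: "x \<in> half_plane (d * e) R"
  have "norm (d * e) = 1" using d e by (auto simp: norm_mult)
  from half_plane_norm[OF x this] R show ?thesis by simp
qed

lemma laplace_weight_deriv:
  "((\<lambda>s. M * ((1 + s) / c + 1 / c\<^sup>2) * exp (- c * s)) has_real_derivative - (M * (1 + s) * exp (- c * s))) (at s)"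
  by (rule derivative_eq_intros refl | use c in \<open>simp add: field_simps power2_eq_square\<close>)+

lemma laplace_weight_lim: "((\<lambda>s. M * ((1 + s) / c + 1 / c\<^sup>2) * exp (- c * s)) \<longlongrightarrow> 0) at_top"
  "((\<lambda>s. M * (1 + s) * exp (- c * s)) \<longlongrightarrow> 0) at_top"
  using c by real_asymp+

lemma half_plane_integrand_bound:
  assumes F: "\<And>x. x \<in> half_plane (d * e) R \<Longrightarrow> norm (F x) \<le> M * (1 / norm x)"
    and x: "x \<in> half_plane (d * e) R" and s: "0 \<le> s"
  shows "norm (exp (- e * of_real s) * F (x + of_real s * e')) \<le> M / norm x * (1 + s) * exp (- c * s)"
    and "norm (exp (- e * of_real s) * F (x + of_real s * e')) \<le> M * (1 + s) * exp (- c * s)"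
proof -
  let ?y = "x + of_real s * e'"
  have x1: "1 < norm x" by (rule half_plane_norm1[OF x])
  have y: "?y \<in> half_plane (d * e) R" by (rule half_plane_shift[OF x s])
  have y1: "1 < norm ?y" by (rule half_plane_norm1[OF y])
  have M: "0 \<le> M"
  proof -
    have "0 \<le> M / norm x" using order_trans[OF norm_ge_zero F[OF x]] by simp
    then show ?thesis using x1 by (auto simp: zero_le_divide_iff)
  qed
  have e'1: "norm e' = 1" using e e' by auto
  have "norm x \<le> norm ?y + s"
    (* Moving by s changes 1 / |x| at most by the factor 1 + s because |y| > 1; the exponential absorbs
       this factor. *)
    using norm_triangle_ineq4[of ?y "of_real s * e'"] s e'1 by (simp add: norm_mult)
  also have "\<dots> \<le> norm ?y * (1 + s)"
    using mult_left_mono[OF less_imp_le[OF y1] s] by (simp add: algebra_simps)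
  finally have "norm x \<le> (1 + s) * norm ?y" by (simp only: mult.commute)
  moreover have "norm x > 0" "norm ?y > 0" using x1 y1 by linarith+
  ultimately have "1 / norm ?y \<le> (1 + s) / norm x"
    by (simp add: divide_simps)
  then have "M * (1 / norm ?y) \<le> M * ((1 + s) / norm x)"
    using M by (rule mult_left_mono)
  with F[OF y] have Fy: "norm (F ?y) \<le> M / norm x * (1 + s)" by simp
  have "norm (exp (- e * of_real s)) = exp (- c * s)"
    using c by (simp add: norm_exp_eq_Re)
  then have eq: "norm (exp (- e * of_real s) * F ?y) = norm (F ?y) * exp (- c * s)"
    by (simp add: norm_mult)
  show 1: "norm (exp (- e * of_real s) * F ?y) \<le> M / norm x * (1 + s) * exp (- c * s)"
    unfolding eq by (rule mult_right_mono[OF Fy]) auto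
  have "M / norm x \<le> M" using x1 M by (simp add: divide_le_eq mult_le_cancel_left1)
  then have "M / norm x * (1 + s) * exp (- c * s) \<le> M * (1 + s) * exp (- c * s)"
    by (intro mult_right_mono) (use s in auto)
  with 1 show "norm (exp (- e * of_real s) * F ?y) \<le> M * (1 + s) * exp (- c * s)" by linarith
qed

lemma half_plane_laplace_deriv:
  assumes F: "F \<in> weighted_ball (half_plane (d * e) R) M (\<lambda>x. 1 / norm x)"
    and x: "x \<in> half_plane (d * e) R"
  shows "(laplace_ray e e' F has_field_derivative e / e' * laplace_ray e e' F x - F x) (at x)"
proof -
  have e'1: "norm e' = 1" using e e' by auto
  show ?thesis
    by (rule laplace_ray_deriv[OF half_plane_open half_plane_convex e'1 half_plane_shift weighted_ballD(1)[OF F]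
          half_plane_integrand_bound(2)[OF weighted_ballD(2)[OF F]] laplace_weight_deriv laplace_weight_lim x])
qed

lemma half_plane_laplace_bound:
  assumes F: "F \<in> weighted_ball (half_plane (d * e) R) M (\<lambda>x. 1 / norm x)"
    and x: "x \<in> half_plane (d * e) R"
  shows "norm (laplace_ray e e' F x) \<le> \<kappa> * M / norm x"
proof -
  have e'1: "norm e' = 1" using e e' by auto
  have "norm (laplace_ray e e' F x) \<le> M / norm x * ((1 + 0) / c + 1 / c\<^sup>2) * exp (- c * 0)"
    by (rule laplace_ray_lim(3)[OF half_plane_open half_plane_convex e'1 half_plane_shift weighted_ballD(1)[OF F] x
          half_plane_integrand_bound(1)[OF weighted_ballD(2)[OF F] x] laplace_weight_deriv laplace_weight_lim(1)])
  then show ?thesis by (simp add: \<kappa> mult_ac)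
qed

lemma half_plane_laplace_diff:
  assumes F: "F \<in> weighted_ball (half_plane (d * e) R) M (\<lambda>x. 1 / norm x)"
    and G: "G \<in> weighted_ball (half_plane (d * e) R) M (\<lambda>x. 1 / norm x)"
    and FG: "\<And>x. x \<in> half_plane (d * e) R \<Longrightarrow> norm (F x - G x) \<le> C * (1 / norm x)"
    and x: "x \<in> half_plane (d * e) R"
  shows "norm (laplace_ray e e' F x - laplace_ray e e' G x) \<le> \<kappa> * C / norm x"
proof -
  have e'1: "norm e' = 1" using e e' by auto
  have "norm (laplace_ray e e' F x - laplace_ray e e' G x)
      \<le> C / norm x * ((1 + 0) / c + 1 / c\<^sup>2) * exp (- c * 0)"
    by (rule laplace_ray_diff[OF half_plane_open half_plane_convex e'1 half_plane_shift weighted_ballD(1)[OF F] weighted_ballD(1)[OF G] x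
          half_plane_integrand_bound(1)[OF weighted_ballD(2)[OF F] x] laplace_weight_deriv laplace_weight_lim(1)
          half_plane_integrand_bound(1)[OF weighted_ballD(2)[OF G] x] laplace_weight_deriv laplace_weight_lim(1)
          half_plane_integrand_bound(1)[of "\<lambda>y. F y - G y", OF FG x] laplace_weight_deriv laplace_weight_lim(1)])
  then show ?thesis by (simp add: \<kappa> mult_ac)
qed

end

lemma half_sum_norm_le:
  fixes p q :: complex
  assumes "norm p \<le> b" "norm q \<le> b"
  shows "norm ((p - q) / 2) \<le> b" "norm ((p + q) / 2) \<le> b"
proof -
  have "norm (p - q) \<le> 2 * b" "norm (p + q) \<le> 2 * b"
    using norm_triangle_ineq[of p q] norm_triangle_ineq4[of p q] assms by linarith+
  then show "norm ((p - q) / 2) \<le> b" "norm ((p + q) / 2) \<le> b"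
    by (simp_all add: norm_divide)
qed

text \<open>
  The equation \<open>u'' + u' / x = N x u\<close> with \<open>N x u\<close> equal to \<open>u\<close> up to terms that are
  small for small \<open>u\<close> and large \<open>x\<close>; for \<open>N x u = sin u cos u\<close> it is a pendulum. Two
  estimates control the perturbation: the forcing at \<open>u = 0\<close> is \<open>O(1 / x)\<close>, and the derivative of
  \<open>N x u - u\<close> in \<open>u\<close> is quadratically small in \<open>u\<close> and \<open>1 / x\<close>. The exponent two
  matters: for \<open>u = O(1 / x)\<close> it makes the linearised equation an \<open>O(x\<^sup>-\<^sup>2)\<close>, hence
  integrable, perturbation of \<open>u'' = u\<close>.
\<close>
locale forced_pendulum =
  fixes N :: "complex \<Rightarrow> complex \<Rightarrow> complex" and K :: real
  assumes K: "1 \<le> K"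
    and N_lip: "\<And>x a b. 1 \<le> norm x \<Longrightarrow> norm a \<le> 1/2 \<Longrightarrow> norm b \<le> 1/2
        \<Longrightarrow> norm (N x a - N x b - (a - b)) \<le> K * (norm a + norm b + 1 / norm x)\<^sup>2 * norm (a - b)"
    and N_0: "\<And>x. 1 \<le> norm x \<Longrightarrow> norm (N x 0) \<le> K / norm x"
    and N_holomorphic: "\<And>A f. open A \<Longrightarrow> (\<And>x. x \<in> A \<Longrightarrow> 1 \<le> norm x) \<Longrightarrow> f holomorphic_on A
        \<Longrightarrow> (\<And>x. x \<in> A \<Longrightarrow> norm (f x) \<le> 1/2) \<Longrightarrow> (\<lambda>x. N x (f x)) holomorphic_on A"
begin

definition solves :: "(complex \<Rightarrow> complex) \<Rightarrow> complex \<Rightarrow> bool" where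
  "solves f x \<longleftrightarrow> deriv (deriv f) x + deriv f x / x = N x (f x)"

definition decaying_solution :: "complex set \<Rightarrow> real \<Rightarrow> (complex \<Rightarrow> complex) \<Rightarrow> bool" where
  "decaying_solution A M u \<longleftrightarrow> u holomorphic_on A \<and>
     (\<forall>x\<in>A. norm (u x) \<le> M / norm x \<and> norm (u x) \<le> 1/2 \<and> solves u x)"

lemma decaying_solutionD:
  assumes "decaying_solution A M u"
  shows "u holomorphic_on A" "x \<in> A \<Longrightarrow> norm (u x) \<le> M / norm x" "x \<in> A \<Longrightarrow> norm (u x) \<le> 1/2"
    "x \<in> A \<Longrightarrow> solves u x"
  using assms by (auto simp: decaying_solution_def)

lemma decaying_solution_mono:
  assumes u: "decaying_solution A M u" and "B \<subseteq> A" "M \<le> M'"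
  shows "decaying_solution B M' u"
proof -
  have M: "M / norm x \<le> M' / norm x" for x :: complex
    by (intro divide_right_mono) (use assms in auto)
  show ?thesis
    unfolding decaying_solution_def
  proof (intro conjI ballI)
    show "u holomorphic_on B" by (rule holomorphic_on_subset[OF decaying_solutionD(1)[OF u] assms(2)])
    fix x assume "x \<in> B"
    then have x: "x \<in> A" using assms(2) by blast
    show "norm (u x) \<le> M' / norm x" using decaying_solutionD(2)[OF u x] M[of x] by linarith
    show "norm (u x) \<le> 1/2" "solves u x" using decaying_solutionD(3,4)[OF u x] by auto
  qed
qed

text \<open>
  With \<open>p = u' + u\<close> and \<open>q = u' - u\<close> the equation reads \<open>p' = p + F\<close>, \<open>q' = - q + F\<close>
  for \<open>F = N x u - u - u' / x\<close>. Integrating the first from the right end and the second from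
  the left end of the line through \<open>x\<close> in direction \<open>e\<close> expresses \<open>u\<close> and \<open>u'\<close> by
  \<open>F\<close>, and the equation becomes a fixed point problem for \<open>F\<close> alone. The map is a contraction
  on \<open>O(1 / x)\<close> functions for large \<open>R\<close>, since it gains a factor \<open>1 / x\<close> except for the
  inhomogeneous term \<open>N x 0\<close>.
\<close>
lemma half_plane_solution:
  assumes e: "norm e = 1" "0 < Re e" and d: "d = \<i> \<or> d = - \<i>"
  obtains R M u where "1 \<le> R" "decaying_solution (half_plane (d * e) R) M u"
proof -
  define c where "c = Re e"
  have c: "0 < c" using e by (simp add: c_def)
  define \<kappa> where "\<kappa> = 1 / c + 1 / c\<^sup>2"
  have \<kappa>: "0 < \<kappa>" using c by (simp add: \<kappa>_def add_pos_pos)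
  (* The ball has twice the size of the inhomogeneous term. R is chosen such that the arguments of N are
     at most 1/2 and the map halves distances. *)
  define M where "M = 2 * K"
  have M: "2 \<le> M" using K by (simp add: M_def)
  define L where "L = K * (2 * \<kappa> * M + 1)\<^sup>2 + 1"
  have L: "1 \<le> L" using K by (simp add: L_def)
  define R where "R = 1 + 2 * \<kappa> * M + 2 * \<kappa> * L"
  have pos: "0 \<le> \<kappa> * M" "0 \<le> \<kappa> * L"
    using \<kappa> M L by (auto intro!: mult_nonneg_nonneg)
  have R: "1 \<le> R" "2 * (\<kappa> * M) \<le> R" "2 * (\<kappa> * L) \<le> R"
    using pos unfolding R_def by linarith+
  define H where "H = half_plane (d * e) R"
  have H: "open H" "convex H" by (auto simp: H_def half_plane_open half_plane_convex)
  have de: "norm (d * e) = 1" using d e by (auto simp: norm_mult)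
  have nR: "R < norm x" if "x \<in> H" for x
    using half_plane_norm[OF _ de, of x R] that by (simp add: H_def)
  have n1: "1 < norm x" if "x \<in> H" for x
    using nR[OF that] R by simp
  have rbound: "0 < 1 / norm x" "1 / norm x * R \<le> 1" "1 / norm x \<le> 1" if "x \<in> H" for x
  proof -
    have "0 < norm x" "R \<le> norm x" "1 \<le> norm x"
      using nR[OF that] R(1) by linarith+
    then show "0 < 1 / norm x" "1 / norm x * R \<le> 1" "1 / norm x \<le> 1"
      by (auto simp: divide_simps)
  qed
  define p where "p F x = - laplace_ray e e F x" for F x
  define q where "q F x = - laplace_ray e (- e) F x" for F x
  define u where "u F x = (p F x - q F x) / 2" for F x
  define u' where "u' F x = (p F x + q F x) / 2" for F x
  define T where "T F x = N x (u F x) - u F x - u' F x / x" for F x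
  note hp = e(1) c_def c d
  have e0: "e \<noteq> 0" using e by auto
  define S where "S = weighted_ball H M (\<lambda>x. 1 / norm x)"
  have SD: "F \<in> weighted_ball (half_plane (d * e) R) M (\<lambda>x. 1 / norm x)" if "F \<in> S" for F
    using that by (simp add: S_def H_def)
  have HD: "x \<in> half_plane (d * e) R" if "x \<in> H" for x using that by (simp add: H_def)
  note right = hp disjI1[OF refl] R(1) \<kappa>_def and left = hp disjI2[OF refl] R(1) \<kappa>_def
  have derivs: "(p F has_field_derivative p F x + F x) (at x)"
    "(q F has_field_derivative - q F x + F x) (at x)" if F: "F \<in> S" and x: "x \<in> H" for F x
    using DERIV_minus[OF half_plane_laplace_deriv[OF right SD[OF F] HD[OF x]]]
      DERIV_minus[OF half_plane_laplace_deriv[OF left SD[OF F] HD[OF x]]] e0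
    by (simp_all add: p_def[abs_def] q_def[abs_def] add.commute)
  have bounds: "norm (u F x) \<le> \<kappa> * M / norm x" "norm (u F x) \<le> 1/2" if F: "F \<in> S" and x: "x \<in> H" for F x
  proof -
    have pq: "norm (p F x) \<le> \<kappa> * M / norm x" "norm (q F x) \<le> \<kappa> * M / norm x"
      using half_plane_laplace_bound[OF right SD[OF F] HD[OF x]] half_plane_laplace_bound[OF left SD[OF F] HD[OF x]]
      by (simp_all add: p_def q_def)
    show 1: "norm (u F x) \<le> \<kappa> * M / norm x"
      unfolding u_def by (rule half_sum_norm_le[OF pq])
    have "0 < norm x" "2 * (\<kappa> * M) \<le> norm x" using R(2) nR[OF x] n1[OF x] by linarith+
    then have "\<kappa> * M / norm x \<le> 1 / 2" by (simp add: field_simps)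
    with 1 show "norm (u F x) \<le> 1/2" by linarith
  qed
  have diffs: "norm (u F x - u G x) \<le> \<kappa> * C / norm x" "norm (u' F x - u' G x) \<le> \<kappa> * C / norm x"
    if F: "F \<in> S" and G: "G \<in> S" and FG: "\<And>x. x \<in> H \<Longrightarrow> norm (F x - G x) \<le> C * (1 / norm x)" and x: "x \<in> H" for F G C x
  proof -
    have FG': "norm (F x - G x) \<le> C * (1 / norm x)" if "x \<in> half_plane (d * e) R" for x
      using FG[of x] that by (simp add: H_def)
    have pq: "norm (p F x - p G x) \<le> \<kappa> * C / norm x" "norm (q F x - q G x) \<le> \<kappa> * C / norm x"
      using half_plane_laplace_diff[OF right SD[OF F] SD[OF G] FG' HD[OF x]]
        half_plane_laplace_diff[OF left SD[OF F] SD[OF G] FG' HD[OF x]]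
      by (simp_all add: p_def q_def norm_minus_commute)
    have eq: "u F x - u G x = ((p F x - p G x) - (q F x - q G x)) / 2"
      "u' F x - u' G x = ((p F x - p G x) + (q F x - q G x)) / 2"
      by (simp_all add: u_def u'_def field_simps)
    show "norm (u F x - u G x) \<le> \<kappa> * C / norm x" "norm (u' F x - u' G x) \<le> \<kappa> * C / norm x"
      unfolding eq by (rule half_sum_norm_le[OF pq])+
  qed
  have uderiv: "(u F has_field_derivative u' F x) (at x)"
    "(u' F has_field_derivative u F x + F x) (at x)" if F: "F \<in> S" and x: "x \<in> H" for F x
  proof -
    note D = derivs[OF F x]
    show "(u F has_field_derivative u' F x) (at x)"
      using DERIV_cdivide[OF DERIV_diff[OF D], of 2] by (simp add: u_def[abs_def] u'_def)
    show "(u' F has_field_derivative u F x + F x) (at x)"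
      using DERIV_cdivide[OF DERIV_add[OF D], of 2] by (simp add: u_def u'_def[abs_def] field_simps)
  qed
  have uhol: "u F holomorphic_on H" "u' F holomorphic_on H" if "F \<in> S" for F
    using uderiv[OF that] by (auto simp: holomorphic_on_open[OF H(1)])
  obtain F where F: "F \<in> S" "\<And>x. x \<in> H \<Longrightarrow> T F x = F x"
  proof (rule holomorphic_contraction_fixpoint[OF H(1), of "\<lambda>x. 1 / norm x" 1 M T, folded S_def])
    show "0 < 1 / norm x" "1 / norm x \<le> 1" if "x \<in> H" for x
      using rbound[OF that] by auto
    show "0 \<le> M" using M by simp
    show "T F holomorphic_on H" if F: "F \<in> S" for F
    proof -
      have "(\<lambda>x. N x (u F x)) holomorphic_on H"
        by (rule N_holomorphic[OF H(1) _ uhol(1)[OF F] bounds(2)[OF F]]) (use n1 in \<open>auto intro: less_imp_le\<close>)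
      then show ?thesis
        unfolding T_def[abs_def] by (intro holomorphic_intros uhol F) (use n1 in force)+
    qed
    show "norm (T (\<lambda>_. 0) x) \<le> M / 2 * (1 / norm x)" if "x \<in> H" for x
      using N_0[of x] n1[OF that] by (simp add: T_def u_def u'_def p_def q_def laplace_ray_def M_def)
    show "norm (T F x - T G x) \<le> C / 2 * (1 / norm x)"
      if F: "F \<in> S" and G: "G \<in> S"
        and C: "0 \<le> C" and FG: "\<And>x. x \<in> H \<Longrightarrow> norm (F x - G x) \<le> C * (1 / norm x)" and x: "x \<in> H" for F G C x
    proof -
      note bF = bounds[OF F x] and bG = bounds[OF G x] and D = diffs[OF F G FG x]
      define r where "r = 1 / norm x"
      have r: "0 < r" "r * R \<le> 1" "r \<le> 1" using rbound[OF x] by (auto simp: r_def)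
      have b': "norm (u F x) \<le> \<kappa> * M * r" "norm (u G x) \<le> \<kappa> * M * r"
        "norm (u F x - u G x) \<le> \<kappa> * C * r" "norm (u' F x - u' G x) \<le> \<kappa> * C * r"
        using bF bG D by (simp_all add: r_def)
      have \<kappa>C: "0 \<le> \<kappa> * C" using \<kappa> C by auto
      have "norm (N x (u F x) - N x (u G x) - (u F x - u G x))
          \<le> K * (norm (u F x) + norm (u G x) + 1 / norm x)\<^sup>2 * norm (u F x - u G x)"
        by (rule N_lip) (use bF bG n1[OF x] in auto)
      also have "\<dots> \<le> K * (\<kappa> * M * r + \<kappa> * M * r + r)\<^sup>2 * (\<kappa> * C * r)"
        by (intro mult_mono power_mono add_mono) (use b' K r pos \<kappa>C in \<open>auto simp: r_def[symmetric]\<close>)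
      also have "\<dots> = (K * (2 * \<kappa> * M + 1)\<^sup>2) * (\<kappa> * C * r * r\<^sup>2)"
        by (simp add: power2_eq_square algebra_simps)
      also have "\<dots> \<le> (K * (2 * \<kappa> * M + 1)\<^sup>2) * (\<kappa> * C * r * r)"
        using r pos K \<kappa>C \<kappa> C M by (intro mult_mono power_mono) (auto simp: power2_eq_square mult_le_cancel_left1)
      finally have 1: "norm (N x (u F x) - N x (u G x) - (u F x - u G x))
          \<le> K * (2 * \<kappa> * M + 1)\<^sup>2 * (\<kappa> * C * r * r)" by simp
      have 3: "norm ((u' F x - u' G x) / x) \<le> \<kappa> * C * r * r"
        using mult_right_mono[OF b'(4), of r] r by (simp add: norm_divide r_def)
      have "T F x - T G x = (N x (u F x) - N x (u G x) - (u F x - u G x)) - (u' F x - u' G x) / x"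
        by (simp add: T_def diff_divide_distrib)
      then have "norm (T F x - T G x) \<le> norm (N x (u F x) - N x (u G x) - (u F x - u G x)) + norm ((u' F x - u' G x) / x)"
        using norm_triangle_ineq4 by metis
      also have "\<dots> \<le> K * (2 * \<kappa> * M + 1)\<^sup>2 * (\<kappa> * C * r * r) + \<kappa> * C * r * r"
        using 1 3 by linarith
      also have "\<dots> = (2 * (\<kappa> * L)) * r * (C / 2 * r)"
        by (simp add: L_def algebra_simps)
      also have "\<dots> \<le> R * r * (C / 2 * r)"
        using R(3) r C by (intro mult_right_mono) auto
      also have "\<dots> \<le> 1 * (C / 2 * r)"
        using r C by (intro mult_right_mono) (auto simp: mult.commute)
      finally show ?thesis by (simp add: r_def)
    qed
  qed blast
  show thesis
  proof (rule that[OF R(1), of "\<kappa> * M" "u F"])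
    have "solves (u F) x" if x: "x \<in> H" for x
    proof -
    have "deriv (u F) y = u' F y" if "y \<in> H" for y
      using uderiv(1)[OF F(1) that] by (rule DERIV_imp_deriv)
    then have "deriv (deriv (u F)) x = deriv (u' F) x"
      using H(1) x by (intro deriv_cong_ev) (auto simp: eventually_nhds)
    also have "\<dots> = u F x + T F x"
      using DERIV_imp_deriv[OF uderiv(2)[OF F(1) x]] F(2)[OF x] by simp
    finally show ?thesis
      using DERIV_imp_deriv[OF uderiv(1)[OF F(1) x]] by (simp add: solves_def T_def)
    qed
    then show "decaying_solution (half_plane (d * e) R) (\<kappa> * M) (u F)"
      using uhol(1)[OF F(1)] bounds[OF F(1)] by (auto simp: decaying_solution_def H_def)
  qed
qed

end

section \<open>Uniqueness of decaying solutions\<close>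

lemma vector_derivative_inverse_square_bound:
  fixes f :: "real \<Rightarrow> complex"
  assumes ab: "0 < a" "a \<le> b" and f: "\<And>t. a \<le> t \<Longrightarrow> (f has_vector_derivative f' t) (at t)"
    and B: "\<And>t. a \<le> t \<Longrightarrow> norm (f' t) \<le> B / t\<^sup>2"
  shows "norm (f b - f a) \<le> B / a"
proof (cases "a < b")
  case True
  have "norm (f' a) \<le> B / a\<^sup>2" using B[of a] by simp
  then have "0 \<le> B / a\<^sup>2" using norm_ge_zero[of "f' a"] by linarith
  then have B0: "0 \<le> B" using ab by (auto simp: zero_le_divide_iff)
  have "norm (f b - f a) \<le> (- (B / b)) - (- (B / a))"
  proof (rule differentiable_bound_general[OF True, where f' = f'])
    show "continuous_on {a..b} f"
      using f by (intro continuous_at_imp_continuous_on ballI)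
        (auto intro: has_vector_derivative_continuous)
    show "continuous_on {a..b} (\<lambda>t. - (B / t))"
      by (intro continuous_intros) (use ab in auto)
    show "((\<lambda>t. - (B / t)) has_vector_derivative B / t\<^sup>2) (at t)" if "a < t" "t < b" for t
    proof -
      have "((\<lambda>t. - (B / t)) has_real_derivative B / t\<^sup>2) (at t)"
        using that ab by (auto intro!: derivative_eq_intros simp: power2_eq_square)
      then show ?thesis by (simp add: has_real_derivative_iff_has_vector_derivative)
    qed
  qed (use f B in auto)
  also have "\<dots> \<le> B / a" using B0 ab by auto
  finally show ?thesis .
next
  case False
  have "norm (f' a) \<le> B / a\<^sup>2" using B[of a] by simp
  then have "0 \<le> B / a\<^sup>2" using norm_ge_zero[of "f' a"] by linarith
  then have B0: "0 \<le> B" using ab by (auto simp: zero_le_divide_iff)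
  with False ab show ?thesis by auto
qed

lemma tendsto_at_top_norm_le:
  fixes f :: "real \<Rightarrow> complex"
  assumes "(f \<longlongrightarrow> L) at_top" "\<And>t. T \<le> t \<Longrightarrow> norm (f t - z) \<le> B"
  shows "norm (L - z) \<le> B"
proof (rule tendsto_upperbound)
  show "((\<lambda>t. norm (f t - z)) \<longlongrightarrow> norm (L - z)) at_top"
    by (intro tendsto_intros assms)
  show "\<forall>\<^sub>F t in at_top. norm (f t - z) \<le> B"
    using eventually_ge_at_top[of T] by eventually_elim (rule assms)
qed auto

lemma analytic_ray_derivatives:
  assumes "f analytic_on {of_real t * e}"
  shows "((\<lambda>t. f (of_real t * e)) has_vector_derivative e * deriv f (of_real t * e)) (at t)"
    and "((\<lambda>t. deriv f (of_real t * e)) has_vector_derivative e * deriv (deriv f) (of_real t * e)) (at t)"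
proof -
  have ray: "((\<lambda>t. of_real t * e) has_vector_derivative e) (at t)"
    by (auto intro!: derivative_eq_intros)
  have f: "(f has_field_derivative deriv f (of_real t * e)) (at (of_real t * e))"
    using assms analytic_on_imp_differentiable_at DERIV_deriv_iff_field_differentiable by blast
  have "deriv f analytic_on {of_real t * e}"
    using assms by (rule analytic_deriv)
  then have f': "(deriv f has_field_derivative deriv (deriv f) (of_real t * e)) (at (of_real t * e))"
    using analytic_on_imp_differentiable_at DERIV_deriv_iff_field_differentiable by blast
  show "((\<lambda>t. f (of_real t * e)) has_vector_derivative e * deriv f (of_real t * e)) (at t)"
    using field_vector_diff_chain_at[OF ray f] by (simp add: o_def)
  show "((\<lambda>t. deriv f (of_real t * e)) has_vector_derivative e * deriv (deriv f) (of_real t * e)) (at t)"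
    using field_vector_diff_chain_at[OF ray f'] by (simp add: o_def)
qed

text \<open>
  Along a ray on which \<open>exp (- x)\<close> does not grow, a solution of \<open>\<eta>'' = (1 + O(x\<^sup>-\<^sup>2)) \<eta>\<close>
  vanishes if it is \<open>o(exp (- x))\<close> together with its derivative. Indeed the perturbation then acts
  as a source whose effect, integrated from infinity, is at most half of \<open>\<eta>\<close> itself. For
  \<open>e = 1\<close> this says that a recessive solution is determined by its leading coefficient; on the
  imaginary axis, where both exponentials have modulus one, it says that no nonzero solution decays.
\<close>
lemma recessive_solution_zero:
  fixes \<eta> :: "complex \<Rightarrow> complex" and e :: complex
  assumes e: "norm e = 1" "0 \<le> Re e" and T: "0 < T" and c: "0 \<le> c" "c \<le> T / 2"
    and an: "\<And>t. T \<le> t \<Longrightarrow> \<eta> analytic_on {of_real t * e}"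
    and ode: "\<And>t. T \<le> t \<Longrightarrow> norm (deriv (deriv \<eta>) (of_real t * e) - \<eta> (of_real t * e))
                \<le> c / t\<^sup>2 * norm (\<eta> (of_real t * e))"
    and lim: "((\<lambda>t. exp (of_real t * e) * \<eta> (of_real t * e)) \<longlongrightarrow> 0) at_top"
      "((\<lambda>t. exp (of_real t * e) * deriv \<eta> (of_real t * e)) \<longlongrightarrow> 0) at_top"
    and t: "T \<le> t"
  shows "\<eta> (of_real t * e) = 0"
proof -
  define x where "x t = of_real t * e" for t
  define E where "E t = exp (x t) * \<eta> (x t)" for t
  (* The coefficients of exp (- x) and exp x in eta, up to the factor 2; both would be constant for the
     unperturbed equation. *)
  define P where "P t = exp (x t) * (\<eta> (x t) - deriv \<eta> (x t))" for t
  define Q where "Q t = exp (- x t) * (\<eta> (x t) + deriv \<eta> (x t))" for t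
  have xd: "(x has_vector_derivative e) (at t)" for t
    unfolding x_def[abs_def] by (auto intro!: derivative_eq_intros)
  have exd: "((\<lambda>t. exp (x t)) has_vector_derivative e * exp (x t)) (at t)" for t
    using field_vector_diff_chain_at[OF xd[of t] DERIV_exp] by (simp add: o_def)
  have emd: "((\<lambda>t. exp (- x t)) has_vector_derivative - (e * exp (- x t))) (at t)" for t
  proof -
    have "((\<lambda>z. exp (- z)) has_field_derivative - exp (- x t)) (at (x t))"
      by (auto intro!: derivative_eq_intros)
    from field_vector_diff_chain_at[OF xd[of t] this] show ?thesis by (simp add: o_def)
  qed
  note hd = analytic_ray_derivatives[OF an, folded x_def]
  have Pd: "(P has_vector_derivative e * (exp (x t) * (\<eta> (x t) - deriv (deriv \<eta>) (x t)))) (at t)"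
    if "T \<le> t" for t
    unfolding P_def[abs_def]
    using has_vector_derivative_mult[OF exd[of t] has_vector_derivative_diff[OF hd[OF that]]]
    by (simp add: algebra_simps)
  have Qd: "(Q has_vector_derivative e * (exp (- x t) * (deriv (deriv \<eta>) (x t) - \<eta> (x t)))) (at t)"
    if "T \<le> t" for t
    unfolding Q_def[abs_def]
    using has_vector_derivative_mult[OF emd[of t] has_vector_derivative_add[OF hd[OF that]]]
    by (simp add: algebra_simps)
  have P0: "(P \<longlongrightarrow> 0) at_top"
    using tendsto_diff[OF lim] by (simp add: P_def[abs_def] x_def right_diff_distrib)
  have S0: "((\<lambda>t. exp (x t) * (\<eta> (x t) + deriv \<eta> (x t))) \<longlongrightarrow> 0) at_top"
    using tendsto_add[OF lim] by (simp add: x_def distrib_left)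
  have nexp: "norm (exp (- x t)) = exp (- 2 * (t * Re e)) * norm (exp (x t))" for t
    by (simp add: x_def norm_exp_eq_Re flip: exp_add)
  have Q0: "(Q \<longlongrightarrow> 0) at_top"
  proof (rule Lim_null_comparison)
    show "((\<lambda>t. norm (exp (x t) * (\<eta> (x t) + deriv \<eta> (x t)))) \<longlongrightarrow> 0) at_top"
      using S0 by (rule tendsto_norm_zero)
    show "\<forall>\<^sub>F t in at_top. norm (Q t) \<le> norm (exp (x t) * (\<eta> (x t) + deriv \<eta> (x t)))"
      using eventually_ge_at_top[of 0]
    proof eventually_elim
      case (elim t)
      have "norm (exp (- x t)) \<le> 1 * norm (exp (x t))"
        unfolding nexp by (rule mult_right_mono) (use elim e in auto)
      then show ?case unfolding Q_def norm_mult by (intro mult_right_mono) auto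
    qed
  qed
  have halve: "norm (E t) \<le> m / 2" if m: "\<And>t. T \<le> t \<Longrightarrow> norm (E t) \<le> m" and t: "T \<le> t" for m t
  proof -
    have m0: "0 \<le> m" using m[OF t] norm_ge_zero[of "E t"] by linarith
    have t0: "0 < t" using T t by simp
    have der: "norm (exp (x s)) * norm (deriv (deriv \<eta>) (x s) - \<eta> (x s)) \<le> c * m / s\<^sup>2" if "T \<le> s" for s
    proof -
      have "norm (exp (x s)) * norm (deriv (deriv \<eta>) (x s) - \<eta> (x s))
          \<le> norm (exp (x s)) * (c / s\<^sup>2 * norm (\<eta> (x s)))"
        by (rule mult_left_mono) (use ode[OF that] in \<open>auto simp: x_def\<close>)
      also have "\<dots> = c / s\<^sup>2 * norm (E s)" by (simp add: E_def norm_mult)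
      also have "\<dots> \<le> c / s\<^sup>2 * m" by (rule mult_left_mono[OF m[OF that]]) (use c in auto)
      finally show ?thesis by simp
    qed
    have cmt: "c * m / t \<le> m / 2"
    proof -
      have "c * m \<le> t / 2 * m" by (rule mult_right_mono) (use c t m0 in auto)
      then show ?thesis using t0 by (simp add: field_simps)
    qed
    have "norm (0 - P t) \<le> c * m / t"
    proof (rule tendsto_at_top_norm_le[OF P0])
      fix b assume "t \<le> b"
      then show "norm (P b - P t) \<le> c * m / t"
        by (rule vector_derivative_inverse_square_bound[OF t0 _ Pd])
          (use t der in \<open>auto simp: norm_mult e norm_minus_commute\<close>)
    qed
    then have "norm (P t) \<le> c * m / t" by simp
    then have P: "norm (P t) \<le> m / 2" using cmt by linarith
    have "norm (0 - Q t) \<le> exp (- 2 * (t * Re e)) * (c * m) / t"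
    proof (rule tendsto_at_top_norm_le[OF Q0])
      fix b assume "t \<le> b"
      then show "norm (Q b - Q t) \<le> exp (- 2 * (t * Re e)) * (c * m) / t"
      proof (rule vector_derivative_inverse_square_bound[OF t0 _ Qd])
        fix s assume s: "t \<le> s"
        then have Ts: "T \<le> s" using t by simp
        have "exp (- 2 * (s * Re e)) \<le> exp (- 2 * (t * Re e))"
          using s e by (simp add: mult_right_mono)
        then have "exp (- 2 * (s * Re e)) * (norm (exp (x s)) * norm (deriv (deriv \<eta>) (x s) - \<eta> (x s)))
          \<le> exp (- 2 * (t * Re e)) * (c * m / s\<^sup>2)"
          by (intro mult_mono der[OF Ts]) auto
        then show "norm (e * (exp (- x s) * (deriv (deriv \<eta>) (x s) - \<eta> (x s))))
            \<le> exp (- 2 * (t * Re e)) * (c * m) / s\<^sup>2"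
          by (simp only: norm_mult e nexp mult.assoc mult_1 times_divide_eq_right)
      qed (use t in auto)
    qed
    then have "exp (2 * (t * Re e)) * norm (Q t) \<le> exp (2 * (t * Re e)) * (exp (- 2 * (t * Re e)) * (c * m) / t)"
      by (intro mult_left_mono) auto
    also have "\<dots> = c * m / t" by (simp add: exp_minus)
    finally have Q: "exp (2 * (t * Re e)) * norm (Q t) \<le> m / 2" using cmt by linarith
    have E2: "exp (2 * x t) * exp (- x t) = exp (x t)" by (simp flip: exp_add)
    have "exp (2 * x t) * Q t = exp (x t) * (\<eta> (x t) + deriv \<eta> (x t))"
      by (simp only: Q_def E2 mult.assoc[symmetric])
    then have "2 * E t = P t + exp (2 * x t) * Q t"
      by (simp add: E_def P_def algebra_simps)
    then have "norm (2 * E t) \<le> norm (P t) + norm (exp (2 * x t) * Q t)"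
      by (simp only: norm_triangle_ineq)
    also have "norm (exp (2 * x t) * Q t) = exp (2 * (t * Re e)) * norm (Q t)"
      by (simp add: norm_mult norm_exp_eq_Re x_def)
    finally show ?thesis using P Q by (simp add: norm_mult)
  qed
  obtain m where m: "\<And>t. T \<le> t \<Longrightarrow> norm (E t) \<le> m"
  proof -
    have E0: "(E \<longlongrightarrow> 0) at_top" using lim(1) by (simp add: E_def[abs_def] x_def)
    have "\<forall>\<^sub>F t in at_top. norm (E t) < 1"
      using tendstoD[OF E0, of 1] by (simp add: dist_norm)
    then obtain T1 where T1: "\<And>t. T1 \<le> t \<Longrightarrow> norm (E t) < 1"
      by (auto simp: eventually_at_top_linorder)
    have "continuous_on {T..T1} E"
      unfolding E_def[abs_def]
      by (intro continuous_at_imp_continuous_on ballI continuous_intros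
          has_vector_derivative_continuous[OF hd(1)] has_vector_derivative_continuous[OF exd]) auto
    then have "bounded (E ` {T..T1})"
      by (intro compact_imp_bounded compact_continuous_image) auto
    then obtain B where "\<forall>y\<in>E ` {T..T1}. norm y \<le> B"
      unfolding bounded_iff by blast
    then have B: "\<And>t. t \<in> {T..T1} \<Longrightarrow> norm (E t) \<le> B" by blast
    show thesis
    proof (rule that[of "max 1 B"])
      fix t assume "T \<le> t"
      then show "norm (E t) \<le> max 1 B"
        using T1[of t] B[of t] by (cases "t \<le> T1") auto
    qed
  qed
  have "norm (E s) \<le> m * (1/2) ^ n" if "T \<le> s" for n s
    using that
  proof (induction n arbitrary: s)
    case (Suc n)
    show ?case using halve[of "m * (1/2) ^ n" s] Suc by (simp add: mult_ac)
  qed (use m in auto)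
  then have le: "norm (E t) \<le> m * (1/2) ^ n" for n using t by blast
  have "(\<lambda>n. m * (1/2) ^ n) \<longlonglongrightarrow> 0"
    by (intro tendsto_mult_right_zero LIMSEQ_realpow_zero) auto
  then have "norm (E t) \<le> 0"
    by (rule LIMSEQ_le_const) (use le in auto)
  then show ?thesis by (simp add: E_def x_def)
qed

lemma csqrt_norm_sq: "(norm (csqrt x))\<^sup>2 = norm x"
  by (metis norm_power power2_csqrt)

text \<open>
  The factor \<open>x\<^sup>1\<^sup>/\<^sup>2\<close> removes the first order term \<open>f' / x\<close>, which is not an integrable
  perturbation, at the price of an integrable one; it is the reason for the power
  \<open>x\<^sup>-\<^sup>1\<^sup>/\<^sup>2\<close> in the asymptotics of the solutions.
\<close>
lemma gauged_second_derivative: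
  assumes f: "f analytic_on {x}" and x: "x \<notin> \<real>\<^sub>\<le>\<^sub>0"
  shows "deriv (deriv (\<lambda>y. csqrt y * f y)) x
           = csqrt x * (deriv (deriv f) x + deriv f x / x) - csqrt x * f x / (4 * x\<^sup>2)"
    and "(\<lambda>y. csqrt y * f y) analytic_on {x}"
proof -
  show "(\<lambda>y. csqrt y * f y) analytic_on {x}"
    by (intro analytic_intros f) (use x in auto)
  obtain U where U: "open U" "x \<in> U" "f holomorphic_on U"
    using f by (auto simp: analytic_at)
  define V where "V = U - \<real>\<^sub>\<le>\<^sub>0"
  have V: "open V" "x \<in> V" "f holomorphic_on V" "deriv f holomorphic_on V"
    using U x by (auto simp: V_def intro: holomorphic_on_subset holomorphic_deriv)
  have df: "(f has_field_derivative deriv f y) (at y)" "(deriv f has_field_derivative deriv (deriv f) y) (at y)"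
    if "y \<in> V" for y
    using V that holomorphic_derivI by blast+
  have ds: "(csqrt has_field_derivative 1 / (2 * csqrt y)) (at y)" if "y \<in> V" for y
  proof -
    have eq: "1 / (2 * csqrt y) = inverse (csqrt y) / 2" by (simp add: field_simps)
    show ?thesis unfolding eq using has_field_derivative_csqrt[of y] that by (auto simp: V_def)
  qed
  have s0: "csqrt y \<noteq> 0" if "y \<in> V" for y using that by (auto simp: V_def)
  have "deriv (\<lambda>y. csqrt y * f y) y = csqrt y * deriv f y + f y / (2 * csqrt y)" if "y \<in> V" for y
    using DERIV_mult[OF ds[OF that] df(1)[OF that]] by (intro DERIV_imp_deriv) (simp add: algebra_simps)
  then have "deriv (deriv (\<lambda>y. csqrt y * f y)) x = deriv (\<lambda>y. csqrt y * deriv f y + f y / (2 * csqrt y)) x"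
    using V by (intro deriv_cong_ev) (auto simp: eventually_nhds)
  also have "\<dots> = (1 / (2 * csqrt x)) * deriv f x + csqrt x * deriv (deriv f) x
      + (deriv f x * (2 * csqrt x) - f x * (2 * (1 / (2 * csqrt x)))) / (2 * csqrt x * (2 * csqrt x))"
    using x by (intro DERIV_imp_deriv)
      (auto intro!: derivative_eq_intros df[OF V(2)] ds[OF V(2)] s0[OF V(2)] simp: algebra_simps)
  also have "\<dots> = csqrt x * (deriv (deriv f) x + deriv f x / (csqrt x)\<^sup>2) - csqrt x * f x / (4 * ((csqrt x)\<^sup>2)\<^sup>2)"
    using s0[OF V(2)] by (simp add: field_simps power2_eq_square)
  finally show "deriv (deriv (\<lambda>y. csqrt y * f y)) x
           = csqrt x * (deriv (deriv f) x + deriv f x / x) - csqrt x * f x / (4 * x\<^sup>2)"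
    by simp
qed

lemma second_derivative_diff:
  assumes u: "u analytic_on {x}" and v: "v analytic_on {x}"
  shows "deriv (\<lambda>y. v y - u y) x = deriv v x - deriv u x"
    and "deriv (deriv (\<lambda>y. v y - u y)) x = deriv (deriv v) x - deriv (deriv u) x"
proof -
  have dif: "f field_differentiable at x" if "f analytic_on {x}" for f :: "complex \<Rightarrow> complex"
    using that analytic_on_imp_differentiable_at by blast
  have ev: "\<forall>\<^sub>F y in nhds x. deriv (\<lambda>y. v y - u y) y = deriv v y - deriv u y"
  proof -
    obtain U where U: "open U" "x \<in> U" "u holomorphic_on U"
      using u(1) by (auto simp: analytic_at)
    obtain V where V: "open V" "x \<in> V" "v holomorphic_on V"
      using v(1) by (auto simp: analytic_at)
    have "deriv (\<lambda>y. v y - u y) y = deriv v y - deriv u y" if "y \<in> U \<inter> V" for y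
      using that U V by (intro deriv_diff) (auto simp: holomorphic_on_imp_differentiable_at)
    then show ?thesis using U V by (auto simp: eventually_nhds intro!: exI[of _ "U \<inter> V"])
  qed
  show "deriv (deriv (\<lambda>y. v y - u y)) x = deriv (deriv v) x - deriv (deriv u) x"
    using deriv_cong_ev[OF ev refl] deriv_diff[OF dif[OF analytic_deriv[OF v]] dif[OF analytic_deriv[OF u]]]
    by simp
  show "deriv (\<lambda>y. v y - u y) x = deriv v x - deriv u x"
    using eventually_nhds_x_imp_x[OF ev] .
qed

context forced_pendulum
begin

lemma difference_equation_bound:
  assumes u: "u analytic_on {x}" "solves u x" "norm (u x) \<le> 1/2"
    and v: "v analytic_on {x}" "solves v x" "norm (v x) \<le> 1/2"
    and x: "x \<notin> \<real>\<^sub>\<le>\<^sub>0" "1 \<le> norm x"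
  defines "\<eta> \<equiv> \<lambda>y. csqrt y * (v y - u y)"
  shows "norm (deriv (deriv \<eta>) x - \<eta> x)
           \<le> (K * (norm (u x) + norm (v x) + 1 / norm x)\<^sup>2 + 1 / (norm x)\<^sup>2) * norm (\<eta> x)"
    and "\<eta> analytic_on {x}"
proof -
  have an: "(\<lambda>y. v y - u y) analytic_on {x}" by (intro analytic_intros u v)
  have "deriv (deriv \<eta>) x = csqrt x * (N x (v x) - N x (u x)) - \<eta> x / (4 * x\<^sup>2)"
    unfolding \<eta>_def gauged_second_derivative(1)[OF an x(1)] second_derivative_diff[OF u(1) v(1)]
    using u(2) v(2) unfolding solves_def
    by (simp add: algebra_simps diff_divide_distrib flip: u(2)[unfolded solves_def] v(2)[unfolded solves_def])
  then have eq: "deriv (deriv \<eta>) x - \<eta> x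
     = csqrt x * (N x (v x) - N x (u x) - (v x - u x)) - \<eta> x / (4 * x\<^sup>2)"
    by (simp add: \<eta>_def algebra_simps)
  have "norm (csqrt x * (N x (v x) - N x (u x) - (v x - u x)))
     \<le> norm (csqrt x) * (K * (norm (v x) + norm (u x) + 1 / norm x)\<^sup>2 * norm (v x - u x))"
    unfolding norm_mult by (intro mult_left_mono N_lip u v x) auto
  also have "\<dots> = K * (norm (u x) + norm (v x) + 1 / norm x)\<^sup>2 * norm (\<eta> x)"
    by (simp add: \<eta>_def norm_mult add.commute)
  finally have 1: "norm (csqrt x * (N x (v x) - N x (u x) - (v x - u x)))
     \<le> K * (norm (u x) + norm (v x) + 1 / norm x)\<^sup>2 * norm (\<eta> x)" .
  have 2: "norm (\<eta> x / (4 * x\<^sup>2)) \<le> 1 / (norm x)\<^sup>2 * norm (\<eta> x)"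
  proof -
    have "0 < norm x" using x(2) by linarith
    then have "norm (\<eta> x) / (4 * (norm x)\<^sup>2) \<le> norm (\<eta> x) / (norm x)\<^sup>2"
      by (intro frac_le) auto
    then show ?thesis by (simp add: norm_divide norm_mult norm_power)
  qed
  show "norm (deriv (deriv \<eta>) x - \<eta> x)
           \<le> (K * (norm (u x) + norm (v x) + 1 / norm x)\<^sup>2 + 1 / (norm x)\<^sup>2) * norm (\<eta> x)"
    unfolding eq distrib_right by (rule order_trans[OF norm_triangle_ineq4 add_mono[OF 1 2]])
  show "\<eta> analytic_on {x}"
    unfolding \<eta>_def by (rule gauged_second_derivative(2)[OF an x(1)])
qed

text \<open>
  The gauged difference of two solutions that are \<open>O(1 / x)\<close> is \<open>O(x\<^sup>-\<^sup>1\<^sup>/\<^sup>2)\<close>, and so is its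
  derivative by Cauchy's estimate; hence it vanishes on the imaginary half axis, and everywhere by
  analytic continuation.
\<close>
lemma decaying_solution_unique_on_axis:
  assumes d: "d = \<i> \<or> d = - \<i>" and A: "open A" "connected A"
    and du: "decaying_solution A M u" and dv: "decaying_solution A M v"
    and ray: "\<And>t. T \<le> t \<Longrightarrow> cball (of_real t * d) 1 \<subseteq> A" and x: "x \<in> A"
  shows "u x = v x"
proof -
  note u = decaying_solutionD[OF du] and v = decaying_solutionD[OF dv]
  define \<eta> where "\<eta> y = csqrt y * (v y - u y)" for y
  have d1: "norm d = 1" "Re d = 0" "d \<noteq> 0" using d by auto
  define c where "c = K * (2 * \<bar>M\<bar> + 1)\<^sup>2 + 1"
  have c0: "1 \<le> c" using K by (simp add: c_def)
  define T1 where "T1 = max T (2 * c)"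
  have T1: "T \<le> T1" "2 \<le> T1" "c \<le> T1 / 2" using c0 by (auto simp: T1_def)
  have near: "t - 1 \<le> norm y" "norm y \<le> t + 1" "y \<in> A" "y \<notin> \<real>\<^sub>\<le>\<^sub>0"
    if "T1 \<le> t" "y \<in> cball (of_real t * d) 1" for t y
  proof -
    have dist: "norm (of_real t * d - y) \<le> 1" using that by (simp add: dist_norm)
    have nt: "norm (of_real t * d) = t" using d1 that T1 by (simp add: norm_mult)
    show "t - 1 \<le> norm y" using norm_triangle_sub[of "of_real t * d" y] dist nt by linarith
    show "norm y \<le> t + 1"
      using norm_triangle_sub[of y "of_real t * d"] dist nt by (simp add: norm_minus_commute)
    show "y \<in> A" using ray[of t] that T1 by auto
    have "\<bar>Im (of_real t * d - y)\<bar> \<le> 1"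
      using abs_Im_le_cmod[of "of_real t * d - y"] dist by linarith
    then have "Im y \<noteq> 0" using d that T1 by auto
    then show "y \<notin> \<real>\<^sub>\<le>\<^sub>0" by (auto simp: complex_nonpos_Reals_iff)
  qed
  have on_ray: "of_real t * d \<in> A" "of_real t * d \<notin> \<real>\<^sub>\<le>\<^sub>0" "norm (of_real t * d) = t" if "T1 \<le> t" for t
    using near[OF that, of "of_real t * d"] d1 that T1 by (auto simp: norm_mult)
  have bound: "norm (\<eta> y) \<le> sqrt (t + 1) * (2 * \<bar>M\<bar> / (t - 1))" if t: "T1 \<le> t" "y \<in> cball (of_real t * d) 1" for t y
  proof -
    note n = near[OF t]
    have t1: "0 < t - 1" using t T1 by simp
    have le: "M / norm y \<le> \<bar>M\<bar> / (t - 1)"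
      using n(1) t1 by (intro frac_le) auto
    have "norm (v y - u y) \<le> 2 * \<bar>M\<bar> / (t - 1)"
      using norm_triangle_ineq4[of "v y" "u y"] u(2)[OF n(3)] v(2)[OF n(3)] le by (simp add: add_divide_distrib)
    moreover have "norm (csqrt y) \<le> sqrt (t + 1)"
      using n(2) csqrt_norm_sq[of y] by (intro real_le_rsqrt) simp
    ultimately show ?thesis
      unfolding \<eta>_def norm_mult using t1 by (intro mult_mono) auto
  qed
  have small: "((\<lambda>t. sqrt (t + 1) * (2 * \<bar>M\<bar> / (t - 1))) \<longlongrightarrow> 0) at_top"
    by real_asymp
  have hol: "\<eta> holomorphic_on cball (of_real t * d) 1" if "T1 \<le> t" for t
    unfolding \<eta>_def[abs_def]
    by (intro holomorphic_intros holomorphic_on_subset[OF u(1)] holomorphic_on_subset[OF v(1)])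
      (use near[OF that] in auto)
  have eta0: "\<eta> (of_real t * d) = 0" if t: "T1 \<le> t" for t
  proof (rule recessive_solution_zero[OF d1(1) _ _ _ T1(3) _ _ _ _ t])
    fix s assume s: "T1 \<le> s"
    let ?x = "of_real s * d"
    have s0: "0 < s" "1 \<le> s" using s T1 by auto
    have an: "u analytic_on {?x}" "v analytic_on {?x}"
      using on_ray(1)[OF s] A u(1) v(1) by (auto simp: analytic_at)
    note db = difference_equation_bound[OF an(1) u(4,3)[OF on_ray(1)[OF s]] an(2)
        v(4,3)[OF on_ray(1)[OF s]] on_ray(2)[OF s], unfolded on_ray(3)[OF s], OF s0(2), folded \<eta>_def]
    show "\<eta> analytic_on {?x}" by (rule db(2))
    have "norm (u ?x) \<le> \<bar>M\<bar> / s" "norm (v ?x) \<le> \<bar>M\<bar> / s"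
    proof -
      have "M / s \<le> \<bar>M\<bar> / s" using s0 by (intro divide_right_mono) auto
      then show "norm (u ?x) \<le> \<bar>M\<bar> / s" "norm (v ?x) \<le> \<bar>M\<bar> / s"
        using u(2)[OF on_ray(1)[OF s]] v(2)[OF on_ray(1)[OF s]] on_ray(3)[OF s] by auto
    qed
    then have "K * (norm (u ?x) + norm (v ?x) + 1 / s)\<^sup>2 + 1 / s\<^sup>2 \<le> K * (\<bar>M\<bar> / s + \<bar>M\<bar> / s + 1 / s)\<^sup>2 + 1 / s\<^sup>2"
      using K s0 by (intro add_right_mono mult_left_mono power_mono add_mono) auto
    also have "\<dots> = c / s\<^sup>2"
    proof -
      have eq: "\<bar>M\<bar> / s + \<bar>M\<bar> / s + 1 / s = (2 * \<bar>M\<bar> + 1) / s" by (simp add: add_divide_distrib)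
      show ?thesis unfolding eq power_divide c_def by (simp add: add_divide_distrib)
    qed
    finally show "norm (deriv (deriv \<eta>) ?x - \<eta> ?x) \<le> c / s\<^sup>2 * norm (\<eta> ?x)"
      by (rule order_trans[OF db(1) mult_right_mono]) auto
  next
    show "((\<lambda>t. exp (of_real t * d) * \<eta> (of_real t * d)) \<longlongrightarrow> 0) at_top"
    proof (rule Lim_null_comparison[OF _ small])
      show "\<forall>\<^sub>F t in at_top. norm (exp (of_real t * d) * \<eta> (of_real t * d)) \<le> sqrt (t + 1) * (2 * \<bar>M\<bar> / (t - 1))"
        using eventually_ge_at_top[of T1]
      proof eventually_elim
        case (elim t)
        show ?case using bound[OF elim, of "of_real t * d"] by (simp add: norm_mult d1)
      qed
    qed
    show "((\<lambda>t. exp (of_real t * d) * deriv \<eta> (of_real t * d)) \<longlongrightarrow> 0) at_top"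
    proof (rule Lim_null_comparison[OF _ small])
      show "\<forall>\<^sub>F t in at_top. norm (exp (of_real t * d) * deriv \<eta> (of_real t * d)) \<le> sqrt (t + 1) * (2 * \<bar>M\<bar> / (t - 1))"
        using eventually_ge_at_top[of T1]
      proof eventually_elim
        case (elim t)
        have "norm ((deriv ^^ 1) \<eta> (of_real t * d)) \<le> fact 1 * (sqrt (t + 1) * (2 * \<bar>M\<bar> / (t - 1))) / 1 ^ 1"
          by (rule Cauchy_inequality)
            (use hol[OF elim] bound[OF elim] in \<open>auto intro: holomorphic_on_imp_continuous_on
              holomorphic_on_subset simp: dist_norm\<close>)
        then show ?case by (simp add: norm_mult d1)
      qed
    qed
  qed (use d1 T1 c0 in auto)
  then have zero: "v (of_real t * d) - u (of_real t * d) = 0" if "T1 \<le> t" for t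
    using eta0[OF that] T1 that d1 on_ray(2)[OF that] by (auto simp: \<eta>_def)
  have "(\<lambda>y. v y - u y) x = 0"
  proof (rule analytic_continuation[of "\<lambda>y. v y - u y" A "(\<lambda>t. of_real t * d) ` {T1..}" "of_real T1 * d"])
    show "(\<lambda>y. v y - u y) holomorphic_on A" by (intro holomorphic_intros u(1) v(1))
    show "(\<lambda>t. of_real t * d) ` {T1..} \<subseteq> A" "of_real T1 * d \<in> A" using on_ray by auto
    show "of_real T1 * d islimpt (\<lambda>t. of_real t * d) ` {T1..}"
    proof (rule islimpt_approachable[THEN iffD2], intro allI impI)
      fix \<epsilon> :: real assume "0 < \<epsilon>"
      let ?y = "of_real (T1 + \<epsilon> / 2) * d"
      have "?y \<in> (\<lambda>t. of_real t * d) ` {T1..}"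
        using \<open>0 < \<epsilon>\<close> by (intro imageI) auto
      moreover have E: "?y - of_real T1 * d = of_real (\<epsilon> / 2) * d"
        by (simp add: distrib_right)
      have "dist ?y (of_real T1 * d) = \<epsilon> / 2"
        unfolding dist_norm E using d1 \<open>0 < \<epsilon>\<close> by (simp add: norm_mult)
      ultimately show "\<exists>x'\<in>(\<lambda>t. of_real t * d) ` {T1..}. x' \<noteq> of_real T1 * d \<and> dist x' (of_real T1 * d) < \<epsilon>"
        using \<open>0 < \<epsilon>\<close> by (intro bexI[of _ ?y]) auto
    qed
  qed (use A x zero in auto)
  then show ?thesis by simp
qed

end

section \<open>Perturbations of the exponential equation on the real line\<close>

lemma vector_derivative_constant_bound:
  fixes f :: "real \<Rightarrow> complex"
  assumes ab: "a \<le> b" and f: "\<And>t. a \<le> t \<Longrightarrow> t \<le> b \<Longrightarrow> (f has_vector_derivative f' t) (at t)"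
    and B: "\<And>t. a \<le> t \<Longrightarrow> t \<le> b \<Longrightarrow> norm (f' t) \<le> B"
  shows "norm (f b - f a) \<le> B * (b - a)"
proof (cases "a < b")
  case True
  have "norm (f b - f a) \<le> B * b - B * a"
  proof (rule differentiable_bound_general[OF True, where f' = f' and \<phi>' = "\<lambda>_. B"])
    show "continuous_on {a..b} f"
      using f by (intro continuous_at_imp_continuous_on ballI)
        (auto intro: has_vector_derivative_continuous)
    show "((*) B has_vector_derivative B) (at t)" for t
      by (auto simp flip: has_real_derivative_iff_has_vector_derivative intro!: derivative_eq_intros)
  qed (use f B in \<open>auto intro!: continuous_intros\<close>)
  then show ?thesis by (simp add: right_diff_distrib)
qed (use ab in auto)

lemma norm_square_derivative:
  fixes h :: "real \<Rightarrow> complex"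
  assumes "(h has_vector_derivative h1 t) (at t)"
  shows "((\<lambda>t. (norm (h t))\<^sup>2) has_real_derivative 2 * (h t \<bullet> h1 t)) (at t)"
  using bounded_bilinear.has_vector_derivative[OF bounded_bilinear_inner assms assms]
  by (simp add: has_real_derivative_iff_has_vector_derivative power2_norm_eq_inner inner_commute)

lemma inner_derivative:
  fixes h h1 :: "real \<Rightarrow> complex"
  assumes "(h has_vector_derivative h1 t) (at t)" "(h1 has_vector_derivative h2 t) (at t)"
  shows "((\<lambda>t. 2 * (h t \<bullet> h1 t)) has_real_derivative 2 * (h t \<bullet> h2 t + (norm (h1 t))\<^sup>2)) (at t)"
  using DERIV_cmult[OF bounded_bilinear.has_vector_derivative[OF bounded_bilinear_inner assms,
      folded has_real_derivative_iff_has_vector_derivative], of 2]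
  by (simp add: power2_norm_eq_inner)

lemma inner_almost_equal_lower_bound:
  fixes a b :: complex
  assumes "norm (b - a) \<le> \<epsilon> * norm a"
  shows "(1 - \<epsilon>) * (norm a)\<^sup>2 \<le> a \<bullet> b"
proof -
  have "- (a \<bullet> (b - a)) \<le> norm a * norm (b - a)"
    using norm_cauchy_schwarz[of a "- (b - a)"] unfolding inner_minus_right norm_minus_cancel .
  also have "\<dots> \<le> norm a * (\<epsilon> * norm a)"
    by (rule mult_left_mono[OF assms]) auto
  finally have "- (a \<bullet> (b - a)) \<le> \<epsilon> * (norm a)\<^sup>2" by (simp add: power2_eq_square mult_ac)
  moreover have "a \<bullet> b = (norm a)\<^sup>2 + a \<bullet> (b - a)"
    by (simp add: power2_norm_eq_inner inner_diff_right)
  moreover have "(1 - \<epsilon>) * (norm a)\<^sup>2 = (norm a)\<^sup>2 - \<epsilon> * (norm a)\<^sup>2"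
    by (simp add: left_diff_distrib)
  ultimately show ?thesis by linarith
qed

text \<open>
  Along a solution of \<open>h'' = (1 + q) h\<close> with \<open>|q| \<le> 1/2\<close> the square of the modulus
  \<open>\<rho> = |h|\<^sup>2\<close> satisfies \<open>\<rho>'' \<ge> \<rho>\<close>. If \<open>\<rho>' + \<rho>\<close> were positive somewhere, then it would
  grow like \<open>exp t\<close> from there on, and so would \<open>\<rho>\<close>. Otherwise \<open>\<rho> exp t\<close> decreases.
\<close>
lemma perturbed_exponential_slow_growth_imp_decay:
  fixes h h1 h2 :: "real \<Rightarrow> complex"
  assumes h: "\<And>t. T \<le> t \<Longrightarrow> (h has_vector_derivative h1 t) (at t)"
      "\<And>t. T \<le> t \<Longrightarrow> (h1 has_vector_derivative h2 t) (at t)"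
    and ode: "\<And>t. T \<le> t \<Longrightarrow> norm (h2 t - h t) \<le> 1/2 * norm (h t)"
    and growth: "\<And>t. T \<le> t \<Longrightarrow> (norm (h t))\<^sup>2 \<le> t"
    and t: "T \<le> t"
  shows "(norm (h t))\<^sup>2 \<le> (norm (h T))\<^sup>2 * exp T * exp (- t)"
proof -
  define \<rho> where "\<rho> t = (norm (h t))\<^sup>2" for t
  define \<rho>1 where "\<rho>1 t = 2 * (h t \<bullet> h1 t)" for t
  define \<rho>2 where "\<rho>2 t = 2 * (h t \<bullet> h2 t + (norm (h1 t))\<^sup>2)" for t
  have d: "(\<rho> has_real_derivative \<rho>1 t) (at t)" "(\<rho>1 has_real_derivative \<rho>2 t) (at t)" if "T \<le> t" for t
    using norm_square_derivative[of h h1 t, OF h(1)[OF that]] inner_derivative[of h h1 t h2, OF h(1,2)[OF that]]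
    by (simp_all add: \<rho>_def[abs_def] \<rho>1_def[abs_def] \<rho>2_def)
  have convex: "\<rho> t \<le> \<rho>2 t" if "T \<le> t" for t
  proof -
    have le: "\<rho> t \<le> 2 * (h t \<bullet> h2 t)"
      using inner_almost_equal_lower_bound[OF ode[OF that]] by (simp add: \<rho>_def)
    show ?thesis unfolding \<rho>2_def distrib_left by (rule add_increasing2[OF _ le]) simp
  qed
  have neg: "\<rho>1 a + \<rho> a \<le> 0" if a: "T \<le> a" for a
  proof (rule ccontr)
    assume "\<not> \<rho>1 a + \<rho> a \<le> 0"
    define m where "m = (\<rho>1 a + \<rho> a) * exp (- a)"
    have m: "0 < m" using \<open>\<not> \<rho>1 a + \<rho> a \<le> 0\<close> by (simp add: m_def)
    have lower: "m * exp t \<le> \<rho>1 t + \<rho> t" if "a \<le> t" for t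
    proof -
      have "m \<le> (\<rho>1 t + \<rho> t) * exp (- t)"
        unfolding m_def
      proof (rule DERIV_nonneg_imp_nondecreasing[OF that])
        fix s assume "a \<le> s" "s \<le> t"
        then have s: "T \<le> s" using a by simp
        have "((\<lambda>s. (\<rho>1 s + \<rho> s) * exp (- s)) has_real_derivative (\<rho>2 s - \<rho> s) * exp (- s)) (at s)"
          by (auto intro!: derivative_eq_intros d[OF s] simp: algebra_simps)
        then show "\<exists>y. ((\<lambda>s. (\<rho>1 s + \<rho> s) * exp (- s)) has_real_derivative y) (at s) \<and> 0 \<le> y"
          using convex[OF s] by (intro exI[of _ "(\<rho>2 s - \<rho> s) * exp (- s)"]) auto
      qed
      then have "m * exp t \<le> (\<rho>1 t + \<rho> t) * exp (- t) * exp t"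
        by (rule mult_right_mono) auto
      then show ?thesis by (simp add: mult.assoc flip: exp_add)
    qed
    define b where "b = \<rho> a * exp a - m / 2 * exp (2 * a)"
    have grows: "m / 2 * exp t - \<bar>b\<bar> \<le> t" if t: "max a 0 \<le> t" for t
    proof -
      have "b \<le> \<rho> t * exp t - m / 2 * exp (2 * t)"
        unfolding b_def
      proof (rule DERIV_nonneg_imp_nondecreasing[of a t])
        fix s assume as: "a \<le> s" "s \<le> t"
        then have s: "T \<le> s" using a by simp
        have "((\<lambda>s. \<rho> s * exp s - m / 2 * exp (2 * s)) has_real_derivative
            (\<rho>1 s + \<rho> s) * exp s - m * exp s * exp s) (at s)"
          by (auto intro!: derivative_eq_intros d[OF s] simp: algebra_simps simp flip: exp_add)
        moreover have "0 \<le> (\<rho>1 s + \<rho> s) * exp s - m * exp s * exp s"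
          using mult_right_mono[OF lower[OF as(1)], of "exp s"] by simp
        ultimately show "\<exists>y. ((\<lambda>s. \<rho> s * exp s - m / 2 * exp (2 * s)) has_real_derivative y) (at s) \<and> 0 \<le> y"
          by blast
      qed (use t in auto)
      also have "\<dots> = (\<rho> t - m / 2 * exp t) * exp t"
        by (simp add: algebra_simps flip: exp_add)
      finally have "b * exp (- t) \<le> (\<rho> t - m / 2 * exp t) * exp t * exp (- t)"
        by (rule mult_right_mono) auto
      then have "b * exp (- t) \<le> \<rho> t - m / 2 * exp t" by (simp add: mult.assoc flip: exp_add)
      moreover have "- \<bar>b\<bar> \<le> b * exp (- t)"
      proof -
        have "\<bar>b\<bar> * exp (- t) \<le> \<bar>b\<bar> * 1" using t by (intro mult_left_mono) auto
        moreover have "- (\<bar>b\<bar> * exp (- t)) \<le> b * exp (- t)"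
          using mult_right_mono[of "- \<bar>b\<bar>" b "exp (- t)"] by simp
        ultimately show ?thesis by linarith
      qed
      moreover have "\<rho> t \<le> t" using growth[of t] t a by (simp add: \<rho>_def)
      ultimately show ?thesis by linarith
    qed
    have "\<forall>\<^sub>F t in at_top. t < m / 2 * exp t - \<bar>b\<bar>"
      using m by real_asymp
    then have "\<forall>\<^sub>F t in at_top. t < m / 2 * exp t - \<bar>b\<bar> \<and> max a 0 \<le> t"
      using eventually_ge_at_top by (rule eventually_conj)
    then obtain t where "t < m / 2 * exp t - \<bar>b\<bar>" "max a 0 \<le> t"
      by (auto dest: eventually_happens)
    with grows[of t] show False by linarith
  qed
  have "\<rho> t * exp t \<le> \<rho> T * exp T"
  proof (rule DERIV_nonpos_imp_nonincreasing[OF t])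
    fix s assume "T \<le> s" "s \<le> t"
    then have "((\<lambda>s. \<rho> s * exp s) has_real_derivative (\<rho>1 s + \<rho> s) * exp s) (at s)"
      by (auto intro!: derivative_eq_intros d simp: algebra_simps)
    then show "\<exists>y. ((\<lambda>s. \<rho> s * exp s) has_real_derivative y) (at s) \<and> y \<le> 0"
      using neg[OF \<open>T \<le> s\<close>] by (intro exI[of _ "(\<rho>1 s + \<rho> s) * exp s"]) (auto simp: mult_nonpos_nonneg)
  qed
  then have "\<rho> t * exp t * exp (- t) \<le> \<rho> T * exp T * exp (- t)"
    by (rule mult_right_mono) auto
  then show ?thesis by (simp add: \<rho>_def mult.assoc flip: exp_add)
qed

text \<open>
  The sharp rate is obtained by comparison with \<open>exp (- t - c / t)\<close>, a supersolution of
  \<open>b'' = (1 - c / t\<^sup>2) b\<close>. The Wronskian-like quantity \<open>\<rho>' + 2 f \<rho>\<close>, where \<open>- f\<close> is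
  the logarithmic derivative of that function, is increasing; if it were positive somewhere, then
  \<open>\<rho>\<close> could not tend to zero. Hence \<open>\<rho> exp (2 t + 2 c / t)\<close> decreases.
\<close>
lemma perturbed_exponential_sharp_decay:
  fixes h h1 h2 :: "real \<Rightarrow> complex"
  assumes h: "\<And>t. T \<le> t \<Longrightarrow> (h has_vector_derivative h1 t) (at t)"
      "\<And>t. T \<le> t \<Longrightarrow> (h1 has_vector_derivative h2 t) (at t)"
    and T: "0 < T" and c: "0 \<le> c" "c \<le> T\<^sup>2"
    and ode: "\<And>t. T \<le> t \<Longrightarrow> norm (h2 t - h t) \<le> c / t\<^sup>2 * norm (h t)"
    and lim: "((\<lambda>t. (norm (h t))\<^sup>2) \<longlongrightarrow> 0) at_top"
  obtains M where "\<And>t. T \<le> t \<Longrightarrow> norm (h t) \<le> M * exp (- t)"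
proof -
  define \<rho> where "\<rho> t = (norm (h t))\<^sup>2" for t
  define \<rho>1 where "\<rho>1 t = 2 * (h t \<bullet> h1 t)" for t
  define \<rho>2 where "\<rho>2 t = 2 * (h t \<bullet> h2 t + (norm (h1 t))\<^sup>2)" for t
  define f where "f t = 1 - c / t\<^sup>2" for t
  have d: "(\<rho> has_real_derivative \<rho>1 t) (at t)" "(\<rho>1 has_real_derivative \<rho>2 t) (at t)" if "T \<le> t" for t
    using norm_square_derivative[of h h1 t, OF h(1)[OF that]] inner_derivative[of h h1 t h2, OF h(1,2)[OF that]]
    by (simp_all add: \<rho>_def[abs_def] \<rho>1_def[abs_def] \<rho>2_def)
  have fd: "(f has_real_derivative 2 * c / t ^ 3) (at t)" if "T \<le> t" for t
    unfolding f_def[abs_def]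
    by (auto intro!: derivative_eq_intros simp: eval_nat_numeral) (use that T in \<open>simp_all add: field_simps\<close>)
  have f01: "0 \<le> f t" "f t \<le> 1" if "T \<le> t" for t
  proof -
    have "T\<^sup>2 \<le> t\<^sup>2" using that T by (intro power_mono) auto
    then have "c \<le> t\<^sup>2" "0 < t\<^sup>2" using c that T by (linarith, simp)
    then show "0 \<le> f t" "f t \<le> 1" using c by (auto simp: f_def divide_simps)
  qed
  have rho0: "0 \<le> \<rho> t" for t by (simp add: \<rho>_def)
  define A where "A t = \<rho>1 t + 2 * (f t * \<rho> t)" for t
  have mono: "A s \<le> A t" if "T \<le> s" "s \<le> t" for s t
  proof (rule DERIV_nonneg_imp_nondecreasing[OF that(2)])
    fix r assume "s \<le> r" "r \<le> t"
    then have r: "T \<le> r" using that by simp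
    have "(A has_real_derivative \<rho>2 r + 2 * (2 * c / r ^ 3 * \<rho> r + f r * \<rho>1 r)) (at r)"
      unfolding A_def[abs_def] by (auto intro!: derivative_eq_intros d[OF r] fd[OF r] simp: algebra_simps)
    moreover have "0 \<le> \<rho>2 r + 2 * (2 * c / r ^ 3 * \<rho> r + f r * \<rho>1 r)"
    proof -
      have r0: "0 < r" using r T by simp
      have "(1 - c / r\<^sup>2) * \<rho> r \<le> h r \<bullet> h2 r"
        using inner_almost_equal_lower_bound[OF ode[OF r]] by (simp add: \<rho>_def)
      then have 1: "2 * (f r * \<rho> r + (norm (h1 r))\<^sup>2) \<le> \<rho>2 r"
        by (simp add: \<rho>2_def f_def)
      (* Completing the square disposes of the mixed term f rho'. *)
      have "(norm (h1 r + of_real (f r) * h r))\<^sup>2 = (norm (h1 r))\<^sup>2 + f r * \<rho>1 r + (f r)\<^sup>2 * \<rho> r"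
        unfolding \<rho>1_def \<rho>_def power2_norm_eq_inner
        by (simp add: inner_complex_def power2_eq_square algebra_simps)
      then have 2: "0 \<le> (norm (h1 r))\<^sup>2 + f r * \<rho>1 r + (f r)\<^sup>2 * \<rho> r" by (metis zero_le_power2)
      have 3: "0 \<le> 2 * c / r ^ 3 * \<rho> r" using c r0 rho0[of r] by simp
      have "(f r)\<^sup>2 * \<rho> r \<le> f r * \<rho> r"
        using f01[OF r] rho0[of r] by (intro mult_right_mono) (auto simp: power2_eq_square mult_le_cancel_left1 mult_left_le)
      with 1 2 3 show ?thesis by simp
    qed
    ultimately show "\<exists>y. (A has_real_derivative y) (at r) \<and> 0 \<le> y" by blast
  qed
  have lim': "(\<rho> \<longlongrightarrow> 0) at_top" using lim by (simp add: \<rho>_def[abs_def])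
  have neg: "A a \<le> 0" if a: "T \<le> a" for a
  proof (rule ccontr)
    assume "\<not> A a \<le> 0"
    then have m: "0 < A a" by simp
    have "\<forall>\<^sub>F t in at_top. \<rho> t < A a / 4"
      by (rule order_tendstoD(2)[OF lim']) (use m in auto)
    then obtain b where b: "\<And>t. b \<le> t \<Longrightarrow> \<rho> t < A a / 4"
      by (auto simp: eventually_at_top_linorder)
    define s where "s = max a b"
    have s: "a \<le> s" "b \<le> s" by (auto simp: s_def)
    have "\<rho> s - A a / 2 * s \<le> \<rho> (s + 1) - A a / 2 * (s + 1)"
    proof (rule DERIV_nonneg_imp_nondecreasing[of s "s + 1"])
      fix r assume r: "s \<le> r" "r \<le> s + 1"
      then have Tr: "T \<le> r" "a \<le> r" using s a by auto
      have "((\<lambda>r. \<rho> r - A a / 2 * r) has_real_derivative \<rho>1 r - A a / 2) (at r)"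
        by (auto intro!: derivative_eq_intros d[OF Tr(1)])
      moreover have "0 \<le> \<rho>1 r - A a / 2"
      proof -
        have "f r * \<rho> r \<le> 1 * \<rho> r" by (rule mult_right_mono[OF f01(2)[OF Tr(1)] rho0])
        then have "A r \<le> \<rho>1 r + 2 * \<rho> r" by (simp add: A_def)
        moreover have "A a \<le> A r" by (rule mono[OF a Tr(2)])
        moreover have "\<rho> r < A a / 4" by (rule b) (use s r in auto)
        ultimately show ?thesis by linarith
      qed
      ultimately show "\<exists>y. ((\<lambda>r. \<rho> r - A a / 2 * r) has_real_derivative y) (at r) \<and> 0 \<le> y" by blast
    qed auto
    moreover have "A a / 2 * (s + 1) = A a / 2 * s + A a / 2" by (simp add: distrib_left)
    ultimately have "A a / 2 \<le> \<rho> (s + 1)" using rho0[of s] by linarith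
    with b[of "s + 1"] s m show False by simp
  qed
  define G where "G t = \<rho> t * exp (2 * t + 2 * c / t)" for t
  have G: "G t \<le> G T" if t: "T \<le> t" for t
  proof (rule DERIV_nonpos_imp_nonincreasing[OF t])
    fix s assume s: "T \<le> s" "s \<le> t"
    have s0: "0 < s" using s T by simp
    have "(G has_real_derivative A s * exp (2 * s + 2 * c / s)) (at s)"
      unfolding G_def[abs_def] A_def f_def using s0
      by (auto intro!: derivative_eq_intros d[OF s(1)] simp: algebra_simps power2_eq_square)
    then show "\<exists>y. (G has_real_derivative y) (at s) \<and> y \<le> 0"
      using neg[OF s(1)] by (intro exI[of _ "A s * exp (2 * s + 2 * c / s)"]) (auto simp: mult_nonpos_nonneg)
  qed
  show thesis
  proof (rule that[of "sqrt (G T)"])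
    fix t assume t: "T \<le> t"
    have "\<rho> t * exp (2 * t) \<le> G t"
      unfolding G_def using c t T rho0[of t] by (intro mult_left_mono) auto
    also have "\<dots> \<le> G T" by (rule G[OF t])
    finally have "\<rho> t * exp (2 * t) * exp (- (2 * t)) \<le> G T * exp (- (2 * t))"
      by (rule mult_right_mono) auto
    then have "\<rho> t \<le> G T * exp (- (2 * t))" by (simp add: mult.assoc flip: exp_add)
    also have "\<dots> = (sqrt (G T) * exp (- t))\<^sup>2"
    proof -
      have "0 \<le> G T" using rho0[of T] by (simp add: G_def)
      moreover have "(exp (- t))\<^sup>2 = exp (- (2 * t))" by (simp add: power2_eq_square flip: exp_add)
      ultimately show ?thesis by (simp add: power_mult_distrib)
    qed
    finally have "(norm (h t))\<^sup>2 \<le> (sqrt (G T) * exp (- t))\<^sup>2" by (simp add: \<rho>_def)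
    then show "norm (h t) \<le> sqrt (G T) * exp (- t)"
      by (rule power2_le_imp_le) (simp add: G_def rho0)
  qed
qed

lemma tendsto_of_tail_bound:
  fixes P :: "real \<Rightarrow> complex"
  assumes P: "\<And>s t. 0 < T \<Longrightarrow> T \<le> s \<Longrightarrow> s \<le> t \<Longrightarrow> norm (P t - P s) \<le> B / s" and T: "0 < T"
  obtains L where "(P \<longlongrightarrow> L) at_top"
proof -
  have lim0: "((\<lambda>t. B / t) \<longlongrightarrow> 0) at_top" by real_asymp
  have lim0': "(\<lambda>n. B / real n) \<longlonglongrightarrow> 0"
    using lim0 filterlim_real_sequentially by (rule filterlim_compose)
  have "Cauchy (\<lambda>n. P (real n))"
  proof (rule CauchyI')
    fix e :: real assume "e > 0"
    have "\<forall>\<^sub>F n in sequentially. B / real n < e"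
      by (rule order_tendstoD(2)[OF lim0' \<open>e > 0\<close>])
    moreover have "\<forall>\<^sub>F n in sequentially. T \<le> real n"
      using filterlim_real_sequentially by (auto simp: filterlim_at_top)
    ultimately have "\<forall>\<^sub>F n in sequentially. B / real n < e \<and> T \<le> real n" by (rule eventually_conj)
    then obtain n0 where n0: "\<And>n. n0 \<le> n \<Longrightarrow> B / real n < e \<and> T \<le> real n"
      by (auto simp: eventually_sequentially)
    show "\<exists>M. \<forall>m\<ge>M. \<forall>n>m. dist (P (real m)) (P (real n)) < e"
    proof (intro exI allI impI)
      fix m n :: nat assume mn: "n0 \<le> m" "m < n"
      show "dist (P (real m)) (P (real n)) < e"
        using P[OF T, of "real m" "real n"] n0[OF mn(1)] mn by (simp add: dist_norm norm_minus_commute)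
    qed
  qed
  then obtain L where L: "(\<lambda>n. P (real n)) \<longlonglongrightarrow> L"
    using Cauchy_convergent convergent_def by blast
  have close: "norm (L - P t) \<le> B / t" if t: "T \<le> t" for t
  proof (rule tendsto_upperbound)
    show "(\<lambda>n. norm (P (real n) - P t)) \<longlonglongrightarrow> norm (L - P t)"
      by (intro tendsto_intros L)
    have "\<forall>\<^sub>F n in sequentially. t \<le> real n"
      using filterlim_real_sequentially by (auto simp: filterlim_at_top)
    then show "\<forall>\<^sub>F n in sequentially. norm (P (real n) - P t) \<le> B / t"
      by eventually_elim (use P[OF T t] in blast)
  qed auto
  have "((\<lambda>t. P t - L) \<longlongrightarrow> 0) at_top"
  proof (rule Lim_null_comparison[OF _ lim0])
    show "\<forall>\<^sub>F t in at_top. norm (P t - L) \<le> B / t"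
      using eventually_ge_at_top[of T]
      by eventually_elim (use close in \<open>simp add: norm_minus_commute\<close>)
  qed
  then show thesis by (intro that[of L]) (rule LIM_zero_cancel)
qed

text \<open>
  Variation of constants: the coefficient of \<open>exp (- t)\<close> has an integrable derivative, hence a
  limit, and the coefficient of \<open>exp t\<close> tends to zero, hence is controlled by the integral of its
  derivative from \<open>t\<close> to infinity.
\<close>
lemma perturbed_exponential_asymptotics:
  fixes h h1 h2 :: "real \<Rightarrow> complex"
  assumes h: "\<And>t. T \<le> t \<Longrightarrow> (h has_vector_derivative h1 t) (at t)"
      "\<And>t. T \<le> t \<Longrightarrow> (h1 has_vector_derivative h2 t) (at t)"
    and T: "0 < T" and c: "0 \<le> c" "c \<le> T\<^sup>2"
    and ode: "\<And>t. T \<le> t \<Longrightarrow> norm (h2 t - h t) \<le> c / t\<^sup>2 * norm (h t)"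
    and M: "\<And>t. T \<le> t \<Longrightarrow> norm (h t) \<le> M * exp (- t)"
  obtains C where "((\<lambda>t. exp t * h t) \<longlongrightarrow> C) at_top" "((\<lambda>t. exp t * h1 t) \<longlongrightarrow> - C) at_top"
proof -
  have M0: "0 \<le> M"
  proof -
    have "0 \<le> M * exp (- T)" using M[of T] norm_ge_zero[of "h T"] by linarith
    then show ?thesis by (simp add: zero_le_mult_iff)
  qed
  have ne: "norm (exp (of_real t :: complex)) = exp t" for t by (simp add: norm_exp_eq_Re)
  have ode': "norm (h2 t - h t) \<le> c * M / t\<^sup>2 * exp (- t)" if "T \<le> t" for t
  proof -
    have "c / t\<^sup>2 * norm (h t) \<le> c / t\<^sup>2 * (M * exp (- t))"
      by (rule mult_left_mono[OF M[OF that]]) (use c in auto)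
    with ode[OF that] show ?thesis by (simp add: mult_ac)
  qed
  have h2b: "norm (h2 t) \<le> 2 * M * exp (- t)" if "T \<le> t" for t
  proof -
    have "T\<^sup>2 \<le> t\<^sup>2" using that T by (intro power_mono) auto
    then have "c \<le> t\<^sup>2" using c by linarith
    then have "c / t\<^sup>2 \<le> 1" using that T by (auto simp: divide_simps)
    then have "c / t\<^sup>2 * norm (h t) \<le> 1 * norm (h t)" by (rule mult_right_mono) auto
    then have "norm (h2 t - h t) \<le> norm (h t)" using ode[OF that] by simp
    then show ?thesis using M[OF that] norm_triangle_sub[of "h2 t" "h t"] by simp
  qed
  (* A bound for the first derivative by interpolation between h and h2 on an interval of length one. *)
  have h1b: "norm (h1 t) \<le> 4 * M * exp (- t)" if t: "T \<le> t" for t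
  proof -
    have B0: "0 \<le> 2 * M * exp (- t)" using M0 by simp
    have osc: "norm (h1 s - h1 t) \<le> 2 * M * exp (- t)" if s: "t \<le> s" "s \<le> t + 1" for s
    proof -
      have "norm (h1 s - h1 t) \<le> 2 * M * exp (- t) * (s - t)"
      proof (rule vector_derivative_constant_bound[OF s(1)])
        fix r assume r: "t \<le> r"
        then have Tr: "T \<le> r" using t by simp
        show "(h1 has_vector_derivative h2 r) (at r)" by (rule h(2)[OF Tr])
        have "exp (- r) \<le> exp (- t)" using r by simp
        then have "2 * M * exp (- r) \<le> 2 * M * exp (- t)" using M0 by (intro mult_left_mono) auto
        with h2b[OF Tr] show "norm (h2 r) \<le> 2 * M * exp (- t)" by linarith
      qed
      also have "\<dots> \<le> 2 * M * exp (- t) * 1" using s B0 by (intro mult_left_mono) auto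
      finally show ?thesis by simp
    qed
    have "norm (h (t + 1) - h t - (t + 1 - t) *\<^sub>R h1 t) \<le> norm (t + 1 - t) * (2 * M * exp (- t))"
    proof (rule vector_differentiable_bound_linearization)
      show "(h has_vector_derivative h1 r) (at r within {t..t + 1})" if "r \<in> {t..t + 1}" for r
        using h(1)[of r] that t by (auto intro: has_vector_derivative_at_within)
    qed (use osc in \<open>auto simp: closed_segment_eq_real_ivl\<close>)
    then have 1: "norm ((h (t + 1) - h t) - h1 t) \<le> 2 * M * exp (- t)" by simp
    have "norm (h (t + 1)) \<le> M * exp (- t)"
    proof -
      have "M * exp (- (t + 1)) \<le> M * exp (- t)" using M0 by (intro mult_left_mono) auto
      with M[of "t + 1"] t show ?thesis by simp
    qed
    then have 2: "norm (h (t + 1) - h t) \<le> 2 * M * exp (- t)"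
      using norm_triangle_ineq4[of "h (t + 1)" "h t"] M[OF t] by simp
    from 1 2 show ?thesis
      using norm_triangle_ineq4[of "h (t + 1) - h t" "(h (t + 1) - h t) - h1 t"] by simp
  qed
  have exd: "((\<lambda>t. exp (of_real t :: complex)) has_vector_derivative exp (of_real t)) (at t)" for t
  proof -
    have "((\<lambda>t. of_real t :: complex) has_vector_derivative 1) (at t)"
      by (auto intro!: derivative_eq_intros)
    from field_vector_diff_chain_at[OF this DERIV_exp] show ?thesis by (simp add: o_def)
  qed
  have emd: "((\<lambda>t. exp (- of_real t :: complex)) has_vector_derivative - exp (- of_real t)) (at t)" for t
  proof -
    have "((\<lambda>t. - of_real t :: complex) has_vector_derivative - 1) (at t)"
      by (auto intro!: derivative_eq_intros)
    from field_vector_diff_chain_at[OF this DERIV_exp] show ?thesis by (simp add: o_def)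
  qed
  define P where "P t = exp (of_real t) * (h t - h1 t)" for t
  define Q where "Q t = exp (- of_real t) * (h t + h1 t)" for t
  have Pd: "(P has_vector_derivative exp (of_real t) * (h t - h2 t)) (at t)" if "T \<le> t" for t
    unfolding P_def[abs_def]
    using has_vector_derivative_mult[OF exd[of t] has_vector_derivative_diff[OF h[OF that]]]
    by (simp add: algebra_simps)
  have Qd: "(Q has_vector_derivative exp (- of_real t) * (h2 t - h t)) (at t)" if "T \<le> t" for t
    unfolding Q_def[abs_def]
    using has_vector_derivative_mult[OF emd[of t] has_vector_derivative_add[OF h[OF that]]]
    by (simp add: algebra_simps)
  have "norm (P t - P s) \<le> c * M / s" if "T \<le> s" "s \<le> t" for s t
  proof (rule vector_derivative_inverse_square_bound[OF _ that(2) Pd])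
    fix r assume "s \<le> r"
    then have r: "T \<le> r" using that by simp
    have "exp r * norm (h2 r - h r) \<le> exp r * (c * M / r\<^sup>2 * exp (- r))"
      by (rule mult_left_mono[OF ode'[OF r]]) auto
    also have "\<dots> = c * M / r\<^sup>2" by (simp add: exp_minus)
    finally show "norm (exp (of_real r) * (h r - h2 r)) \<le> c * M / r\<^sup>2"
      by (simp add: norm_mult ne norm_minus_commute)
  qed (use that T in auto)
  then obtain L where L: "(P \<longlongrightarrow> L) at_top"
    using tendsto_of_tail_bound[of T P "c * M"] T by blast
  have sumb: "norm (h t + h1 t) \<le> 5 * M * exp (- t)" if "T \<le> t" for t
    using norm_triangle_ineq[of "h t" "h1 t"] M[OF that] h1b[OF that] by simp
  have Q0: "(Q \<longlongrightarrow> 0) at_top"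
  proof (rule Lim_null_comparison)
    show "((\<lambda>t. exp (- t) * (5 * M * exp (- t))) \<longlongrightarrow> 0) at_top" by real_asymp
    show "\<forall>\<^sub>F t in at_top. norm (Q t) \<le> exp (- t) * (5 * M * exp (- t))"
      using eventually_ge_at_top[of T]
    proof eventually_elim
      case (elim t)
      have "norm (exp (- of_real t :: complex)) = exp (- t)" by (simp add: norm_exp_eq_Re)
      then show ?case unfolding Q_def norm_mult using mult_left_mono[OF sumb[OF elim], of "exp (- t)"] by simp
    qed
  qed
  have Qb: "norm (Q t) \<le> exp (- 2 * t) * (c * M) / t" if t: "T \<le> t" for t
  proof -
    have t0: "0 < t" using t T by simp
    have "norm (0 - Q t) \<le> exp (- 2 * t) * (c * M) / t"
    proof (rule tendsto_at_top_norm_le[OF Q0])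
      fix b assume "t \<le> b"
      then show "norm (Q b - Q t) \<le> exp (- 2 * t) * (c * M) / t"
      proof (rule vector_derivative_inverse_square_bound[OF t0 _ Qd])
        fix r assume r: "t \<le> r"
        then have Tr: "T \<le> r" using t by simp
        have "exp (- r) * norm (h2 r - h r) \<le> exp (- r) * (c * M / r\<^sup>2 * exp (- r))"
          by (rule mult_left_mono[OF ode'[OF Tr]]) auto
        also have "\<dots> = c * M / r\<^sup>2 * exp (- 2 * r)" by (simp add: mult_ac flip: exp_add)
        also have "\<dots> \<le> c * M / r\<^sup>2 * exp (- 2 * t)"
          by (rule mult_left_mono) (use r c M0 in auto)
        finally show "norm (exp (- of_real r) * (h2 r - h r)) \<le> exp (- 2 * t) * (c * M) / r\<^sup>2"
          by (simp add: norm_mult norm_exp_eq_Re mult_ac)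
      qed (use t T in auto)
    qed
    then show ?thesis by simp
  qed
  have S: "((\<lambda>t. exp (of_real t) * (h t + h1 t)) \<longlongrightarrow> 0) at_top"
  proof (rule Lim_null_comparison)
    show "((\<lambda>t. c * M / t) \<longlongrightarrow> 0) at_top" by real_asymp
    show "\<forall>\<^sub>F t in at_top. norm (exp (of_real t) * (h t + h1 t)) \<le> c * M / t"
      using eventually_ge_at_top[of T]
    proof eventually_elim
      case (elim t)
      have "exp (of_real t) * (h t + h1 t) = exp (2 * of_real t) * Q t"
        by (simp add: Q_def flip: exp_add mult.assoc)
      then have "norm (exp (of_real t) * (h t + h1 t)) = exp (2 * t) * norm (Q t)"
        by (simp add: norm_mult norm_exp_eq_Re)
      also have "\<dots> \<le> exp (2 * t) * (exp (- 2 * t) * (c * M) / t)"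
        by (rule mult_left_mono[OF Qb[OF elim]]) auto
      also have "\<dots> = c * M / t" by (simp add: exp_minus)
      finally show ?case .
    qed
  qed
  show thesis
  proof (rule that[of "L / 2"])
    have "((\<lambda>t. (P t + exp (of_real t) * (h t + h1 t)) / 2) \<longlongrightarrow> (L + 0) / 2) at_top"
      by (intro tendsto_intros L S) auto
    then show "((\<lambda>t. exp t * h t) \<longlongrightarrow> L / 2) at_top"
      by (simp add: P_def algebra_simps exp_of_real)
    have "((\<lambda>t. (exp (of_real t) * (h t + h1 t) - P t) / 2) \<longlongrightarrow> (0 - L) / 2) at_top"
      by (intro tendsto_intros L S) auto
    then show "((\<lambda>t. exp t * h1 t) \<longlongrightarrow> - (L / 2)) at_top"
      by (simp add: P_def algebra_simps exp_of_real)
  qed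
qed

context forced_pendulum
begin

text \<open>
  Mere convergence of \<open>v\<close> to zero on the real axis bootstraps to exponential closeness to \<open>u\<close>:
  first \<open>q = o(1)\<close> gives some exponential decay of the gauged difference, then \<open>v\<close> itself is
  \<open>O(1 / x)\<close>, so that \<open>q = O(x\<^sup>-\<^sup>2)\<close>, and the sharp results apply.
\<close>
lemma recessive_difference_on_real_ray:
  assumes u: "\<And>t. T \<le> t \<Longrightarrow> u analytic_on {of_real t}" "\<And>t. T \<le> t \<Longrightarrow> solves u (of_real t)"
      "\<And>t. T \<le> t \<Longrightarrow> norm (u (of_real t)) \<le> M / t"
    and v: "\<And>t. T \<le> t \<Longrightarrow> v analytic_on {of_real t}" "\<And>t. T \<le> t \<Longrightarrow> solves v (of_real t)"
      "((\<lambda>t. v (of_real t)) \<longlongrightarrow> 0) at_top"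
  defines "\<eta> \<equiv> \<lambda>x. csqrt x * (v x - u x)"
  obtains C M' T' where "((\<lambda>t. exp (of_real t) * \<eta> (of_real t)) \<longlongrightarrow> C) at_top"
    "((\<lambda>t. exp (of_real t) * deriv \<eta> (of_real t)) \<longlongrightarrow> - C) at_top"
    "\<And>t. T' \<le> t \<Longrightarrow> norm (v (of_real t)) \<le> M' / t"
proof -
  have v0: "((\<lambda>t. norm (v (of_real t))) \<longlongrightarrow> 0) at_top"
    using v(3) by (rule tendsto_norm_zero)
  have M0: "((\<lambda>t. \<bar>M\<bar> / t) \<longlongrightarrow> 0) at_top" by real_asymp
  have i0: "((\<lambda>t::real. 1 / t) \<longlongrightarrow> 0) at_top" "((\<lambda>t::real. 1 / t\<^sup>2) \<longlongrightarrow> 0) at_top" by real_asymp+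
  have "((\<lambda>t. K * (\<bar>M\<bar> / t + norm (v (of_real t)) + 1 / t)\<^sup>2 + 1 / t\<^sup>2) \<longlongrightarrow> K * (0 + 0 + 0)\<^sup>2 + 0) at_top"
    by (intro tendsto_intros M0 v0 i0)
  then have q0: "\<forall>\<^sub>F t in at_top. K * (\<bar>M\<bar> / t + norm (v (of_real t)) + 1 / t)\<^sup>2 + 1 / t\<^sup>2 < 1/2"
    by (rule order_tendstoD) simp
  have "\<forall>\<^sub>F t in at_top. norm (v (of_real t)) < 1/2" by (rule order_tendstoD[OF v0]) simp
  moreover have "\<forall>\<^sub>F t in at_top. \<bar>M\<bar> / t < 1/2" by (rule order_tendstoD[OF M0]) simp
  ultimately have "\<forall>\<^sub>F t in at_top. (norm (v (of_real t)) < 1/2 \<and> \<bar>M\<bar> / t < 1/2) \<and>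
      (K * (\<bar>M\<bar> / t + norm (v (of_real t)) + 1 / t)\<^sup>2 + 1 / t\<^sup>2 < 1/2 \<and> max T 1 \<le> t)"
    using q0 eventually_ge_at_top by (intro eventually_conj)
  then obtain T1 where T1: "\<And>t. T1 \<le> t \<Longrightarrow> norm (v (of_real t)) < 1/2" "\<And>t. T1 \<le> t \<Longrightarrow> \<bar>M\<bar> / t < 1/2"
    "\<And>t. T1 \<le> t \<Longrightarrow> K * (\<bar>M\<bar> / t + norm (v (of_real t)) + 1 / t)\<^sup>2 + 1 / t\<^sup>2 < 1/2"
    "\<And>t. T1 \<le> t \<Longrightarrow> max T 1 \<le> t"
    unfolding eventually_at_top_linorder by blast
  have t1: "T \<le> t" "1 \<le> t" if "T1 \<le> t" for t using T1(4)[OF that] by auto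
  have \<eta>_at: "csqrt y * (v y - u y) = \<eta> y" for y by (simp add: \<eta>_def)
  have ub: "norm (u (of_real t)) \<le> \<bar>M\<bar> / t" if "T1 \<le> t" for t
  proof -
    have "M / t \<le> \<bar>M\<bar> / t" using t1[OF that] by (intro divide_right_mono) auto
    then show ?thesis using u(3)[OF t1(1)[OF that]] by linarith
  qed
  have db: "norm (deriv (deriv \<eta>) (of_real t) - \<eta> (of_real t))
      \<le> (K * (norm (u (of_real t)) + norm (v (of_real t)) + 1 / t)\<^sup>2 + 1 / t\<^sup>2) * norm (\<eta> (of_real t))"
    "\<eta> analytic_on {of_real t}" if t: "T1 \<le> t" for t
  proof -
    have t0: "norm (of_real t :: complex) = t" using t1[OF t] by simp
    have x: "complex_of_real t \<notin> \<real>\<^sub>\<le>\<^sub>0" "1 \<le> norm (complex_of_real t)"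
      using t1[OF t] by (auto simp: complex_nonpos_Reals_iff)
    have uv: "norm (u (of_real t)) \<le> 1/2" "norm (v (of_real t)) \<le> 1/2"
      using ub[OF t] T1(1,2)[OF t] by linarith+
    note d = difference_equation_bound[OF u(1,2)[OF t1(1)[OF t]] uv(1) v(1,2)[OF t1(1)[OF t]] uv(2) x,
        unfolded t0 \<eta>_at]
    show "norm (deriv (deriv \<eta>) (of_real t) - \<eta> (of_real t))
      \<le> (K * (norm (u (of_real t)) + norm (v (of_real t)) + 1 / t)\<^sup>2 + 1 / t\<^sup>2) * norm (\<eta> (of_real t))"
      "\<eta> analytic_on {of_real t}" by (rule d)+
  qed
  define h where "h t = \<eta> (of_real t)" for t
  define h1 where "h1 t = deriv \<eta> (of_real t)" for t
  define h2 where "h2 t = deriv (deriv \<eta>) (of_real t)" for t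
  have hd: "(h has_vector_derivative h1 t) (at t)" "(h1 has_vector_derivative h2 t) (at t)" if "T1 \<le> t" for t
    using analytic_ray_derivatives[of \<eta> t 1] db(2)[OF that]
    by (simp_all add: h_def[abs_def] h1_def[abs_def] h2_def)
  have hsq: "(norm (h t))\<^sup>2 = t * (norm (v (of_real t) - u (of_real t)))\<^sup>2" if "T1 \<le> t" for t
    using csqrt_norm_sq[of "of_real t"] t1[OF that]
    by (simp add: h_def \<eta>_def norm_mult power_mult_distrib)
  have grow: "(norm (h t))\<^sup>2 \<le> t" if t: "T1 \<le> t" for t
  proof -
    have "norm (v (of_real t) - u (of_real t)) \<le> 1"
      using norm_triangle_ineq4[of "v (of_real t)" "u (of_real t)"] ub[OF t] T1(1,2)[OF t] by linarith
    then have "(norm (v (of_real t) - u (of_real t)))\<^sup>2 \<le> 1" by (simp add: power_le_one)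
    then have "t * (norm (v (of_real t) - u (of_real t)))\<^sup>2 \<le> t * 1" using t1[OF t] by (intro mult_left_mono) auto
    then show ?thesis by (simp add: hsq[OF t])
  qed
  have half: "norm (h2 t - h t) \<le> 1/2 * norm (h t)" if t: "T1 \<le> t" for t
  proof -
    have "K * (norm (u (of_real t)) + norm (v (of_real t)) + 1 / t)\<^sup>2 + 1 / t\<^sup>2
       \<le> K * (\<bar>M\<bar> / t + norm (v (of_real t)) + 1 / t)\<^sup>2 + 1 / t\<^sup>2"
      using K ub[OF t] t1[OF t] by (intro add_right_mono mult_left_mono power_mono) auto
    also have "\<dots> \<le> 1/2" using T1(3)[OF t] by simp
    finally show ?thesis unfolding h_def h2_def
      by (rule order_trans[OF db(1)[OF t] mult_right_mono]) simp
  qed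
  define M1 where "M1 = (norm (h T1))\<^sup>2 * exp T1"
  have M1: "0 \<le> M1" by (simp add: M1_def)
  have dec: "(norm (h t))\<^sup>2 \<le> M1 * exp (- t)" if "T1 \<le> t" for t
    unfolding M1_def by (rule perturbed_exponential_slow_growth_imp_decay[OF hd half grow that])
  define M' where "M' = \<bar>M\<bar> + 2 * sqrt M1"
  have vb: "norm (v (of_real t)) \<le> M' / t" if t: "T1 \<le> t" for t
  proof -
    have t0: "0 < t" using t1[OF t] by simp
    have "(norm (v (of_real t) - u (of_real t)))\<^sup>2 * 1 \<le> (norm (v (of_real t) - u (of_real t)))\<^sup>2 * t"
      using t1[OF t] by (intro mult_left_mono) auto
    then have "(norm (v (of_real t) - u (of_real t)))\<^sup>2 \<le> M1 * exp (- t)"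
      using dec[OF t] unfolding hsq[OF t] by (simp add: mult.commute)
    also have "\<dots> = (sqrt M1 * exp (- t / 2))\<^sup>2"
    proof -
      have "(exp (- t / 2))\<^sup>2 = exp (- t)" by (simp add: power2_eq_square flip: exp_add)
      then show ?thesis using M1 by (simp only: power_mult_distrib) simp
    qed
    finally have 1: "norm (v (of_real t) - u (of_real t)) \<le> sqrt M1 * exp (- t / 2)"
      by (rule power2_le_imp_le) (use M1 in auto)
    have "t / 2 \<le> exp (t / 2)" using exp_ge_add_one_self[of "t / 2"] by linarith
    then have "exp (- t / 2) \<le> 2 / t"
      using t0 by (simp add: exp_minus divide_simps)
    then have "sqrt M1 * exp (- t / 2) \<le> sqrt M1 * (2 / t)" using M1 by (intro mult_left_mono) auto
    then have "norm (v (of_real t) - u (of_real t)) \<le> 2 * sqrt M1 / t" using 1 by (simp add: mult.commute)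
    then have "norm (v (of_real t)) \<le> \<bar>M\<bar> / t + 2 * sqrt M1 / t"
      using norm_triangle_sub[of "v (of_real t)" "u (of_real t)"] ub[OF t] by linarith
    then show ?thesis by (simp add: M'_def add_divide_distrib)
  qed
  define c where "c = K * (\<bar>M\<bar> + M' + 1)\<^sup>2 + 1"
  have c: "1 \<le> c" using K by (simp add: c_def)
  define T2 where "T2 = max T1 c"
  have T2: "T1 \<le> T2" "1 \<le> T2" "c \<le> T2\<^sup>2"
  proof -
    show "T1 \<le> T2" "1 \<le> T2" using c by (auto simp: T2_def)
    then have "T2 * 1 \<le> T2 * T2" by (intro mult_left_mono) auto
    then show "c \<le> T2\<^sup>2" by (simp add: T2_def power2_eq_square)
  qed
  have ode: "norm (h2 t - h t) \<le> c / t\<^sup>2 * norm (h t)" if t2: "T2 \<le> t" for t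
  proof -
    have t: "T1 \<le> t" using t2 T2 by simp
    have t0: "0 < t" using t1[OF t] by simp
    have "K * (norm (u (of_real t)) + norm (v (of_real t)) + 1 / t)\<^sup>2 + 1 / t\<^sup>2
       \<le> K * (\<bar>M\<bar> / t + M' / t + 1 / t)\<^sup>2 + 1 / t\<^sup>2"
      using K ub[OF t] vb[OF t] t0 by (intro add_right_mono mult_left_mono power_mono add_mono) auto
    also have "\<dots> = c / t\<^sup>2"
    proof -
      have eq: "\<bar>M\<bar> / t + M' / t + 1 / t = (\<bar>M\<bar> + M' + 1) / t" by (simp add: add_divide_distrib)
      show ?thesis unfolding eq power_divide c_def by (simp add: add_divide_distrib)
    qed
    finally show ?thesis unfolding h_def h2_def
      by (rule order_trans[OF db(1)[OF t] mult_right_mono]) simp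
  qed
  have T20: "0 < T2" "0 \<le> c" using T2 c by auto
  have hd2: "(h has_vector_derivative h1 t) (at t)" "(h1 has_vector_derivative h2 t) (at t)" if "T2 \<le> t" for t
    using hd[of t] that T2 by auto
  have lim: "((\<lambda>t. (norm (h t))\<^sup>2) \<longlongrightarrow> 0) at_top"
  proof (rule Lim_null_comparison)
    show "((\<lambda>t. M1 * exp (- t)) \<longlongrightarrow> 0) at_top" by real_asymp
    show "\<forall>\<^sub>F t in at_top. norm ((norm (h t))\<^sup>2) \<le> M1 * exp (- t)"
      using eventually_ge_at_top[of T1] by eventually_elim (use dec in simp)
  qed
  obtain M2 where M2: "\<And>t. T2 \<le> t \<Longrightarrow> norm (h t) \<le> M2 * exp (- t)"
    using perturbed_exponential_sharp_decay[OF hd2 T20(1,2) T2(3) ode lim] by blast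
  obtain C where "((\<lambda>t. exp (of_real t) * h t) \<longlongrightarrow> C) at_top" "((\<lambda>t. exp (of_real t) * h1 t) \<longlongrightarrow> - C) at_top"
    using perturbed_exponential_asymptotics[OF hd2 T20(1,2) T2(3) ode M2] by blast
  with vb show thesis by (intro that[of C T1 M']) (auto simp: h_def h1_def)
qed

end

section \<open>The one-parameter family of recessive perturbations\<close>

text \<open>
  The size of the coefficient \<open>q\<close> in \<open>\<eta>'' = (1 + q) \<eta>\<close> when \<open>\<eta>\<close> is of the order of
  \<open>exp (- x)\<close>: the first summand stems from the \<open>O(1 / x)\<close> base solution, the second one from the
  square of the gauged perturbation \<open>x\<^sup>-\<^sup>1\<^sup>/\<^sup>2 \<eta>\<close>. Only horizontal rays are used for
  integration since on vertical lines the second summand is not integrable.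
\<close>
definition recessive_weight :: "complex \<Rightarrow> real" where
  "recessive_weight x = 1 / (norm x)\<^sup>2 + exp (- 2 * Re x) / norm x"

context
  fixes A :: "complex set" and \<mu> :: complex
  assumes A: "open A" "convex A" and shift: "\<And>x s. x \<in> A \<Longrightarrow> 0 \<le> s \<Longrightarrow> x + of_real s * 1 \<in> A"
    and re: "\<And>x. x \<in> A \<Longrightarrow> - 1 < Re x" and far: "\<And>x. x \<in> A \<Longrightarrow> 2 \<le> norm x"
    and \<mu>: "\<mu> = 1 \<or> \<mu> = - 1"
begin

text \<open>
  Since \<open>Re x > - 1\<close>, a horizontal shift to the right increases the modulus linearly, up to a
  constant.
\<close>
lemma recessive_weight_shift:
  assumes x: "x \<in> A" and s: "0 \<le> s"
  shows "recessive_weight (x + of_real s * 1) \<le> 4 / (norm x + s)\<^sup>2 + 2 * exp 2 / norm x * exp (- 2 * s)"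
proof -
  let ?y = "x + of_real s * 1"
  have n: "2 \<le> norm x" "0 < norm x" using far[OF x] by auto
  have "(norm ?y)\<^sup>2 = (norm x)\<^sup>2 + 2 * s * Re x + s\<^sup>2"
    unfolding cmod_power2 by (simp add: power2_eq_square algebra_simps)
  moreover have "- (2 * s) \<le> 2 * s * Re x"
    using mult_left_mono[OF less_imp_le[OF re[OF x]], of "2 * s"] s by simp
  moreover have "2\<^sup>2 \<le> (norm x)\<^sup>2" using n by (intro power_mono) auto
  moreover have "0 \<le> (s - 2)\<^sup>2" by simp
  then have "4 * s \<le> s\<^sup>2 + 4" by (simp add: power2_diff)
  moreover have "0 \<le> (norm x - s)\<^sup>2" by simp
  then have "2 * (norm x * s) \<le> (norm x)\<^sup>2 + s\<^sup>2" by (simp add: power2_diff)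
  ultimately have "((norm x + s) / 2)\<^sup>2 \<le> (norm ?y)\<^sup>2"
    by (simp add: power_divide power2_sum)
  then have ny: "(norm x + s) / 2 \<le> norm ?y" by (rule power2_le_imp_le) simp
  have ns: "0 < norm x + s" using n s by simp
  have y0: "0 < norm ?y" by (rule less_le_trans[OF _ ny]) (use ns in simp)
  have 1: "1 / (norm ?y)\<^sup>2 \<le> 4 / (norm x + s)\<^sup>2"
  proof -
    have "((norm x + s) / 2)\<^sup>2 \<le> (norm ?y)\<^sup>2" using ny ns by (intro power_mono) auto
    then have "1 / (norm ?y)\<^sup>2 \<le> 1 / ((norm x + s) / 2)\<^sup>2"
      using ns y0 by (intro divide_left_mono mult_pos_pos zero_less_power) auto
    then show ?thesis by (simp add: power_divide)
  qed
  have "1 / norm ?y \<le> 2 / norm x"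
  proof -
    have "norm x \<le> 2 * norm ?y"
      by (rule order_trans[OF _ mult_left_mono[OF ny, of 2]]) (use s in auto)
    then show ?thesis using y0 n by (simp add: divide_simps mult.commute)
  qed
  moreover have "exp (- 2 * Re ?y) \<le> exp 2 * exp (- 2 * s)"
    using re[OF x] by (simp flip: exp_add)
  ultimately have "1 / norm ?y * exp (- 2 * Re ?y) \<le> 2 / norm x * (exp 2 * exp (- 2 * s))"
    using n by (intro mult_mono) auto
  with 1 show ?thesis by (simp add: recessive_weight_def)
qed

lemma recessive_majorant_deriv:
  assumes n: "0 < n" and s: "0 \<le> s"
  shows "((\<lambda>s. B * (4 / (n + s) + exp 2 / n * exp (- 2 * s))) has_real_derivative
           - (B * (4 / (n + s)\<^sup>2 + 2 * exp 2 / n * exp (- 2 * s)))) (at s)"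
  using assms by (auto intro!: derivative_eq_intros simp: power2_eq_square algebra_simps)

lemma recessive_majorant_lim:
  fixes n B :: real
  assumes n: "0 < n"
  shows "((\<lambda>s. B * (4 / (n + s) + exp 2 / n * exp (- 2 * s))) \<longlongrightarrow> 0) at_top"
    and "((\<lambda>s. B * (4 / (n + s)\<^sup>2 + 2 * exp 2 / n * exp (- 2 * s))) \<longlongrightarrow> 0) at_top"
  by real_asymp+

lemma recessive_integrand_bound:
  assumes F: "\<And>x. x \<in> A \<Longrightarrow> norm (F x) \<le> m * recessive_weight x * exp (- Re x)" and m: "0 \<le> m"
    and x: "x \<in> A" and s: "0 \<le> s"
  shows "norm (exp (- \<mu> * of_real s) * F (x + of_real s * 1))
      \<le> m * exp (- Re x) * (4 / (norm x + s)\<^sup>2 + 2 * exp 2 / norm x * exp (- 2 * s))"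
    and "norm (exp (- \<mu> * of_real s) * F (x + of_real s * 1))
      \<le> m * exp 1 * (4 / (2 + s)\<^sup>2 + 2 * exp 2 / 2 * exp (- 2 * s))"
proof -
  let ?y = "x + of_real s * 1"
  have y: "?y \<in> A" by (rule shift[OF x s])
  have n: "2 \<le> norm x" by (rule far[OF x])
  have "norm (exp (- \<mu> * of_real s)) \<le> exp s" using \<mu> s by (auto simp: norm_exp_eq_Re)
  then have "norm (exp (- \<mu> * of_real s) * F ?y) \<le> exp s * (m * recessive_weight ?y * exp (- Re ?y))"
    unfolding norm_mult by (intro mult_mono F y) auto
  also have "\<dots> = m * exp (- Re x) * recessive_weight ?y"
  proof -
    have E: "exp s * exp (- Re ?y) = exp (- Re x)" by (simp flip: exp_add)
    have "exp s * (m * recessive_weight ?y * exp (- Re ?y)) = m * recessive_weight ?y * (exp s * exp (- Re ?y))"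
      by (simp only: mult_ac)
    then show ?thesis unfolding E by (simp only: mult_ac)
  qed
  also have "\<dots> \<le> m * exp (- Re x) * (4 / (norm x + s)\<^sup>2 + 2 * exp 2 / norm x * exp (- 2 * s))"
    by (rule mult_left_mono[OF recessive_weight_shift[OF x s]]) (use m in auto)
  finally show 1: "norm (exp (- \<mu> * of_real s) * F ?y)
      \<le> m * exp (- Re x) * (4 / (norm x + s)\<^sup>2 + 2 * exp 2 / norm x * exp (- 2 * s))" .
  also have "\<dots> \<le> m * exp 1 * (4 / (2 + s)\<^sup>2 + 2 * exp 2 / 2 * exp (- 2 * s))"
  proof (intro mult_mono add_mono)
    show "4 / (norm x + s)\<^sup>2 \<le> 4 / (2 + s)\<^sup>2"
      using n s by (intro divide_left_mono power_mono mult_pos_pos zero_less_power) auto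
    show "2 * exp 2 / norm x \<le> 2 * exp 2 / 2"
      using n by (intro divide_left_mono) auto
    show "exp (- Re x) \<le> exp 1" using re[OF x] by simp
  qed (use m n s in auto)
  finally show "norm (exp (- \<mu> * of_real s) * F ?y)
      \<le> m * exp 1 * (4 / (2 + s)\<^sup>2 + 2 * exp 2 / 2 * exp (- 2 * s))" .
qed

lemma recessive_laplace_deriv:
  assumes F: "F \<in> weighted_ball A m (\<lambda>x. recessive_weight x * exp (- Re x))" and m: "0 \<le> m"
    and x: "x \<in> A"
  shows "(laplace_ray \<mu> 1 F has_field_derivative \<mu> / 1 * laplace_ray \<mu> 1 F x - F x) (at x)"
proof -
  note wF = weighted_ballD[OF F, unfolded mult.assoc[symmetric]]
  show ?thesis
  by (rule laplace_ray_deriv[OF A norm_one shift wF(1) recessive_integrand_bound(2)[OF wF(2) m]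
        recessive_majorant_deriv recessive_majorant_lim x]) auto
qed

lemma recessive_laplace_bound:
  assumes F: "F \<in> weighted_ball A m (\<lambda>x. recessive_weight x * exp (- Re x))" and m: "0 \<le> m"
    and x: "x \<in> A"
  shows "norm (laplace_ray \<mu> 1 F x) \<le> m * (4 + exp 2) / norm x * exp (- Re x)"
proof -
  note wF = weighted_ballD[OF F, unfolded mult.assoc[symmetric]]
  have n: "0 < norm x" using far[OF x] by linarith
  have "norm (laplace_ray \<mu> 1 F x) \<le> m * exp (- Re x) * (4 / (norm x + 0) + exp 2 / norm x * exp (- 2 * 0))"
    by (rule laplace_ray_lim(3)[OF A norm_one shift wF(1) x recessive_integrand_bound(1)[OF wF(2) m x]
          recessive_majorant_deriv[OF n] recessive_majorant_lim(1)[OF n]])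
  then show ?thesis by (simp add: add_divide_distrib algebra_simps)
qed

lemma recessive_laplace_diff:
  assumes F: "F \<in> weighted_ball A m (\<lambda>x. recessive_weight x * exp (- Re x))"
    and G: "G \<in> weighted_ball A m (\<lambda>x. recessive_weight x * exp (- Re x))" and m: "0 \<le> m"
    and FG: "\<And>x. x \<in> A \<Longrightarrow> norm (F x - G x) \<le> c * recessive_weight x * exp (- Re x)" and c: "0 \<le> c"
    and x: "x \<in> A"
  shows "norm (laplace_ray \<mu> 1 F x - laplace_ray \<mu> 1 G x) \<le> c * (4 + exp 2) / norm x * exp (- Re x)"
proof -
  note wG = weighted_ballD[OF G, unfolded mult.assoc[symmetric]]
  note wF = weighted_ballD[OF F, unfolded mult.assoc[symmetric]]
  have n: "0 < norm x" using far[OF x] by linarith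
  have "norm (laplace_ray \<mu> 1 F x - laplace_ray \<mu> 1 G x)
      \<le> c * exp (- Re x) * (4 / (norm x + 0) + exp 2 / norm x * exp (- 2 * 0))"
    by (rule laplace_ray_diff[OF A norm_one shift wF(1) wG(1) x
          recessive_integrand_bound(1)[OF wF(2) m x] recessive_majorant_deriv[OF n] recessive_majorant_lim(1)[OF n]
          recessive_integrand_bound(1)[OF wG(2) m x] recessive_majorant_deriv[OF n] recessive_majorant_lim(1)[OF n]
          recessive_integrand_bound(1)[of "\<lambda>y. F y - G y", OF FG c x]
          recessive_majorant_deriv[OF n] recessive_majorant_lim(1)[OF n]])
  then show ?thesis by (simp add: add_divide_distrib algebra_simps)
qed

end

context forced_pendulum
begin

text \<open>
  A member of the one-parameter family of solutions that differ from \<open>u\<close> by a multiple of the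
  decaying exponential, with \<open>\<eta>\<close> the gauged difference.
\<close>
definition recessive_perturbation ::
    "complex set \<Rightarrow> (complex \<Rightarrow> complex) \<Rightarrow> complex \<Rightarrow> real \<Rightarrow> (complex \<Rightarrow> complex) \<Rightarrow> bool" where
  "recessive_perturbation A u C B \<eta> \<longleftrightarrow> \<eta> holomorphic_on A \<and>
     (\<forall>x\<in>A. solves (\<lambda>y. u y + \<eta> y / csqrt y) x \<and> norm (u x + \<eta> x / csqrt x) \<le> 1/2 \<and>
        norm (\<eta> x - C * exp (- x)) \<le> B / norm x * exp (- Re x) \<and>
        norm (deriv \<eta> x + C * exp (- x)) \<le> B / norm x * exp (- Re x))"

lemma recessive_perturbationD:
  assumes "recessive_perturbation A u C B \<eta>"
  shows "\<eta> holomorphic_on A" "x \<in> A \<Longrightarrow> solves (\<lambda>y. u y + \<eta> y / csqrt y) x"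
    "x \<in> A \<Longrightarrow> norm (u x + \<eta> x / csqrt x) \<le> 1/2"
    "x \<in> A \<Longrightarrow> norm (\<eta> x - C * exp (- x)) \<le> B / norm x * exp (- Re x)"
    "x \<in> A \<Longrightarrow> norm (deriv \<eta> x + C * exp (- x)) \<le> B / norm x * exp (- Re x)"
  using assms by (auto simp: recessive_perturbation_def)

text \<open>
  The integral equation that prescribes the coefficient \<open>C\<close> of \<open>exp (- x)\<close> and integrates the
  nonlinear terms from the right is solved by contraction in the weight \<open>exp (- Re x)\<close>. On horizontal
  rays this works up to, and slightly beyond, the imaginary axis, although the exponential does not
  decay there.
\<close>
lemma recessive_family_aux:
  fixes C :: complex and M M1 k0 \<rho> :: real
  assumes M: "0 \<le> M" and M1: "M1 = 2 * (norm C + 1)"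
    and k0: "k0 = K * (2 * (2 * M + 1)\<^sup>2 + 8 * M1\<^sup>2) + 1"
    and \<rho>: "2 \<le> \<rho>" "4 * M \<le> \<rho>" "(4 * M1 * exp 1)\<^sup>2 \<le> \<rho>" "2 * k0 * (4 + exp 2) \<le> \<rho>"
    and A: "open A" "convex A" and shift: "\<And>x s. x \<in> A \<Longrightarrow> 0 \<le> s \<Longrightarrow> x + of_real s \<in> A"
    and re: "\<And>x. x \<in> A \<Longrightarrow> - 1 < Re x" and far: "\<And>x. x \<in> A \<Longrightarrow> \<rho> \<le> norm x"
    and du: "decaying_solution A M u"
  obtains \<eta> where "recessive_perturbation A u C (k0 * M1 * (4 + exp 2)) \<eta>"
proof -
  note u = decaying_solutionD(1,2,4)[OF du]
  define k1 :: real where "k1 = 4 + exp 2"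
  have k1: "0 < k1" by (simp add: k1_def add_pos_pos)
  have M1': "2 \<le> M1" using M1 by simp
  have k0': "1 \<le> k0" using K by (simp add: k0)
  have shift1: "x + of_real s * 1 \<in> A" if "x \<in> A" "0 \<le> s" for x s using shift[OF that] by simp
  have far2: "2 \<le> norm x" if "x \<in> A" for x using far[OF that] \<rho>(1) by linarith
  have x0: "0 < norm x" if "x \<in> A" for x using far2[OF that] by linarith
  have x1: "1 \<le> norm x" if "x \<in> A" for x using far2[OF that] by linarith
  have slit: "x \<notin> \<real>\<^sub>\<le>\<^sub>0" if "x \<in> A" for x
  proof
    assume "x \<in> \<real>\<^sub>\<le>\<^sub>0"
    then have "norm x = - Re x" by (auto simp: complex_nonpos_Reals_iff cmod_eq_Re)
    with re[OF that] far2[OF that] show False by linarith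
  qed
  have s0: "csqrt x \<noteq> 0" if "x \<in> A" for x using slit[OF that] by auto
  note rl = A shift1 re far2
  (* The equation for the gauged difference is eta'' = eta + G x eta. *)
  define G where "G x a = csqrt x * (N x (u x + a / csqrt x) - N x (u x) - a / csqrt x) - a / (4 * x\<^sup>2)" for x a
  have u4: "norm (u x) \<le> 1/4" if x: "x \<in> A" for x
  proof -
    have "4 * M \<le> norm x" using \<rho>(2) far[OF x] by linarith
    then have "M / norm x \<le> 1/4" using x0[OF x] by (simp add: divide_simps)
    then show ?thesis using u(2)[OF x] by linarith
  qed
  have a4: "norm (a / csqrt x) \<le> 1/4" if x: "x \<in> A" and a: "norm a \<le> M1 * exp (- Re x)" for x a
  proof -
    have "exp (- Re x) \<le> exp 1" using re[OF x] by simp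
    then have "M1 * exp (- Re x) \<le> M1 * exp 1" using M1' by (intro mult_left_mono) auto
    then have 1: "norm a \<le> M1 * exp 1" using a by linarith
    have "(4 * M1 * exp 1)\<^sup>2 \<le> (norm (csqrt x))\<^sup>2"
      using \<rho>(3) far[OF x] unfolding csqrt_norm_sq by linarith
    then have "4 * M1 * exp 1 \<le> norm (csqrt x)" by (rule power2_le_imp_le) simp
    with 1 have "4 * norm a \<le> norm (csqrt x)" by linarith
    then show ?thesis using s0[OF x] by (simp add: norm_divide divide_simps)
  qed
  have ua: "norm (u x + a / csqrt x) \<le> 1/2" if x: "x \<in> A" and a: "norm a \<le> M1 * exp (- Re x)" for x a
    using norm_triangle_ineq[of "u x" "a / csqrt x"] u4[OF x] a4[OF x a] by linarith
  have lip: "norm (G x a - G x b) \<le> k0 * recessive_weight x * norm (a - b)"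
    if x: "x \<in> A" and a: "norm a \<le> M1 * exp (- Re x)" and b: "norm b \<le> M1 * exp (- Re x)" for x a b
  proof -
    define n where "n = norm x"
    have n: "0 < n" using x0[OF x] by (simp add: n_def)
    define s where "s = norm (csqrt x)"
    have s: "0 < s" "s\<^sup>2 = n" using s0[OF x] csqrt_norm_sq[of x] by (simp_all add: s_def n_def)
    define P where "P = (2 * M + 1) / n"
    define Q where "Q = 2 * M1 * exp (- Re x) / s"
    have part: "norm (u x + c / csqrt x) \<le> M / n + M1 * exp (- Re x) / s" if "norm c \<le> M1 * exp (- Re x)" for c
    proof -
      have "norm (c / csqrt x) \<le> M1 * exp (- Re x) / s"
        using that s(1) by (simp add: norm_divide s_def divide_right_mono)
      then show ?thesis using norm_triangle_ineq[of "u x" "c / csqrt x"] u(2)[OF x] by (simp add: n_def)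
    qed
    have sum: "norm (u x + a / csqrt x) + norm (u x + b / csqrt x) + 1 / n \<le> P + Q"
      using part[OF a] part[OF b] by (simp add: P_def Q_def add_divide_distrib)
    have "0 \<le> (P - Q)\<^sup>2" by simp
    then have "(P + Q)\<^sup>2 \<le> 2 * P\<^sup>2 + 2 * Q\<^sup>2" by (simp add: power2_sum power2_diff)
    also have "\<dots> = 2 * (2 * M + 1)\<^sup>2 * (1 / n\<^sup>2) + 8 * M1\<^sup>2 * (exp (- 2 * Re x) / n)"
    proof -
      have E: "(exp (- Re x))\<^sup>2 = exp (- 2 * Re x)" by (simp add: power2_eq_square flip: exp_add)
      show ?thesis
        unfolding P_def Q_def power_divide power_mult_distrib E s(2) by simp
    qed
    also have "\<dots> \<le> (2 * (2 * M + 1)\<^sup>2 + 8 * M1\<^sup>2) * (1 / n\<^sup>2) + (2 * (2 * M + 1)\<^sup>2 + 8 * M1\<^sup>2) * (exp (- 2 * Re x) / n)"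
      using n by (intro add_mono mult_right_mono) auto
    also have "\<dots> = (2 * (2 * M + 1)\<^sup>2 + 8 * M1\<^sup>2) * recessive_weight x"
      by (simp add: recessive_weight_def n_def distrib_left)
    finally have PQ: "(P + Q)\<^sup>2 \<le> (2 * (2 * M + 1)\<^sup>2 + 8 * M1\<^sup>2) * recessive_weight x" .
    have sq: "K * (norm (u x + a / csqrt x) + norm (u x + b / csqrt x) + 1 / n)\<^sup>2
        \<le> K * ((2 * (2 * M + 1)\<^sup>2 + 8 * M1\<^sup>2) * recessive_weight x)"
    proof (rule mult_left_mono)
      have "(norm (u x + a / csqrt x) + norm (u x + b / csqrt x) + 1 / n)\<^sup>2 \<le> (P + Q)\<^sup>2"
        using sum n by (intro power_mono) auto
      with PQ show "(norm (u x + a / csqrt x) + norm (u x + b / csqrt x) + 1 / n)\<^sup>2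
        \<le> (2 * (2 * M + 1)\<^sup>2 + 8 * M1\<^sup>2) * recessive_weight x" by linarith
    qed (use K in auto)
    define D where "D = N x (u x + a / csqrt x) - N x (u x + b / csqrt x) - ((u x + a / csqrt x) - (u x + b / csqrt x))"
    have eq: "G x a - G x b = csqrt x * D - (a - b) / (4 * x\<^sup>2)"
      by (simp add: G_def D_def algebra_simps diff_divide_distrib)
    have "norm D \<le> K * (norm (u x + a / csqrt x) + norm (u x + b / csqrt x) + 1 / norm x)\<^sup>2
        * norm ((u x + a / csqrt x) - (u x + b / csqrt x))"
      unfolding D_def by (rule N_lip[OF x1[OF x] ua[OF x a] ua[OF x b]])
    also have "norm ((u x + a / csqrt x) - (u x + b / csqrt x)) = norm (a - b) / s"
      by (simp add: s_def norm_divide flip: diff_divide_distrib)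
    finally have "s * norm D \<le> s * (K * (norm (u x + a / csqrt x) + norm (u x + b / csqrt x) + 1 / n)\<^sup>2 * (norm (a - b) / s))"
      using s by (intro mult_left_mono) (auto simp: n_def)
    also have "\<dots> = K * (norm (u x + a / csqrt x) + norm (u x + b / csqrt x) + 1 / n)\<^sup>2 * norm (a - b)"
      using s by simp
    also have "\<dots> \<le> K * ((2 * (2 * M + 1)\<^sup>2 + 8 * M1\<^sup>2) * recessive_weight x) * norm (a - b)"
      by (rule mult_right_mono[OF sq]) auto
    finally have 1: "norm (csqrt x * D) \<le> K * ((2 * (2 * M + 1)\<^sup>2 + 8 * M1\<^sup>2) * recessive_weight x) * norm (a - b)"
      by (simp add: norm_mult s_def)
    have "norm ((a - b) / (4 * x\<^sup>2)) \<le> 1 / n\<^sup>2 * norm (a - b)"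
    proof -
      have "norm (a - b) / (4 * n\<^sup>2) \<le> norm (a - b) / n\<^sup>2" using n by (intro frac_le) auto
      then show ?thesis by (simp add: norm_divide norm_mult norm_power n_def)
    qed
    also have "\<dots> \<le> recessive_weight x * norm (a - b)"
      using n by (intro mult_right_mono) (auto simp: recessive_weight_def n_def)
    finally have 2: "norm ((a - b) / (4 * x\<^sup>2)) \<le> recessive_weight x * norm (a - b)" .
    have "norm (G x a - G x b) \<le> norm (csqrt x * D) + norm ((a - b) / (4 * x\<^sup>2))"
      unfolding eq by (rule norm_triangle_ineq4)
    also have "\<dots> \<le> K * ((2 * (2 * M + 1)\<^sup>2 + 8 * M1\<^sup>2) * recessive_weight x) * norm (a - b) + recessive_weight x * norm (a - b)"
      by (rule add_mono[OF 1 2])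
    also have "\<dots> = k0 * recessive_weight x * norm (a - b)"
      unfolding k0 by (simp add: distrib_right mult.assoc)
    finally show ?thesis .
  qed
  have rw0: "0 \<le> recessive_weight x" for x by (simp add: recessive_weight_def)
  have G0: "G x 0 = 0" for x by (simp add: G_def)
  define GG where "GG \<eta> x = G x (\<eta> x)" for \<eta> x
  define Jp where "Jp \<eta> = laplace_ray 1 1 (GG \<eta>)" for \<eta>
  define Jm where "Jm \<eta> = laplace_ray (- 1) 1 (GG \<eta>)" for \<eta>
  define T where "T \<eta> x = C * exp (- x) + (Jm \<eta> x - Jp \<eta> x) / 2" for \<eta> x
  define T' where "T' \<eta> x = - C * exp (- x) - (Jm \<eta> x + Jp \<eta> x) / 2" for \<eta> x
  define S where "S = weighted_ball A M1 (\<lambda>x. exp (- Re x))"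
  have GGh: "GG \<eta> holomorphic_on A" if \<eta>: "\<eta> \<in> S" for \<eta>
  proof -
    note \<eta> = weighted_ballD[OF \<eta>[unfolded S_def]]
    have c: "csqrt holomorphic_on A" by (intro holomorphic_intros) (use slit in auto)
    have ue: "(\<lambda>x. u x + \<eta> x / csqrt x) holomorphic_on A"
      by (intro holomorphic_intros u(1) \<eta>(1) c s0)
    have N1: "(\<lambda>x. N x (u x + \<eta> x / csqrt x)) holomorphic_on A"
      by (rule N_holomorphic[OF A(1) x1 ue ua[OF _ \<eta>(2)]])
    have N2: "(\<lambda>x. N x (u x)) holomorphic_on A"
      by (rule N_holomorphic[OF A(1) x1 u(1)]) (use u4 in \<open>force\<close>)+
    show ?thesis
      unfolding GG_def[abs_def] G_def
      by (intro holomorphic_intros c N1 N2 \<eta>(1) s0) (use x0 in auto)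
  qed
  have GGd: "norm (GG \<eta> x - GG \<theta> x) \<le> k0 * c * recessive_weight x * exp (- Re x)"
    if \<eta>: "\<eta> \<in> S" and \<theta>: "\<theta> \<in> S" and le: "\<And>x. x \<in> A \<Longrightarrow> norm (\<eta> x - \<theta> x) \<le> c * exp (- Re x)" and x: "x \<in> A" for \<eta> \<theta> c x
  proof -
    have "norm (GG \<eta> x - GG \<theta> x) \<le> k0 * recessive_weight x * norm (\<eta> x - \<theta> x)"
      unfolding GG_def
      by (rule lip[OF x weighted_ballD(2)[OF \<eta>[unfolded S_def] x] weighted_ballD(2)[OF \<theta>[unfolded S_def] x]])
    also have "\<dots> \<le> k0 * recessive_weight x * (c * exp (- Re x))"
      using le[OF x] k0' rw0[of x] by (intro mult_left_mono) auto
    finally show ?thesis by (simp add: mult_ac)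
  qed
  have S0: "(\<lambda>_. 0) \<in> S" using M1' by (auto simp: S_def weighted_ball_def)
  have GG: "GG \<eta> \<in> weighted_ball A (k0 * M1) (\<lambda>x. recessive_weight x * exp (- Re x))" if \<eta>: "\<eta> \<in> S" for \<eta>
    using GGh[OF \<eta>] GGd[OF \<eta> S0, of M1] weighted_ballD(2)[OF \<eta>[unfolded S_def]]
    by (simp add: weighted_ball_def GG_def G0 mult.assoc)
  have kM: "0 \<le> k0 * M1" using k0' M1' by simp
  note plus = rl disjI1[OF refl] and minus = rl disjI2[OF refl]
  have Jd: "(Jp \<eta> has_field_derivative Jp \<eta> x - GG \<eta> x) (at x)"
    "(Jm \<eta> has_field_derivative - Jm \<eta> x - GG \<eta> x) (at x)"
    "norm (Jp \<eta> x) \<le> k0 * M1 * k1 / norm x * exp (- Re x)"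
    "norm (Jm \<eta> x) \<le> k0 * M1 * k1 / norm x * exp (- Re x)" if \<eta>: "\<eta> \<in> S" and x: "x \<in> A" for \<eta> x
    using recessive_laplace_deriv[OF plus GG[OF \<eta>] kM x] recessive_laplace_deriv[OF minus GG[OF \<eta>] kM x]
      recessive_laplace_bound[OF plus GG[OF \<eta>] kM x] recessive_laplace_bound[OF minus GG[OF \<eta>] kM x]
    by (simp_all add: Jp_def Jm_def k1_def)
  have Tb: "norm (T \<eta> x - C * exp (- x)) \<le> k0 * M1 * k1 / norm x * exp (- Re x)"
    "norm (T' \<eta> x + C * exp (- x)) \<le> k0 * M1 * k1 / norm x * exp (- Re x)" if \<eta>: "\<eta> \<in> S" and x: "x \<in> A" for \<eta> x
  proof -
    note J = Jd(4,3)[OF \<eta> x]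
    have eq: "T \<eta> x - C * exp (- x) = (Jm \<eta> x - Jp \<eta> x) / 2" "T' \<eta> x + C * exp (- x) = - ((Jm \<eta> x + Jp \<eta> x) / 2)"
      by (simp_all add: T_def T'_def)
    show "norm (T \<eta> x - C * exp (- x)) \<le> k0 * M1 * k1 / norm x * exp (- Re x)"
      unfolding eq by (rule half_sum_norm_le(1)[OF J])
    show "norm (T' \<eta> x + C * exp (- x)) \<le> k0 * M1 * k1 / norm x * exp (- Re x)"
      unfolding eq norm_minus_cancel by (rule half_sum_norm_le(2)[OF J])
  qed
  have expd: "((\<lambda>x. exp (- x)) has_field_derivative - exp (- x)) (at x)" for x :: complex
    by (auto intro!: derivative_eq_intros)
  have Td: "(T \<eta> has_field_derivative T' \<eta> x) (at x)" "(T' \<eta> has_field_derivative T \<eta> x + GG \<eta> x) (at x)"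
    if \<eta>: "\<eta> \<in> S" and x: "x \<in> A" for \<eta> x
  proof -
    note D = Jd(2,1)[OF \<eta> x]
    have eq: "C * - exp (- x) + ((- Jm \<eta> x - GG \<eta> x) - (Jp \<eta> x - GG \<eta> x)) / 2 = T' \<eta> x"
      by (simp add: T'_def field_simps)
    show "(T \<eta> has_field_derivative T' \<eta> x) (at x)"
      unfolding T_def[abs_def] eq[symmetric]
      by (rule DERIV_add[OF DERIV_cmult[OF expd[of x], of C] DERIV_cdivide[OF DERIV_diff[OF D], of 2]])
    show "(T' \<eta> has_field_derivative T \<eta> x + GG \<eta> x) (at x)"
      using DERIV_diff[OF DERIV_cmult[OF expd[of x], of "- C"] DERIV_cdivide[OF DERIV_add[OF D], of 2]]
      by (simp add: T_def T'_def[abs_def] field_simps)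
  qed
  obtain \<eta> where \<eta>: "\<eta> \<in> S" "\<And>x. x \<in> A \<Longrightarrow> T \<eta> x = \<eta> x"
  proof (rule holomorphic_contraction_fixpoint[OF A(1), of "\<lambda>x. exp (- Re x)" "exp 1" M1 T, folded S_def])
    show "exp (- Re x) \<le> exp 1" if "x \<in> A" for x using re[OF that] by simp
    show "0 \<le> M1" using M1' by simp
    show "T \<eta> holomorphic_on A" if "\<eta> \<in> S" for \<eta>
      using Td(1)[OF that] by (auto simp: holomorphic_on_open[OF A(1)])
    show "norm (T (\<lambda>_. 0) x) \<le> M1 / 2 * exp (- Re x)" for x
      by (simp add: T_def Jp_def Jm_def laplace_ray_def GG_def G0 norm_mult norm_exp_eq_Re M1)
    show "norm (T \<eta> x - T \<theta> x) \<le> c / 2 * exp (- Re x)"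
      if \<eta>: "\<eta> \<in> S" and \<theta>: "\<theta> \<in> S" and c: "0 \<le> c"
        and le: "\<And>x. x \<in> A \<Longrightarrow> norm (\<eta> x - \<theta> x) \<le> c * exp (- Re x)" and x: "x \<in> A" for \<eta> \<theta> c x
    proof -
      have kc: "0 \<le> k0 * c" using k0' c by simp
      note d = GGd[OF \<eta> \<theta> le]
      have J: "norm (Jm \<eta> x - Jm \<theta> x) \<le> k0 * c * k1 / norm x * exp (- Re x)"
        "norm (Jp \<eta> x - Jp \<theta> x) \<le> k0 * c * k1 / norm x * exp (- Re x)"
        using recessive_laplace_diff[OF minus GG[OF \<eta>] GG[OF \<theta>] kM d kc x]
          recessive_laplace_diff[OF plus GG[OF \<eta>] GG[OF \<theta>] kM d kc x]
        by (simp_all add: Jp_def Jm_def k1_def)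
      have eq: "T \<eta> x - T \<theta> x = ((Jm \<eta> x - Jm \<theta> x) - (Jp \<eta> x - Jp \<theta> x)) / 2"
        by (simp add: T_def field_simps)
      have "norm (T \<eta> x - T \<theta> x) \<le> k0 * c * k1 / norm x * exp (- Re x)"
        unfolding eq by (rule half_sum_norm_le(1)[OF J])
      also have "\<dots> \<le> c / 2 * exp (- Re x)"
      proof (rule mult_right_mono)
        have "c * (2 * k0 * k1) \<le> c * norm x"
          using \<rho>(4) far[OF x] c by (intro mult_left_mono) (auto simp: k1_def)
        then show "k0 * c * k1 / norm x \<le> c / 2" using x0[OF x] by (simp add: divide_simps mult_ac)
      qed auto
      finally show ?thesis .
    qed
  qed auto
  show thesis
  proof (rule that[of "T \<eta>"], unfold recessive_perturbation_def, intro conjI ballI)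
    have Tf1: "(T \<eta> has_field_derivative T' \<eta> x) (at x)" if "x \<in> A" for x
      by (rule Td(1)[OF \<eta>(1) that])
    have Tf2: "(T' \<eta> has_field_derivative T \<eta> x + GG \<eta> x) (at x)" if "x \<in> A" for x
      by (rule Td(2)[OF \<eta>(1) that])
    show "T \<eta> holomorphic_on A"
      using Tf1 by (auto simp: holomorphic_on_open[OF A(1)])
    fix x assume x: "x \<in> A"
    have dT: "deriv (T \<eta>) y = T' \<eta> y" if "y \<in> A" for y by (rule DERIV_imp_deriv[OF Tf1[OF that]])
    show "norm (T \<eta> x - C * exp (- x)) \<le> k0 * M1 * (4 + exp 2) / norm x * exp (- Re x)"
      "norm (deriv (T \<eta>) x + C * exp (- x)) \<le> k0 * M1 * (4 + exp 2) / norm x * exp (- Re x)"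
      using Tb[OF \<eta>(1) x] by (simp_all add: dT[OF x] k1_def)
    show "norm (u x + T \<eta> x / csqrt x) \<le> 1/2"
      by (rule ua[OF x]) (use \<eta>(2)[OF x] weighted_ballD(2)[OF \<eta>(1)[unfolded S_def] x] in simp)
    define f where "f y = T \<eta> y / csqrt y" for y
    have fan: "f analytic_on {x}"
    proof -
      have "f holomorphic_on A"
        unfolding f_def[abs_def]
        by (intro holomorphic_intros \<open>T \<eta> holomorphic_on A\<close> s0) (use slit in auto)
      then show ?thesis using A(1) x by (auto simp: analytic_at)
    qed
    have "deriv (deriv (\<lambda>y. csqrt y * f y)) x = deriv (deriv (T \<eta>)) x"
    proof (intro deriv_cong_ev refl)
      have "deriv (\<lambda>y. csqrt y * f y) z = deriv (T \<eta>) z" if "z \<in> A" for z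
        using A(1) that s0 by (intro deriv_cong_ev refl) (auto simp: eventually_nhds f_def)
      then show "\<forall>\<^sub>F z in nhds x. deriv (\<lambda>y. csqrt y * f y) z = deriv (T \<eta>) z"
        using A(1) x by (auto simp: eventually_nhds)
    qed
    also have "\<dots> = deriv (T' \<eta>) x"
      using A(1) x dT by (intro deriv_cong_ev) (auto simp: eventually_nhds)
    also have "\<dots> = T \<eta> x + GG \<eta> x" by (rule DERIV_imp_deriv[OF Tf2[OF x]])
    also have "GG \<eta> x = G x (T \<eta> x)" by (simp add: GG_def \<eta>(2)[OF x])
    also have "T \<eta> x + G x (T \<eta> x) = csqrt x * (N x (u x + f x) - N x (u x)) - csqrt x * f x / (4 * x\<^sup>2)"
      using s0[OF x] by (simp add: G_def f_def right_diff_distrib)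
    finally have "csqrt x * (deriv (deriv f) x + deriv f x / x) = csqrt x * (N x (u x + f x) - N x (u x))"
      unfolding gauged_second_derivative(1)[OF fan slit[OF x]] by simp
    then have f2: "deriv (deriv f) x + deriv f x / x = N x (u x + f x) - N x (u x)"
      using s0[OF x] by simp
    have uan: "u analytic_on {x}" using u(1) A(1) x by (auto simp: analytic_at)
    have f_eq: "(\<lambda>y. u y + f y - u y) = f" by simp
    have "(\<lambda>y. u y + f y) analytic_on {x}" by (intro analytic_intros uan fan)
    note dd = second_derivative_diff[OF uan this, unfolded f_eq]
    have "deriv (deriv (\<lambda>y. u y + f y)) x + deriv (\<lambda>y. u y + f y) x / x
        = (deriv (deriv u) x + deriv u x / x) + (deriv (deriv f) x + deriv f x / x)"
      unfolding dd by (simp add: diff_divide_distrib)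
    also have "\<dots> = N x (u x + f x)"
      using u(3)[OF x] unfolding f2 solves_def by simp
    finally show "solves (\<lambda>y. u y + T \<eta> y / csqrt y) x"
      by (simp add: solves_def f_def)
  qed
qed

lemma recessive_family:
  fixes C :: complex and M :: real
  assumes M: "0 \<le> M"
  shows "\<exists>\<rho> B. 2 \<le> \<rho> \<and> (\<forall>A u. open A \<longrightarrow> convex A \<longrightarrow> (\<forall>x s. x \<in> A \<longrightarrow> 0 \<le> s \<longrightarrow> x + of_real s \<in> A) \<longrightarrow>
     (\<forall>x\<in>A. - 1 < Re x \<and> \<rho> \<le> norm x) \<longrightarrow> decaying_solution A M u \<longrightarrow>
     (\<exists>\<eta>. recessive_perturbation A u C B \<eta>))"
proof -
  define M1 where "M1 = 2 * (norm C + 1)"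
  define k0 where "k0 = K * (2 * (2 * M + 1)\<^sup>2 + 8 * M1\<^sup>2) + 1"
  define \<rho> :: real where "\<rho> = Max {2, 4 * M, (4 * M1 * exp 1)\<^sup>2, 2 * k0 * (4 + exp 2)}"
  have \<rho>: "2 \<le> \<rho>" "4 * M \<le> \<rho>" "(4 * M1 * exp 1)\<^sup>2 \<le> \<rho>" "2 * k0 * (4 + exp 2) \<le> \<rho>"
    unfolding \<rho>_def by (rule Max_ge; simp)+
  have main: "\<exists>\<eta>. recessive_perturbation A u C (k0 * M1 * (4 + exp 2)) \<eta>"
    if a: "open A" "convex A" "\<forall>x s. x \<in> A \<longrightarrow> 0 \<le> s \<longrightarrow> x + of_real s \<in> A"
      "\<forall>x\<in>A. - 1 < Re x \<and> \<rho> \<le> norm x" "decaying_solution A M u" for A u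
    by (rule recessive_family_aux[OF M M1_def k0_def \<rho> a(1,2) _ _ _ a(5)]) (use a in auto)
  show ?thesis
    by (rule exI[of _ \<rho>], rule exI[of _ "k0 * M1 * (4 + exp 2)"]) (intro conjI allI impI \<rho>(1), rule main; assumption)
qed

end

section \<open>The fifth Painleve equation as a forced pendulum\<close>

text \<open>
  The right hand side of the fifth Painleve equation for \<open>\<delta> = 2\<close> in the variable \<open>u\<close>.
\<close>
definition PV_forcing :: "complex \<Rightarrow> complex \<Rightarrow> complex \<Rightarrow> complex \<Rightarrow> complex \<Rightarrow> complex" where
  "PV_forcing \<alpha> \<beta> \<gamma> x u = sin u * cos u + \<gamma> * cos u / (2 * x)
     + 2 / x\<^sup>2 * (\<alpha> * (1 + sin u)\<^sup>2 + \<beta> * (1 - sin u)\<^sup>2) / cos u ^ 3"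

text \<open>
  The substitution is found by requiring that the term with \<open>w'\<^sup>2\<close> disappears, that is,
  \<open>PV_of'' / PV_of' = (1 / (2 w) + 1 / (w - 1)) PV_of'\<close> with \<open>w = PV_of u\<close>, and that
  \<open>PV_of 0 = - 1\<close>. In terms of \<open>sin u\<close> it is an involution, so that
  \<open>sin u = (w + 1) / (w - 1)\<close>.
\<close>
definition PV_of :: "complex \<Rightarrow> complex" where
  "PV_of u = (sin u + 1) / (sin u - 1)"

lemma cos_neq_0_small:
  fixes u :: complex
  assumes "norm u < 1" shows "cos u \<noteq> 0"
proof
  assume "cos u = 0"
  then obtain n :: int where n: "u = of_real (of_int n * pi) + of_real pi / 2"
    by (auto simp: cos_eq_0)
  then have "u = of_real ((2 * of_int n + 1) * (pi / 2))" by (simp add: algebra_simps)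
  then have "norm u = \<bar>(2 * of_int n + 1) * (pi / 2)\<bar>" by (simp only: norm_of_real)
  also have "\<dots> = \<bar>of_int (2 * n + 1)\<bar> * (pi / 2)" by (simp add: abs_mult)
  also have "\<dots> \<ge> 1 * (pi / 2)"
  proof (rule mult_right_mono)
    have "1 \<le> \<bar>2 * n + 1\<bar>" by presburger
    then show "1 \<le> \<bar>of_int (2 * n + 1) :: real\<bar>" by linarith
  qed auto
  finally show False using assms pi_gt3 by simp
qed

lemma sin_neq_small:
  fixes u :: complex
  assumes "norm u < 1" shows "sin u \<noteq> 1" "sin u \<noteq> -1"
  using cos_neq_0_small[OF assms] sin_cos_squared_add[of u] by (auto simp: power2_eq_square)

text \<open>
  The algebraic content of the substitution, with \<open>s\<close>, \<open>c\<close>, \<open>D\<close>, \<open>E\<close> standing for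
  \<open>sin u\<close>, \<open>cos u\<close>, \<open>u'\<close>, \<open>u''\<close>. The two equations differ by the factor
  \<open>- 2 c / (s - 1)\<^sup>2\<close>, the derivative of \<open>PV_of\<close>.
\<close>
lemma PV_algebra:
  fixes s c x D E \<alpha> \<beta> \<gamma> :: complex
  assumes cs: "c\<^sup>2 = 1 - s\<^sup>2" and nz: "c \<noteq> 0" "x \<noteq> 0" "s \<noteq> 1" "s \<noteq> -1"
  defines "w \<equiv> (s + 1) / (s - 1)" and "w1 \<equiv> - 2 * c / (s - 1)\<^sup>2 * D"
    and "w2 \<equiv> (2 * s / (s - 1)\<^sup>2 + 4 * c\<^sup>2 / (s - 1) ^ 3) * D\<^sup>2 - 2 * c / (s - 1)\<^sup>2 * E"
  shows "w2 - ((1 / (2 * w) + 1 / (w - 1)) * w1\<^sup>2 - w1 / x + (w - 1)\<^sup>2 / x\<^sup>2 * (\<alpha> * w + \<beta> / w)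
             + \<gamma> * w / x + 2 * w * (w + 1) / (w - 1))
     = - 2 * c / (s - 1)\<^sup>2 * (E + D / x - (s * c + \<gamma> * c / (2 * x)
             + 2 / x\<^sup>2 * (\<alpha> * (1 + s)\<^sup>2 + \<beta> * (1 - s)\<^sup>2) / c ^ 3))"
proof -
  define p where "p = s - 1"
  define q where "q = s + 1"
  have pq: "p \<noteq> 0" "q \<noteq> 0" using nz eq_neg_iff_add_eq_0[of s 1] by (auto simp: p_def q_def)
  have s: "s = p + 1" "q = p + 2" by (simp_all add: p_def q_def)
  have c2: "c\<^sup>2 = - (p * q)" using cs by (simp add: p_def q_def power2_eq_square algebra_simps)
  have c3: "c ^ 3 = - (p * q) * c" using c2 by (simp add: power3_eq_cube power2_eq_square)
  have w: "w = q / p" by (simp add: w_def p_def q_def)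
  have wm: "w - 1 = 2 / p" using pq by (simp add: w s divide_simps)
  have wp: "w + 1 = 2 * s / p" using pq by (simp add: w s divide_simps)
  have A1: "(1 / (2 * w) + 1 / (w - 1)) = p * (s + 2) / (2 * q)"
    unfolding wm using pq by (simp add: w divide_simps) (simp add: s algebra_simps)
  have w1s: "w1\<^sup>2 = - 4 * q / p ^ 3 * D\<^sup>2"
  proof -
    have "w1\<^sup>2 = 4 * c\<^sup>2 / p ^ 4 * D\<^sup>2"
      by (simp add: w1_def p_def[symmetric] power_mult_distrib power_divide flip: power_mult)
    also have "\<dots> = - 4 * q / p ^ 3 * D\<^sup>2"
      unfolding c2 using pq by (simp add: divide_simps power4_eq_xxxx power3_eq_cube)
    finally show ?thesis .
  qed
  have T1: "(1 / (2 * w) + 1 / (w - 1)) * w1\<^sup>2 = - 2 * (s + 2) / p\<^sup>2 * D\<^sup>2"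
    unfolding A1 w1s using pq by (simp add: divide_simps power2_eq_square power3_eq_cube) (simp add: algebra_simps)
  have T2: "(2 * s / p\<^sup>2 + 4 * c\<^sup>2 / p ^ 3) * D\<^sup>2 = - 2 * (s + 2) / p\<^sup>2 * D\<^sup>2"
    unfolding c2 using pq by (simp add: divide_simps power2_eq_square power3_eq_cube) (simp add: s algebra_simps)
  have T3: "(w - 1)\<^sup>2 / x\<^sup>2 * (\<alpha> * w + \<beta> / w)
     = - 2 * c / p\<^sup>2 * (2 / x\<^sup>2 * (\<alpha> * (1 + s)\<^sup>2 + \<beta> * (1 - s)\<^sup>2) / c ^ 3)"
  proof -
    have q: "1 + s = q" "1 - s = - p" by (simp_all add: p_def q_def)
    show ?thesis
      unfolding wm c3 q using pq nz by (simp add: w divide_simps power2_eq_square)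
  qed
  have T4: "\<gamma> * w / x = - 2 * c / p\<^sup>2 * (\<gamma> * c / (2 * x))"
  proof -
    have "- 2 * c / p\<^sup>2 * (\<gamma> * c / (2 * x)) = - \<gamma> * c\<^sup>2 / (p\<^sup>2 * x)"
      using pq nz by (simp add: divide_simps power2_eq_square)
    also have "\<dots> = \<gamma> * w / x" unfolding c2 using pq nz by (simp add: w divide_simps power2_eq_square)
    finally show ?thesis by simp
  qed
  have T5: "2 * w * (w + 1) / (w - 1) = - 2 * c / p\<^sup>2 * (s * c)"
  proof -
    have "- 2 * c / p\<^sup>2 * (s * c) = - 2 * s * c\<^sup>2 / p\<^sup>2"
      by (simp add: power2_eq_square)
    also have "\<dots> = 2 * w * (w + 1) / (w - 1)"
      unfolding c2 wm wp using pq by (simp add: w divide_simps power2_eq_square)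
    finally show ?thesis by simp
  qed
  have T6: "w1 / x = - 2 * c / p\<^sup>2 * (D / x)" by (simp add: w1_def p_def)
  have w2: "w2 = - 2 * (s + 2) / p\<^sup>2 * D\<^sup>2 + (- 2 * c / p\<^sup>2) * E"
    unfolding w2_def p_def[symmetric] T2 by simp
  show ?thesis
    unfolding w2 T1 T3 T4 T5 T6 p_def[symmetric] by (simp only: distrib_left right_diff_distrib) simp
qed

lemma PV_of_deriv:
  assumes "norm u < 1"
  shows "(PV_of has_field_derivative - 2 * cos u / (sin u - 1)\<^sup>2) (at u)"
    and "((\<lambda>u. - 2 * cos u / (sin u - 1)\<^sup>2) has_field_derivative
           2 * sin u / (sin u - 1)\<^sup>2 + 4 * (cos u)\<^sup>2 / (sin u - 1) ^ 3) (at u)"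
proof -
  have n: "sin u - 1 \<noteq> 0" using sin_neq_small[OF assms] by simp
  have "((\<lambda>u. (sin u + 1) / (sin u - 1)) has_field_derivative
      (cos u * (sin u - 1) - (sin u + 1) * cos u) / ((sin u - 1) * (sin u - 1))) (at u)"
    by (rule DERIV_divide) (auto intro!: derivative_eq_intros simp: sin_neq_small[OF assms])
  moreover have "cos u * (sin u - 1) - (sin u + 1) * cos u = - 2 * cos u" by (simp add: algebra_simps)
  ultimately show "(PV_of has_field_derivative - 2 * cos u / (sin u - 1)\<^sup>2) (at u)"
    unfolding PV_of_def[abs_def] by (simp only: power2_eq_square)
  have alg: "(2 * S * p\<^sup>2 - (- 2 * c) * (2 * p * c)) / (p\<^sup>2 * p\<^sup>2) = 2 * S / p\<^sup>2 + 4 * c\<^sup>2 / p ^ 3"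
    if "p \<noteq> 0" for S p c :: complex
    using that by (simp add: divide_simps power2_eq_square power3_eq_cube) (simp add: algebra_simps)
  have "((\<lambda>u. - 2 * cos u / (sin u - 1)\<^sup>2) has_field_derivative
      (2 * sin u * (sin u - 1)\<^sup>2 - (- 2 * cos u) * (2 * (sin u - 1) * cos u)) / ((sin u - 1)\<^sup>2 * (sin u - 1)\<^sup>2)) (at u)"
    by (rule DERIV_divide) (use n in \<open>auto intro!: derivative_eq_intros\<close>)
  then show "((\<lambda>u. - 2 * cos u / (sin u - 1)\<^sup>2) has_field_derivative
           2 * sin u / (sin u - 1)\<^sup>2 + 4 * (cos u)\<^sup>2 / (sin u - 1) ^ 3) (at u)"
    by (simp only: alg[OF n])
qed

lemma PV_of_eq_iff:
  assumes u: "u analytic_on {x}" "norm (u x) \<le> 1/2" and x: "x \<noteq> 0"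
    and w: "\<forall>\<^sub>F y in nhds x. w y = PV_of (u y)"
  shows "PV_eq \<alpha> \<beta> \<gamma> 2 w x \<longleftrightarrow> deriv (deriv u) x + deriv u x / x = PV_forcing \<alpha> \<beta> \<gamma> x (u x)"
proof -
  obtain U where U: "open U" "x \<in> U" "u holomorphic_on U"
    using u by (auto simp: analytic_at)
  have "isCont u x" using u(1) by (rule analytic_at_imp_isCont)
  then have "\<forall>\<^sub>F y in nhds x. norm (u y) < 1"
    using u(2) by (intro order_tendstoD(2)[of "\<lambda>y. norm (u y)" "norm (u x)"])
      (auto simp: isCont_def tendsto_at_iff_tendsto_nhds intro!: tendsto_norm)
  then obtain V where V: "open V" "x \<in> V" "\<And>y. y \<in> V \<Longrightarrow> norm (u y) < 1"
    by (auto simp: eventually_nhds)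
  define W where "W = U \<inter> V"
  have W: "open W" "x \<in> W" "u holomorphic_on W" "\<And>y. y \<in> W \<Longrightarrow> norm (u y) < 1"
    using U V by (auto simp: W_def intro: holomorphic_on_subset)
  have du: "(u has_field_derivative deriv u y) (at y)" "(deriv u has_field_derivative deriv (deriv u) y) (at y)"
    if "y \<in> W" for y
    using W that holomorphic_derivI holomorphic_deriv by blast+
  define g where "g z = - 2 * cos z / (sin z - 1)\<^sup>2" for z :: complex
  have d1: "deriv w y = g (u y) * deriv u y" if ev: "\<forall>\<^sub>F z in nhds y. w z = PV_of (u z)" and y: "y \<in> W" for y
  proof -
    have "deriv w y = deriv (\<lambda>z. PV_of (u z)) y" by (rule deriv_cong_ev[OF ev refl])
    also have "\<dots> = g (u y) * deriv u y"
      unfolding g_def by (rule DERIV_imp_deriv[OF DERIV_chain2[OF PV_of_deriv(1)[OF W(4)[OF y]] du(1)[OF y]]])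
    finally show ?thesis .
  qed
  have "\<forall>\<^sub>F y in nhds x. \<forall>\<^sub>F z in nhds y. w z = PV_of (u z)"
    using w by (subst eventually_eventually)
  moreover have "\<forall>\<^sub>F y in nhds x. y \<in> W" using W by (auto simp: eventually_nhds)
  ultimately have "\<forall>\<^sub>F y in nhds x. deriv w y = g (u y) * deriv u y"
    by eventually_elim (rule d1)
  then have "deriv (deriv w) x = deriv (\<lambda>y. g (u y) * deriv u y) x" by (intro deriv_cong_ev refl)
  also have "\<dots> = ((2 * sin (u x) / (sin (u x) - 1)\<^sup>2 + 4 * (cos (u x))\<^sup>2 / (sin (u x) - 1) ^ 3) * deriv u x) * deriv u x
      + deriv (deriv u) x * g (u x)"
    using DERIV_mult[OF DERIV_chain2[OF PV_of_deriv(2)[OF W(4)[OF W(2)], folded g_def] du(1)[OF W(2)]] du(2)[OF W(2)]]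
    by (rule DERIV_imp_deriv)
  finally have w2: "deriv (deriv w) x =
      (2 * sin (u x) / (sin (u x) - 1)\<^sup>2 + 4 * (cos (u x))\<^sup>2 / (sin (u x) - 1) ^ 3) * (deriv u x)\<^sup>2
      - 2 * cos (u x) / (sin (u x) - 1)\<^sup>2 * deriv (deriv u) x"
    by (simp add: g_def power2_eq_square)
  have w1: "deriv w x = - 2 * cos (u x) / (sin (u x) - 1)\<^sup>2 * deriv u x"
    using d1[OF w W(2)] by (simp add: g_def)
  have w0: "w x = (sin (u x) + 1) / (sin (u x) - 1)"
    using eventually_nhds_x_imp_x[OF w] by (simp add: PV_of_def)
  have small: "norm (u x) < 1" by (rule W(4)[OF W(2)])
  have c: "cos (u x) \<noteq> 0" by (rule cos_neq_0_small[OF small])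
  note sn = sin_neq_small[OF small]
  have "(cos (u x))\<^sup>2 = 1 - (sin (u x))\<^sup>2" by (simp add: cos_squared_eq)
  note alg = PV_algebra[OF this c x sn, of "deriv u x" "deriv (deriv u) x" \<alpha> \<beta> \<gamma>]
  have "PV_eq \<alpha> \<beta> \<gamma> 2 w x \<longleftrightarrow> - 2 * cos (u x) / (sin (u x) - 1)\<^sup>2 *
      (deriv (deriv u) x + deriv u x / x - PV_forcing \<alpha> \<beta> \<gamma> x (u x)) = 0"
    unfolding PV_eq_def w2 w1 w0 PV_forcing_def alg[symmetric] by (rule eq_iff_diff_eq_0)
  also have "\<dots> \<longleftrightarrow> deriv (deriv u) x + deriv u x / x - PV_forcing \<alpha> \<beta> \<gamma> x (u x) = 0"
    using c sn by simp
  finally show ?thesis by simp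
qed

text \<open>
  In \<open>u\<close>, the derivative of \<open>sin u cos u - u\<close> is \<open>- 2 sin\<^sup>2 u\<close>, that of the
  \<open>\<gamma>\<close>-term is \<open>O(u / x)\<close>, and that of the last term is \<open>O(x\<^sup>-\<^sup>2)\<close>; together this is
  quadratic in \<open>u\<close> and \<open>1 / x\<close>.
\<close>
lemma PV_forcing_forced_pendulum:
  obtains K where "forced_pendulum (PV_forcing \<alpha> \<beta> \<gamma>) K"
proof -
  define r where "r u = 2 * (\<alpha> * (1 + sin u)\<^sup>2 + \<beta> * (1 - sin u)\<^sup>2) / cos u ^ 3" for u :: complex
  have N: "PV_forcing \<alpha> \<beta> \<gamma> x u = sin u * cos u + \<gamma> * cos u / (2 * x) + r u / x\<^sup>2" for x u
    by (simp add: PV_forcing_def r_def)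
  have rh: "r holomorphic_on ball 0 1"
    unfolding r_def[abs_def] by (intro holomorphic_intros) (use cos_neq_0_small in auto)
  then have rh': "deriv r holomorphic_on ball 0 1" by (rule holomorphic_deriv) simp
  have sub: "cball 0 (1/2) \<subseteq> ball (0::complex) 1" by auto
  have "bounded (deriv r ` cball 0 (1/2))" "bounded (cos ` cball (0::complex) (1/2))"
    by (intro compact_imp_bounded compact_continuous_image holomorphic_on_imp_continuous_on
        holomorphic_on_subset[OF rh' sub] holomorphic_on_cos holomorphic_on_id compact_cball continuous_intros)+
  then obtain B S where B: "\<And>u. u \<in> cball 0 (1/2) \<Longrightarrow> norm (deriv r u) \<le> B"
    and S: "\<And>u. u \<in> cball (0::complex) (1/2) \<Longrightarrow> norm (cos u) \<le> S"
    unfolding bounded_iff by blast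
  have B0: "0 \<le> B" using order_trans[OF norm_ge_zero B[of 0]] by simp
  have S0: "1 \<le> S" using S[of 0] by simp
  have sinb: "norm (sin u) \<le> S * norm u" if "norm u \<le> 1/2" for u :: complex
  proof -
    have "norm (sin u - sin 0) \<le> S * norm (u - 0)"
      by (rule field_differentiable_bound[of "cball 0 (1/2)" sin cos])
        (use that S in \<open>auto intro: DERIV_sin has_field_derivative_at_within\<close>)
    then show ?thesis by simp
  qed
  define K where "K = 1 + 2 * S\<^sup>2 + norm \<gamma> * S + B + norm \<gamma> + norm (r 0)"
  show thesis
  proof (rule that[of K], unfold_locales)
    show "1 \<le> K" using S0 B0 by (simp add: K_def)
    show "norm (PV_forcing \<alpha> \<beta> \<gamma> x 0) \<le> K / norm x" if x: "1 \<le> norm x" for x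
    proof -
      have n: "0 < norm x" using x by linarith
      have "norm (\<gamma> / (2 * x)) \<le> norm \<gamma> / norm x"
        using n by (simp add: norm_divide norm_mult divide_simps mult_le_cancel_left1)
      moreover have "norm (r 0 / x\<^sup>2) \<le> norm (r 0) / norm x"
      proof -
        have "norm x * 1 \<le> norm x * norm x" using x by (intro mult_left_mono) auto
        then have "norm (r 0) / (norm x)\<^sup>2 \<le> norm (r 0) / norm x"
          using n by (intro divide_left_mono) (auto simp: power2_eq_square)
        then show ?thesis by (simp add: norm_divide norm_power)
      qed
      ultimately have "norm (PV_forcing \<alpha> \<beta> \<gamma> x 0) \<le> norm \<gamma> / norm x + norm (r 0) / norm x"
        unfolding N using norm_triangle_ineq[of "\<gamma> / (2 * x)" "r 0 / x\<^sup>2"] by simp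
      also have "\<dots> = (norm \<gamma> + norm (r 0)) / norm x" by (simp add: add_divide_distrib)
      also have "\<dots> \<le> K / norm x"
        using n S0 B0 by (intro divide_right_mono) (auto simp: K_def)
      finally show ?thesis .
    qed
    show "norm (PV_forcing \<alpha> \<beta> \<gamma> x a - PV_forcing \<alpha> \<beta> \<gamma> x b - (a - b))
        \<le> K * (norm a + norm b + 1 / norm x)\<^sup>2 * norm (a - b)"
      if x: "1 \<le> norm x" and ab: "norm a \<le> 1/2" "norm b \<le> 1/2" for x a b
    proof -
      have n: "0 < norm x" using x by linarith
      define \<rho> where "\<rho> = max (norm a) (norm b)"
      have \<rho>: "\<rho> \<le> 1/2" "0 \<le> \<rho>" "\<rho> \<le> norm a + norm b" using ab by (auto simp: \<rho>_def le_max_iff_disj)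
      define f where "f u = PV_forcing \<alpha> \<beta> \<gamma> x u - u" for u
      define f' where "f' u = - 2 * (sin u)\<^sup>2 - \<gamma> * sin u / (2 * x) + deriv r u / x\<^sup>2" for u
      have "norm (f a - f b) \<le> K * (norm a + norm b + 1 / norm x)\<^sup>2 * norm (a - b)"
      proof (rule field_differentiable_bound[of "cball 0 \<rho>" f f'])
        fix u assume u: "u \<in> cball (0::complex) \<rho>"
        then have u1: "norm u \<le> 1/2" "norm u \<le> \<rho>" using \<rho> by auto
        then have ub: "u \<in> ball 0 1" by auto
        have dr: "(r has_field_derivative deriv r u) (at u)"
          by (rule holomorphic_derivI[OF rh open_ball ub])
        have "(f has_field_derivative (cos u * cos u + - sin u * sin u) + \<gamma> * - sin u / (2 * x) + deriv r u / x\<^sup>2 - 1) (at u)"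
          unfolding f_def[abs_def] N
          by (intro DERIV_diff DERIV_add DERIV_cdivide DERIV_cmult dr DERIV_ident)
            (auto intro!: derivative_eq_intros)
        moreover have "cos u * cos u + - sin u * sin u + \<gamma> * - sin u / (2 * x) + deriv r u / x\<^sup>2 - 1 = f' u"
        proof -
          have c: "cos u * cos u + - sin u * sin u = 1 - 2 * (sin u)\<^sup>2"
            using sin_cos_squared_add[of u] by (simp add: power2_eq_square algebra_simps)
          show ?thesis unfolding c f'_def by simp
        qed
        ultimately have "(f has_field_derivative f' u) (at u)"
          by (simp only:)
        then show "(f has_field_derivative f' u) (at u within cball 0 \<rho>)"
          by (rule has_field_derivative_at_within)
        have su: "norm (sin u) \<le> S * \<rho>"
        proof -
          have "S * norm u \<le> S * \<rho>" using u1 S0 by (intro mult_left_mono) auto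
          then show ?thesis using sinb[OF u1(1)] by linarith
        qed
        define t where "t = 1 / norm x"
        have t: "0 < t" using n by (simp add: t_def)
        have 1: "norm (2 * (sin u)\<^sup>2) \<le> 2 * S\<^sup>2 * \<rho>\<^sup>2"
          using power_mono[OF su, of 2] by (simp add: norm_mult norm_power power_mult_distrib)
        have 2: "norm (\<gamma> * sin u / (2 * x)) \<le> norm \<gamma> * S * (2 * \<rho> * t)"
        proof -
          have "norm (\<gamma> * sin u / (2 * x)) = norm \<gamma> * norm (sin u) * t / 2"
            by (simp add: t_def norm_mult norm_divide)
          also have "\<dots> \<le> norm \<gamma> * (S * \<rho>) * t / 2"
            using su t by (intro divide_right_mono mult_right_mono mult_left_mono) auto
          also have "\<dots> \<le> norm \<gamma> * (S * \<rho>) * t * 2"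
            using S0 \<rho> t by (simp add: mult_nonneg_nonneg)
          finally show ?thesis by (simp add: mult_ac)
        qed
        have 3: "norm (deriv r u / x\<^sup>2) \<le> B * t\<^sup>2"
        proof -
          have "norm (deriv r u) \<le> B" using B u1 by simp
          then have "norm (deriv r u) * t\<^sup>2 \<le> B * t\<^sup>2" by (rule mult_right_mono) auto
          then show ?thesis by (simp add: t_def norm_divide norm_power power_divide)
        qed
        have "norm (f' u) \<le> norm (2 * (sin u)\<^sup>2) + norm (\<gamma> * sin u / (2 * x)) + norm (deriv r u / x\<^sup>2)"
        proof -
          have "f' u = - (2 * (sin u)\<^sup>2 + \<gamma> * sin u / (2 * x)) + deriv r u / x\<^sup>2" by (simp add: f'_def)
          then have "norm (f' u) \<le> norm (2 * (sin u)\<^sup>2 + \<gamma> * sin u / (2 * x)) + norm (deriv r u / x\<^sup>2)"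
            using norm_triangle_ineq[of "- (2 * (sin u)\<^sup>2 + \<gamma> * sin u / (2 * x))" "deriv r u / x\<^sup>2"]
            by (simp only: norm_minus_cancel)
          then show ?thesis using norm_triangle_ineq[of "2 * (sin u)\<^sup>2" "\<gamma> * sin u / (2 * x)"] by linarith
        qed
        also have "\<dots> \<le> 2 * S\<^sup>2 * \<rho>\<^sup>2 + norm \<gamma> * S * (2 * \<rho> * t) + B * t\<^sup>2"
          using 1 2 3 by linarith
        also have "\<dots> \<le> K * \<rho>\<^sup>2 + K * (2 * \<rho> * t) + K * t\<^sup>2"
        proof (intro add_mono mult_right_mono)
          show "2 * S\<^sup>2 \<le> K" "norm \<gamma> * S \<le> K" "B \<le> K" using S0 B0 by (auto simp: K_def)
        qed (use \<rho> t in auto)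
        also have "\<dots> = K * (\<rho> + t)\<^sup>2" by (simp add: power2_sum algebra_simps)
        also have "\<dots> \<le> K * (norm a + norm b + 1 / norm x)\<^sup>2"
        proof (intro mult_left_mono power_mono)
          show "0 \<le> K" using S0 B0 by (simp add: K_def)
        qed (use \<rho> t in \<open>auto simp: t_def\<close>)
        finally show "norm (f' u) \<le> K * (norm a + norm b + 1 / norm x)\<^sup>2" .
      qed (auto simp: \<rho>_def)
      moreover have "f a - f b = PV_forcing \<alpha> \<beta> \<gamma> x a - PV_forcing \<alpha> \<beta> \<gamma> x b - (a - b)"
        by (simp add: f_def)
      ultimately show ?thesis by simp
    qed
    show "(\<lambda>x. PV_forcing \<alpha> \<beta> \<gamma> x (f x)) holomorphic_on A"
      if "open A" and far: "\<And>x. x \<in> A \<Longrightarrow> 1 \<le> norm x" and f: "f holomorphic_on A"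
        and small: "\<And>x. x \<in> A \<Longrightarrow> norm (f x) \<le> 1/2" for A f
    proof -
      have "cos (f x) \<noteq> 0" if "x \<in> A" for x
        by (rule cos_neq_0_small) (use small[OF that] in linarith)
      moreover have "x \<noteq> 0" if "x \<in> A" for x using far[OF that] by auto
      ultimately show ?thesis
        unfolding PV_forcing_def by (intro holomorphic_intros f) auto
    qed
  qed
qed

section \<open>Identification of solutions with members of the family\<close>

text \<open>
  The normal vector halfway between the positive real axis and the half axis \<open>d\<close>. The half plane with
  this normal contains the ends of both of these half axes and is mapped to itself by shifts to the
  right, so it is where solutions are compared on the real axis and read off on the axis \<open>d\<close>.
\<close>
definition mid :: "complex \<Rightarrow> complex" where
  "mid d = (1 + d) / of_real (sqrt 2)"

lemma mid_inner:
  assumes "d = \<i> \<or> d = - \<i>"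
  shows "mid d \<bullet> x = (Re x + d \<bullet> x) / sqrt 2"
  using assms by (auto simp: mid_def inner_complex_def Re_divide_of_real Im_divide_of_real diff_divide_distrib add_divide_distrib)

lemma mid_norm:
  assumes "d = \<i> \<or> d = - \<i>" shows "norm (mid d) = 1"
proof -
  have "(norm (mid d))\<^sup>2 = 1"
    using assms by (auto simp: cmod_power2 mid_def Re_divide_of_real Im_divide_of_real power_divide)
  then show ?thesis by (simp add: power2_eq_1_iff) (use norm_ge_zero[of "mid d"] in linarith)
qed

lemma mid_pos:
  assumes "d = \<i> \<or> d = - \<i>" shows "0 < mid d \<bullet> 1" "0 < mid d \<bullet> d"
  unfolding mid_inner[OF assms] using assms by (auto simp: inner_complex_def)

lemma half_plane_contains_ray:
  assumes m: "norm m = 1" and y: "0 < m \<bullet> y"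
  obtains T where "0 < T" "\<And>t. T \<le> t \<Longrightarrow> cball (of_real t * y) 1 \<subseteq> half_plane m R"
proof -
  define T where "T = max 1 ((R + 2) / (m \<bullet> y))"
  show thesis
  proof (rule that[of T])
    show "0 < T" by (simp add: T_def)
    fix t assume t: "T \<le> t"
    show "cball (of_real t * y) 1 \<subseteq> half_plane m R"
    proof
      fix z assume "z \<in> cball (of_real t * y) 1"
      then have z: "norm (of_real t * y - z) \<le> 1" by (simp add: dist_norm)
      have "(R + 2) / (m \<bullet> y) \<le> t" using t by (simp add: T_def)
      then have 1: "R + 2 \<le> t * (m \<bullet> y)" using y by (simp add: divide_le_eq)
      have "m \<bullet> (of_real t * y - z) \<le> 1"
        using norm_cauchy_schwarz[of m "of_real t * y - z"] z m by simp
      moreover have "m \<bullet> (of_real t * y) = t * (m \<bullet> y)"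
        by (simp add: scaleR_conv_of_real[symmetric])
      ultimately have "R < m \<bullet> z" using 1 by (simp add: inner_diff_right)
      then show "z \<in> half_plane m R" by (simp add: half_plane_def)
    qed
  qed
qed

context forced_pendulum
begin

text \<open>
  Both half planes contain the end of the axis \<open>d\<close>, where decaying solutions are unique.
\<close>
lemma half_plane_solutions_agree:
  assumes d: "d = \<i> \<or> d = - \<i>"
    and m: "norm m = 1" "0 < m \<bullet> d" and m': "norm m' = 1" "0 < m' \<bullet> d"
    and u: "decaying_solution (half_plane m R) M u" and v: "decaying_solution (half_plane m' R') M' v"
    and x: "x \<in> half_plane m R" "x \<in> half_plane m' R'"
  shows "u x = v x"
proof -
  let ?A = "half_plane m R \<inter> half_plane m' R'"
  obtain T where T: "\<And>t. T \<le> t \<Longrightarrow> cball (of_real t * d) 1 \<subseteq> half_plane m R"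
    using half_plane_contains_ray[OF m] by blast
  obtain T' where T': "\<And>t. T' \<le> t \<Longrightarrow> cball (of_real t * d) 1 \<subseteq> half_plane m' R'"
    using half_plane_contains_ray[OF m'] by blast
  show ?thesis
  proof (rule decaying_solution_unique_on_axis[OF d, of ?A "max M M'" u v "max T T'"])
    show "open ?A" by (intro open_Int half_plane_open)
    show "connected ?A" by (intro convex_connected convex_Int half_plane_convex)
    show "decaying_solution ?A (max M M') u" by (rule decaying_solution_mono[OF u]) auto
    show "decaying_solution ?A (max M M') v" by (rule decaying_solution_mono[OF v]) auto
    show "cball (of_real t * d) 1 \<subseteq> ?A" if "max T T' \<le> t" for t
      using T[of t] T'[of t] that by auto
  qed (use x in auto)
qed

text \<open>
  A solution in the one-parameter family is determined by the coefficient of \<open>exp (- x)\<close>.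
\<close>
lemma recessive_solutions_agree_on_real_ray:
  assumes u: "\<And>t. T \<le> t \<Longrightarrow> u analytic_on {of_real t}" "\<And>t. T \<le> t \<Longrightarrow> solves u (of_real t)"
      "\<And>t. T \<le> t \<Longrightarrow> norm (u (of_real t)) \<le> M / t"
    and v: "\<And>t. T \<le> t \<Longrightarrow> v analytic_on {of_real t}" "\<And>t. T \<le> t \<Longrightarrow> solves v (of_real t)"
      "\<And>t. T \<le> t \<Longrightarrow> norm (v (of_real t)) \<le> M / t"
  defines "\<eta> \<equiv> \<lambda>x. csqrt x * (v x - u x)"
  assumes lim: "((\<lambda>t. exp (of_real t) * \<eta> (of_real t)) \<longlongrightarrow> 0) at_top"
    "((\<lambda>t. exp (of_real t) * deriv \<eta> (of_real t)) \<longlongrightarrow> 0) at_top"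
  obtains T' where "\<And>t. T' \<le> t \<Longrightarrow> v (of_real t) = u (of_real t)"
proof -
  define c where "c = K * (2 * \<bar>M\<bar> + 1)\<^sup>2 + 1"
  have c: "1 \<le> c" using K by (simp add: c_def)
  define T1 where "T1 = Max {T, 2 * c, 2 * \<bar>M\<bar>, 1}"
  have T1: "T \<le> T1" "2 * c \<le> T1" "2 * \<bar>M\<bar> \<le> T1" "1 \<le> T1"
    unfolding T1_def by (rule Max_ge; simp)+
  have \<eta>_at: "csqrt y * (v y - u y) = \<eta> y" for y by (simp add: \<eta>_def)
  have "v (of_real t) = u (of_real t)" if t: "T1 \<le> t" for t
  proof -
    have "\<eta> (of_real t * 1) = 0"
    proof (rule recessive_solution_zero[of 1 T1 c \<eta> t, OF _ _ _ _ _ _ _ _ _ t])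
      fix s assume s1: "T1 \<le> s"
      have s: "T \<le> s" "1 \<le> s" "2 * \<bar>M\<bar> \<le> s" "0 < s" using s1 T1 by linarith+
      have n: "norm (of_real s :: complex) = s" using s by simp
      have x: "complex_of_real s \<notin> \<real>\<^sub>\<le>\<^sub>0" "1 \<le> norm (complex_of_real s)"
        using s by (auto simp: complex_nonpos_Reals_iff)
      have le: "M / s \<le> \<bar>M\<bar> / s" using s by (intro divide_right_mono) auto
      have half: "\<bar>M\<bar> / s \<le> 1/2" using s by (simp add: divide_le_eq)
      have uv: "norm (u (of_real s)) \<le> \<bar>M\<bar> / s" "norm (v (of_real s)) \<le> \<bar>M\<bar> / s"
        using u(3)[OF s(1)] v(3)[OF s(1)] le by linarith+
      have uv2: "norm (u (of_real s)) \<le> 1/2" "norm (v (of_real s)) \<le> 1/2" using uv half by linarith+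
      note db = difference_equation_bound[OF u(1,2)[OF s(1)] uv2(1) v(1,2)[OF s(1)] uv2(2) x, unfolded n \<eta>_at]
      show "\<eta> analytic_on {of_real s * 1}" using db(2) by simp
      have "K * (norm (u (of_real s)) + norm (v (of_real s)) + 1 / s)\<^sup>2 + 1 / s\<^sup>2
          \<le> K * (\<bar>M\<bar> / s + \<bar>M\<bar> / s + 1 / s)\<^sup>2 + 1 / s\<^sup>2"
        using K s uv by (intro add_right_mono mult_left_mono power_mono add_mono) auto
      also have "\<dots> = c / s\<^sup>2"
      proof -
        have eq: "\<bar>M\<bar> / s + \<bar>M\<bar> / s + 1 / s = (2 * \<bar>M\<bar> + 1) / s" by (simp add: add_divide_distrib)
        show ?thesis unfolding eq power_divide c_def by (simp add: add_divide_distrib)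
      qed
      finally have "norm (deriv (deriv \<eta>) (of_real s) - \<eta> (of_real s)) \<le> c / s\<^sup>2 * norm (\<eta> (of_real s))"
        by (rule order_trans[OF db(1) mult_right_mono]) auto
      then show "norm (deriv (deriv \<eta>) (of_real s * 1) - \<eta> (of_real s * 1)) \<le> c / s\<^sup>2 * norm (\<eta> (of_real s * 1))"
        by simp
    qed (use T1 c lim in auto)
    then show ?thesis using t T1 by (simp add: \<eta>_def)
  qed
  then show thesis by (rule that)
qed

text \<open>
  The coefficient \<open>C\<close> is read off from \<open>v\<close> on the real axis, where nothing but the convergence
  of \<open>v\<close> to zero is known. The member of the family over \<open>u\<close> with this coefficient coincides
  with \<open>v\<close>, and it extends \<open>v\<close> to the half plane up to the imaginary half axis \<open>d\<close>.
\<close>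
lemma recessive_identification:
  assumes d: "d = \<i> \<or> d = - \<i>"
    and du: "decaying_solution (half_plane (mid d) R) M u"
    and v: "\<And>t. T \<le> t \<Longrightarrow> v analytic_on {of_real t}" "\<And>t. T \<le> t \<Longrightarrow> solves v (of_real t)"
      "((\<lambda>t. v (of_real t)) \<longlongrightarrow> 0) at_top"
  obtains C R' B \<eta> T' where "R \<le> R'" "2 \<le> R'"
    "recessive_perturbation (half_plane (mid d) R' \<inter> {x. - 1 < Re x}) u C B \<eta>"
    "\<And>t. T' \<le> t \<Longrightarrow> v (of_real t) = u (of_real t) + \<eta> (of_real t) / csqrt (of_real t)"
    "\<And>t. C = 0 \<Longrightarrow> T' \<le> t \<Longrightarrow> v (of_real t) = u (of_real t)"
proof -
  note md = mid_norm[OF d] mid_pos(1)[OF d]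
  have du': "decaying_solution (half_plane (mid d) R) \<bar>M\<bar> u" by (rule decaying_solution_mono[OF du]) auto
  note u = decaying_solutionD(1,2,4)[OF du']
  obtain T0 where T0: "0 < T0" "\<And>t. T0 \<le> t \<Longrightarrow> cball (of_real t * 1) 1 \<subseteq> half_plane (mid d) R"
    using half_plane_contains_ray[OF md] by blast
  define T1 where "T1 = max T0 T"
  have on1: "of_real t \<in> half_plane (mid d) R" "0 < t" if "T1 \<le> t" for t
    using T0(2)[of t] T0(1) that by (auto simp: T1_def)
  have uan: "u analytic_on {of_real t}" if "T1 \<le> t" for t
    using on1(1)[OF that] u(1) half_plane_open by (auto simp: analytic_at)
  have ub: "norm (u (of_real t)) \<le> \<bar>M\<bar> / t" if "T1 \<le> t" for t
    using u(2)[OF on1(1)[OF that]] on1(2)[OF that] by simp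
  have vT: "v analytic_on {of_real t}" "solves v (of_real t)" if "T1 \<le> t" for t
    using v(1,2)[of t] that by (auto simp: T1_def)
  define \<theta> where "\<theta> x = csqrt x * (v x - u x)" for x
  obtain C M' T2 where C: "((\<lambda>t. exp (of_real t) * \<theta> (of_real t)) \<longlongrightarrow> C) at_top"
    "((\<lambda>t. exp (of_real t) * deriv \<theta> (of_real t)) \<longlongrightarrow> - C) at_top"
    and M': "\<And>t. T2 \<le> t \<Longrightarrow> norm (v (of_real t)) \<le> M' / t"
    by (rule recessive_difference_on_real_ray[OF uan u(3)[OF on1(1)] ub vT v(3), folded \<theta>_def]) blast+
  obtain \<rho> B where fam': "2 \<le> \<rho> \<and> (\<forall>A u. open A \<longrightarrow> convex A \<longrightarrow> (\<forall>x s. x \<in> A \<longrightarrow> 0 \<le> s \<longrightarrow> x + of_real s \<in> A) \<longrightarrow>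
     (\<forall>x\<in>A. - 1 < Re x \<and> \<rho> \<le> norm x) \<longrightarrow> decaying_solution A \<bar>M\<bar> u \<longrightarrow>
     (\<exists>\<eta>. recessive_perturbation A u C B \<eta>))"
    using recessive_family[of "\<bar>M\<bar>" C, OF abs_ge_zero] by (elim exE)
  note \<rho> = conjunct1[OF fam'] and fam = conjunct2[OF fam', rule_format]
  define R' where "R' = max R \<rho>"
  define Q where "Q = half_plane (mid d) R' \<inter> {x. - 1 < Re x}"
  have QR: "x \<in> half_plane (mid d) R" if "x \<in> Q" for x
    using that by (auto simp: Q_def half_plane_def R'_def)
  have Qo: "open Q" unfolding Q_def by (intro open_Int half_plane_open open_halfspace_Re_gt)
  have Qn: "\<rho> \<le> norm x" if "x \<in> Q" for x
    using half_plane_norm[OF _ md(1), of x R'] that by (auto simp: Q_def R'_def)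
  have "\<exists>\<eta>. recessive_perturbation Q u C B \<eta>"
  proof (rule fam[OF Qo])
    show "convex Q" unfolding Q_def by (intro convex_Int half_plane_convex convex_halfspace_Re_gt)
    show "x + of_real s \<in> Q" if x: "x \<in> Q" "0 \<le> s" for x s
    proof -
      have "mid d \<bullet> of_real s = s * (mid d \<bullet> 1)"
        using inner_scaleR_right[of "mid d" s 1] by (simp add: scaleR_conv_of_real)
      moreover have "0 \<le> s * (mid d \<bullet> 1)" using x md by simp
      ultimately show ?thesis
        using x by (simp add: Q_def half_plane_def inner_add_right)
    qed
    show "- 1 < Re x \<and> \<rho> \<le> norm x" if "x \<in> Q" for x using Qn[OF that] that by (simp add: Q_def)
    show "decaying_solution Q \<bar>M\<bar> u" by (rule decaying_solution_mono[OF du']) (use QR in auto)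
  qed
  then obtain \<eta> where per: "recessive_perturbation Q u C B \<eta>" by blast
  note \<eta> = recessive_perturbationD[OF per]
  obtain T3 where T3: "0 < T3" "\<And>t. T3 \<le> t \<Longrightarrow> cball (of_real t * 1) 1 \<subseteq> half_plane (mid d) R'"
    using half_plane_contains_ray[OF md] by blast
  define T4 where "T4 = Max {T1, T2, T3, 1}"
  have T4: "T1 \<le> T4" "T2 \<le> T4" "T3 \<le> T4" "1 \<le> T4"
    unfolding T4_def by (rule Max_ge; simp)+
  have inQ: "of_real t \<in> Q" if "T4 \<le> t" for t
    using T3(2)[of t] T4 that by (auto simp: Q_def)
  have slit: "complex_of_real t \<notin> \<real>\<^sub>\<le>\<^sub>0" if "T4 \<le> t" for t
    using that T4 by (auto simp: complex_nonpos_Reals_iff)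
  define f where "f x = u x + \<eta> x / csqrt x" for x
  have uanQ: "u analytic_on {of_real t}" and \<eta>an: "\<eta> analytic_on {of_real t}" if "T4 \<le> t" for t
    using uan[of t] \<eta>(1) Qo inQ[OF that] that T4 by (auto simp: analytic_at)
  have fan: "f analytic_on {of_real t}" if t: "T4 \<le> t" for t
    unfolding f_def[abs_def]
    by (intro analytic_intros uanQ[OF t] \<eta>an[OF t]) (use slit[OF t] that T4 in auto)
  have small: "((\<lambda>t. exp (of_real t) * \<eta> (of_real t)) \<longlongrightarrow> C) at_top"
    "((\<lambda>t. exp (of_real t) * deriv \<eta> (of_real t)) \<longlongrightarrow> - C) at_top"
  proof -
    have lim0: "((\<lambda>t. B / t) \<longlongrightarrow> 0) at_top" by real_asymp
    have ne: "norm (exp (complex_of_real t)) = exp t" for t by (simp add: norm_exp_eq_Re)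
    have E: "exp t * (B / t * exp (- t)) = B / t" for t by (simp add: exp_minus)
    have "((\<lambda>t. exp (of_real t) * \<eta> (of_real t) - C) \<longlongrightarrow> 0) at_top"
    proof (rule Lim_null_comparison[OF _ lim0])
      show "\<forall>\<^sub>F t in at_top. norm (exp (of_real t) * \<eta> (of_real t) - C) \<le> B / t"
        using eventually_ge_at_top[of T4]
      proof eventually_elim
        case (elim t)
        have t: "norm (complex_of_real t) = t" using elim T4 by simp
        have eq: "exp (of_real t) * \<eta> (of_real t) - C = exp (of_real t) * (\<eta> (of_real t) - C * exp (- of_real t))"
          by (simp add: right_diff_distrib exp_minus)
        have "exp t * norm (\<eta> (of_real t) - C * exp (- of_real t)) \<le> exp t * (B / t * exp (- t))"
          using \<eta>(4)[OF inQ[OF elim]] t by (intro mult_left_mono) auto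
        then show ?case unfolding eq norm_mult ne[of t] E[of t] .
      qed
    qed
    then show "((\<lambda>t. exp (of_real t) * \<eta> (of_real t)) \<longlongrightarrow> C) at_top" by (rule LIM_zero_cancel)
    have "((\<lambda>t. exp (of_real t) * deriv \<eta> (of_real t) - (- C)) \<longlongrightarrow> 0) at_top"
    proof (rule Lim_null_comparison[OF _ lim0])
      show "\<forall>\<^sub>F t in at_top. norm (exp (of_real t) * deriv \<eta> (of_real t) - (- C)) \<le> B / t"
        using eventually_ge_at_top[of T4]
      proof eventually_elim
        case (elim t)
        have t: "norm (complex_of_real t) = t" using elim T4 by simp
        have eq: "exp (of_real t) * deriv \<eta> (of_real t) - (- C) = exp (of_real t) * (deriv \<eta> (of_real t) + C * exp (- of_real t))"
          by (simp add: distrib_left exp_minus)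
        have "exp t * norm (deriv \<eta> (of_real t) + C * exp (- of_real t)) \<le> exp t * (B / t * exp (- t))"
          using \<eta>(5)[OF inQ[OF elim]] t by (intro mult_left_mono) auto
        then show ?case unfolding eq norm_mult ne[of t] E[of t] .
      qed
    qed
    then show "((\<lambda>t. exp (of_real t) * deriv \<eta> (of_real t)) \<longlongrightarrow> - C) at_top" by (rule LIM_zero_cancel)
  qed
  define M'' where "M'' = Max {\<bar>M\<bar> + norm C + \<bar>B\<bar>, M', \<bar>M\<bar>}"
  have M'': "\<bar>M\<bar> + norm C + \<bar>B\<bar> \<le> M''" "M' \<le> M''" "\<bar>M\<bar> \<le> M''"
    unfolding M''_def by (rule Max_ge; simp)+
  have fb: "norm (f (of_real t)) \<le> M'' / t" if t: "T4 \<le> t" for t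
  proof -
    have t1: "1 \<le> t" "0 < t" using t T4 by linarith+
    have nt: "norm (complex_of_real t) = t" using t1 by simp
    have "t \<le> exp t" using exp_ge_add_one_self[of t] by linarith
    then have et: "exp (- t) \<le> 1 / t"
      using t1 by (simp add: exp_minus divide_simps)
    have "norm (\<eta> (of_real t)) \<le> norm (C * exp (- of_real t)) + norm (\<eta> (of_real t) - C * exp (- of_real t))"
      by (rule norm_triangle_sub)
    also have "\<dots> \<le> norm C * exp (- t) + B / t * exp (- t)"
      using \<eta>(4)[OF inQ[OF t]] nt by (simp add: norm_mult norm_exp_eq_Re)
    also have "\<dots> = (norm C + B / t) * exp (- t)" by (simp add: distrib_right)
    also have "\<dots> \<le> (norm C + \<bar>B\<bar>) * (1 / t)"
    proof (rule mult_mono)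
      have "B / t \<le> \<bar>B\<bar> / 1" using t1 by (intro frac_le) auto
      then show "norm C + B / t \<le> norm C + \<bar>B\<bar>" by simp
    qed (use et in auto)
    finally have e1: "norm (\<eta> (of_real t)) \<le> (norm C + \<bar>B\<bar>) / t" by simp
    have "norm (csqrt (of_real t)) \<ge> 1"
      using csqrt_norm_sq[of "of_real t"] nt t1 by (intro power2_le_imp_le[of 1]) auto
    then have "norm (\<eta> (of_real t)) / norm (csqrt (of_real t)) \<le> norm (\<eta> (of_real t)) / 1"
      by (intro frac_le) auto
    then have "norm (\<eta> (of_real t) / csqrt (of_real t)) \<le> (norm C + \<bar>B\<bar>) / t"
      using e1 unfolding norm_divide by linarith
    moreover have "norm (u (of_real t)) \<le> \<bar>M\<bar> / t" using ub[of t] t T4 by simp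
    ultimately have "norm (f (of_real t)) \<le> \<bar>M\<bar> / t + (norm C + \<bar>B\<bar>) / t"
      unfolding f_def using norm_triangle_ineq[of "u (of_real t)" "\<eta> (of_real t) / csqrt (of_real t)"] by linarith
    also have "\<dots> = (\<bar>M\<bar> + norm C + \<bar>B\<bar>) / t" by (simp add: add_divide_distrib)
    also have "\<dots> \<le> M'' / t" using M'' t1 by (intro divide_right_mono) auto
    finally show ?thesis .
  qed
  have vb: "norm (v (of_real t)) \<le> M'' / t" and ub': "norm (u (of_real t)) \<le> M'' / t" if t: "T4 \<le> t" for t
  proof -
    have t0: "0 < t" using t T4 by linarith
    have "M' / t \<le> M'' / t" "\<bar>M\<bar> / t \<le> M'' / t" using M'' t0 by (auto intro!: divide_right_mono)
    then show "norm (v (of_real t)) \<le> M'' / t" "norm (u (of_real t)) \<le> M'' / t"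
      using M'[of t] ub[of t] t T4 by linarith+
  qed
  have van: "v analytic_on {of_real t}" "solves v (of_real t)" if "T4 \<le> t" for t
    using vT[of t] that T4 by auto
  have us: "solves u (of_real t)" if "T4 \<le> t" for t using u(3)[OF QR[OF inQ[OF that]]] .
  have fs: "solves f (of_real t)" if "T4 \<le> t" for t
    using \<eta>(2)[OF inQ[OF that]] by (simp add: f_def[abs_def])
  define \<delta> where "\<delta> x = csqrt x * (v x - f x)" for x
  have \<delta>_eq: "\<delta> x = \<theta> x - \<eta> x" if "x \<noteq> 0" for x
    using that by (simp add: \<delta>_def \<theta>_def f_def algebra_simps)
  have \<theta>an: "\<theta> analytic_on {of_real t}" if t: "T4 \<le> t" for t
    unfolding \<theta>_def[abs_def] by (intro analytic_intros uanQ[OF t] van(1)[OF t]) (use slit[OF t] in auto)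
  have \<delta>1: "deriv \<delta> (of_real t) = deriv \<theta> (of_real t) - deriv \<eta> (of_real t)" if t: "T4 \<le> t" for t
  proof -
    have "deriv \<delta> (of_real t) = deriv (\<lambda>x. \<theta> x - \<eta> x) (of_real t)"
    proof (rule deriv_cong_ev[OF _ refl])
      have "\<forall>\<^sub>F x in nhds (complex_of_real t). x \<in> - {0}"
        by (rule eventually_nhds_in_open) (use t T4 in auto)
      then show "\<forall>\<^sub>F x in nhds (complex_of_real t). \<delta> x = \<theta> x - \<eta> x"
        by eventually_elim (use \<delta>_eq in auto)
    qed
    also have "\<dots> = deriv \<theta> (of_real t) - deriv \<eta> (of_real t)"
      using \<theta>an[OF t] \<eta>an[OF t] by (intro deriv_diff analytic_on_imp_differentiable_at) auto
    finally show ?thesis .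
  qed
  have \<delta>lim: "((\<lambda>t. exp (of_real t) * \<delta> (of_real t)) \<longlongrightarrow> 0) at_top"
    "((\<lambda>t. exp (of_real t) * deriv \<delta> (of_real t)) \<longlongrightarrow> 0) at_top"
  proof -
    have "((\<lambda>t. exp (of_real t) * \<theta> (of_real t) - exp (of_real t) * \<eta> (of_real t)) \<longlongrightarrow> C - C) at_top"
      by (intro tendsto_diff C small)
    then have l1: "((\<lambda>t. exp (of_real t) * \<theta> (of_real t) - exp (of_real t) * \<eta> (of_real t)) \<longlongrightarrow> 0) at_top" by simp
    show "((\<lambda>t. exp (of_real t) * \<delta> (of_real t)) \<longlongrightarrow> 0) at_top"
    proof (rule Lim_transform_eventually[OF l1])
      show "\<forall>\<^sub>F t in at_top. exp (of_real t) * \<theta> (of_real t) - exp (of_real t) * \<eta> (of_real t) = exp (of_real t) * \<delta> (of_real t)"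
        using eventually_ge_at_top[of T4]
        by eventually_elim (use \<delta>_eq T4 in \<open>simp add: right_diff_distrib\<close>)
    qed
    have "((\<lambda>t. exp (of_real t) * deriv \<theta> (of_real t) - exp (of_real t) * deriv \<eta> (of_real t)) \<longlongrightarrow> - C - - C) at_top"
      by (intro tendsto_diff C small)
    then have l2: "((\<lambda>t. exp (of_real t) * deriv \<theta> (of_real t) - exp (of_real t) * deriv \<eta> (of_real t)) \<longlongrightarrow> 0) at_top" by simp
    show "((\<lambda>t. exp (of_real t) * deriv \<delta> (of_real t)) \<longlongrightarrow> 0) at_top"
    proof (rule Lim_transform_eventually[OF l2])
      show "\<forall>\<^sub>F t in at_top. exp (of_real t) * deriv \<theta> (of_real t) - exp (of_real t) * deriv \<eta> (of_real t) = exp (of_real t) * deriv \<delta> (of_real t)"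
        using eventually_ge_at_top[of T4]
        by eventually_elim (use \<delta>1 in \<open>simp add: right_diff_distrib\<close>)
    qed
  qed
  obtain T5 where T5: "\<And>t. T5 \<le> t \<Longrightarrow> v (of_real t) = f (of_real t)"
    using recessive_solutions_agree_on_real_ray[OF fan fs fb van vb \<delta>lim[unfolded \<delta>_def]] by blast
  have zero: "\<exists>T6. \<forall>t\<ge>T6. v (of_real t) = u (of_real t)" if C0: "C = 0"
  proof -
    have C': "((\<lambda>t. exp (of_real t) * \<theta> (of_real t)) \<longlongrightarrow> 0) at_top"
      "((\<lambda>t. exp (of_real t) * deriv \<theta> (of_real t)) \<longlongrightarrow> 0) at_top"
      using C C0 by auto
    show ?thesis
      using recessive_solutions_agree_on_real_ray[OF uanQ us ub' van vb C'[unfolded \<theta>_def]] by blast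
  qed
  (* A threshold with this property exists only if C = 0; otherwise the value is arbitrary. *)
  define T6 where "T6 = (SOME T6. \<forall>t\<ge>T6. v (of_real t) = u (of_real t))"
  have T6: "v (of_real t) = u (of_real t)" if "C = 0" "T6 \<le> t" for t
    using someI_ex[OF zero[OF that(1)]] that(2) by (simp add: T6_def)
  show thesis
  proof (rule that[of R' C B \<eta> "max T5 T6"])
    show "R \<le> R'" "2 \<le> R'" using \<rho> by (auto simp: R'_def)
    show "recessive_perturbation (half_plane (mid d) R' \<inter> {x. - 1 < Re x}) u C B \<eta>"
      using per by (simp add: Q_def)
    show "v (of_real t) = u (of_real t) + \<eta> (of_real t) / csqrt (of_real t)" if "max T5 T6 \<le> t" for t
      using T5[of t] that by (simp add: f_def)
    show "v (of_real t) = u (of_real t)" if "C = 0" "max T5 T6 \<le> t" for t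
      using T6[of t] that by simp
  qed
qed

end

section \<open>Identity theorem and lifting of truncated solutions\<close>

lemma nicely_meromorphic_agree_at:
  assumes f: "f nicely_meromorphic_on {z}" and g: "g nicely_meromorphic_on {z}"
    and ev: "\<forall>\<^sub>F w in at z. f w = g w"
  shows "f z = g z"
proof -
  have pole: "is_pole f z \<longleftrightarrow> is_pole g z" by (rule is_pole_cong[OF ev refl])
  have no: "\<not> is_pole h z" if "h \<midarrow>z\<rightarrow> h z" for h
    using not_tendsto_and_filterlim_at_infinity[OF _ that] by (auto simp: is_pole_def)
  show ?thesis
  proof (cases "is_pole f z")
    case True
    then have "f z = 0" "g z = 0"
      using f g no[of f] no[of g] pole by (auto simp: nicely_meromorphic_on_def)
    then show ?thesis by simp
  next
    case False
    then have "f \<midarrow>z\<rightarrow> f z" "g \<midarrow>z\<rightarrow> g z"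
      using f g pole by (auto simp: nicely_meromorphic_on_def)
    moreover from this(1) have "g \<midarrow>z\<rightarrow> f z"
      by (rule Lim_transform_eventually[OF _ ev])
    ultimately show ?thesis using LIM_unique by blast
  qed
qed

text \<open>
  The set \<open>S\<close> may contain boundary points, such as those of the imaginary axis, which is where the
  exponential constants are read off. At every point of
  \<open>S\<close> the two functions either agree or differ in a punctured neighbourhood; the first alternative
  is open and closed in \<open>S\<close>.
\<close>
lemma nicely_meromorphic_identity:
  assumes f: "f nicely_meromorphic_on S" and g: "g nicely_meromorphic_on S" and S: "connected S"
    and ray: "\<And>t. T \<le> t \<Longrightarrow> of_real t \<in> S" and eq: "\<And>t. T \<le> t \<Longrightarrow> f (of_real t) = g (of_real t)"
    and x: "x \<in> S"
  shows "f x = g x"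
proof -
  define P where "P z \<longleftrightarrow> (\<forall>\<^sub>F w in at z. f w = g w)" for z
  have dich: "P z \<or> (\<forall>\<^sub>F w in at z. f w \<noteq> g w)" if z: "z \<in> S" for z
  proof -
    have "f meromorphic_on {z}" "g meromorphic_on {z}"
      using f g z by (auto simp: nicely_meromorphic_on_def intro: meromorphic_on_subset)
    then have "(\<lambda>w. f w - g w) meromorphic_on {z}" by (rule meromorphic_on_diff)
    then have "isolated_singularity_at (\<lambda>w. f w - g w) z" "not_essential (\<lambda>w. f w - g w) z"
      by (auto simp: meromorphic_at_iff)
    from non_zero_neighbour[OF this] show ?thesis
      by (auto simp: P_def frequently_def)
  qed
  have punct: "\<forall>\<^sub>F w in at y. w \<in> ball z r \<and> w \<noteq> z" if "y \<in> ball z r" for y z :: complex and r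
  proof -
    have 1: "\<forall>\<^sub>F w in at y. w \<in> ball z r" by (rule eventually_at_in_open'[OF open_ball that])
    have 2: "\<forall>\<^sub>F w in at y. w \<noteq> z" by (rule eventually_neq_at_within)
    show ?thesis using eventually_conj[OF 1 2] .
  qed
  have "P x"
  proof (rule connected_induction_simple[OF S ray[OF order_refl] x])
    show "P (of_real T)"
    proof (rule ccontr)
      assume "\<not> P (of_real T)"
      then have "\<forall>\<^sub>F w in at (complex_of_real T). f w \<noteq> g w" using dich[OF ray[OF order_refl]] by blast
      then obtain r where r: "0 < r" "\<And>w. w \<noteq> of_real T \<Longrightarrow> dist w (of_real T) < r \<Longrightarrow> f w \<noteq> g w"
        by (auto simp: eventually_at)
      have n: "dist (complex_of_real (T + r / 2)) (of_real T) = r / 2"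
        unfolding dist_of_real dist_real_def using r(1) by simp
      have "f (of_real (T + r / 2)) \<noteq> g (of_real (T + r / 2))"
        using n r(1) by (intro r(2)) auto
      moreover have "f (of_real (T + r / 2)) = g (of_real (T + r / 2))"
        by (rule eq) (use r(1) in simp)
      ultimately show False by contradiction
    qed
    fix z assume z: "z \<in> S"
    show "\<exists>V. openin (top_of_set S) V \<and> z \<in> V \<and> (\<forall>x\<in>V. \<forall>y\<in>V. P x \<longrightarrow> P y)"
      using dich[OF z]
    proof
      assume "P z"
      then obtain r where r: "0 < r" "\<And>w. w \<noteq> z \<Longrightarrow> dist w z < r \<Longrightarrow> f w = g w"
        by (auto simp: P_def eventually_at)
      have "P y" if "y \<in> ball z r" for y
        unfolding P_def using punct[OF that] by eventually_elim (use r(2) in \<open>auto simp: dist_commute\<close>)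
      then show ?thesis
        using z r(1) by (intro exI[of _ "S \<inter> ball z r"]) (auto intro: openin_open_Int)
    next
      assume "\<forall>\<^sub>F w in at z. f w \<noteq> g w"
      then obtain r where r: "0 < r" "\<And>w. w \<noteq> z \<Longrightarrow> dist w z < r \<Longrightarrow> f w \<noteq> g w"
        by (auto simp: eventually_at)
      have "\<not> P y" if "y \<in> ball z r" for y
      proof
        assume "P y"
        then have "\<forall>\<^sub>F w in at y. f w = g w \<and> (w \<in> ball z r \<and> w \<noteq> z)"
          unfolding P_def by (rule eventually_conj[OF _ punct[OF that]])
        then have "\<forall>\<^sub>F w in at y. False"
          by eventually_elim (use r(2) in \<open>auto simp: dist_commute\<close>)
        then show False by simp
      qed
      then show ?thesis
        using z r(1) by (intro exI[of _ "S \<inter> ball z r"]) (auto intro: openin_open_Int)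
    qed
  qed
  then show ?thesis
    unfolding P_def
    by (intro nicely_meromorphic_agree_at nicely_meromorphic_on_subset[OF f] nicely_meromorphic_on_subset[OF g])
      (use x in auto)
qed

lemma PV_of_holomorphic:
  assumes "u holomorphic_on A" "\<And>x. x \<in> A \<Longrightarrow> norm (u x) \<le> 1/2"
  shows "(\<lambda>x. PV_of (u x)) holomorphic_on A"
proof -
  have "sin (u x) - 1 \<noteq> 0" if "x \<in> A" for x
    using sin_neq_small[of "u x"] assms(2)[OF that] by auto
  then show ?thesis unfolding PV_of_def by (intro holomorphic_intros assms)
qed

lemma PV_of_linear_bounds:
  obtains r where "0 < r" "r \<le> 1/2" "\<And>z. norm z < r \<Longrightarrow> norm z \<le> norm (PV_of z + 1)"
    "\<And>z. norm z < r \<Longrightarrow> norm (PV_of z + 1) \<le> 3 * norm z"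
proof -
  have "(PV_of has_field_derivative - 2) (at 0)"
    using PV_of_deriv(1)[of 0] by simp
  then have "(PV_of has_derivative (*) (- 2)) (at 0)" by (simp add: has_field_derivative_def)
  then obtain r0 where r0: "0 < r0" "\<And>y. norm (y - 0) < r0 \<Longrightarrow> norm (PV_of y - PV_of 0 - (- 2) * (y - 0)) \<le> 1 * norm (y - 0)"
    unfolding has_derivative_at_alt using zero_less_one by blast
  have 0: "PV_of 0 = - 1" by (simp add: PV_of_def)
  have est: "norm (PV_of z + 1 + 2 * z) \<le> norm z" if "norm z < r0" for z
    using r0(2)[of z] that by (simp add: 0)
  show thesis
  proof (rule that[of "min r0 (1/2)"])
    fix z :: complex assume "norm z < min r0 (1/2)"
    then have e: "norm (PV_of z + 1 + 2 * z) \<le> norm z" by (intro est) simp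
    have "norm (2 * z) \<le> norm (PV_of z + 1 + 2 * z) + norm (PV_of z + 1)"
      using norm_triangle_ineq4[of "PV_of z + 1 + 2 * z" "PV_of z + 1"] by simp
    then show "norm z \<le> norm (PV_of z + 1)" using e by (simp add: norm_mult)
    have "norm (PV_of z + 1) \<le> norm (PV_of z + 1 + 2 * z) + norm (2 * z)"
      using norm_triangle_ineq4[of "PV_of z + 1 + 2 * z" "2 * z"] by simp
    then show "norm (PV_of z + 1) \<le> 3 * norm z" using e by (simp add: norm_mult)
  qed (use r0 in auto)
qed

lemma PV_of_Arcsin:
  assumes "v \<noteq> 1" shows "PV_of (Arcsin ((v + 1) / (v - 1))) = v"
proof -
  have v: "v - 1 \<noteq> 0" using assms by simp
  have "(v + 1) / (v - 1) + 1 = 2 * v / (v - 1)" "(v + 1) / (v - 1) - 1 = 2 / (v - 1)"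
    using v by (simp_all add: divide_simps)
  then show ?thesis using v by (simp add: PV_of_def)
qed

text \<open>
  Close to \<open>- 1\<close> the substitution is inverted by the arcus sine. A solution that converges to
  \<open>- 1\<close> on the real axis has no poles at large points of this axis, since nicely meromorphic
  functions have the value \<open>0\<close> at their poles.
\<close>
lemma PV_truncated_lift:
  assumes v: "PV_truncated \<alpha> \<beta> \<gamma> 2 v"
  defines "u \<equiv> \<lambda>x. Arcsin ((v x + 1) / (v x - 1))"
  obtains T where "\<And>t. T \<le> t \<Longrightarrow> u analytic_on {of_real t}"
    "\<And>t. T \<le> t \<Longrightarrow> deriv (deriv u) (of_real t) + deriv u (of_real t) / of_real t = PV_forcing \<alpha> \<beta> \<gamma> (of_real t) (u (of_real t))"
    "\<And>t. T \<le> t \<Longrightarrow> v (of_real t) = PV_of (u (of_real t))"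
    "((\<lambda>t. u (of_real t)) \<longlongrightarrow> 0) at_top"
proof -
  obtain R where R: "0 < R" "PV_solution_on \<alpha> \<beta> \<gamma> 2 v {x. 0 \<le> Re x \<and> R < norm x}"
    using v unfolding PV_truncated_def by blast
  have "((\<lambda>r. v (rcis r (- 0))) \<longlongrightarrow> -1) at_top"
    using v pi_gt_zero unfolding PV_truncated_def by (metis abs_zero half_gt_zero)
  then have lim: "((\<lambda>t. v (of_real t)) \<longlongrightarrow> -1) at_top" by simp
  define q where "q x = (v x + 1) / (v x - 1)" for x
  have "((\<lambda>t. q (of_real t)) \<longlongrightarrow> (- 1 + 1) / (- 1 - 1)) at_top"
    unfolding q_def by (intro tendsto_intros lim) auto
  then have q0: "((\<lambda>t. q (of_real t)) \<longlongrightarrow> 0) at_top" by simp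
  have "isCont Arcsin 0" by (rule isCont_Arcsin) auto
  then have u0: "((\<lambda>t. u (of_real t)) \<longlongrightarrow> 0) at_top"
    using isCont_tendsto_compose[OF _ q0, of Arcsin] by (simp add: u_def q_def)
  have "((\<lambda>t. norm (v (of_real t) - (- 1))) \<longlongrightarrow> 0) at_top"
    using tendsto_norm_zero[OF LIM_zero[OF lim]] by simp
  then have e1: "\<forall>\<^sub>F t in at_top. norm (v (of_real t) - (- 1)) < 1" by (rule order_tendstoD) simp
  have e2: "\<forall>\<^sub>F t in at_top. norm (q (of_real t)) < 1" by (rule order_tendstoD[OF tendsto_norm_zero[OF q0]]) simp
  have e3: "\<forall>\<^sub>F t in at_top. norm (u (of_real t)) < 1/2" by (rule order_tendstoD[OF tendsto_norm_zero[OF u0]]) simp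
  have "\<forall>\<^sub>F t in at_top. (norm (v (of_real t) - (- 1)) < 1 \<and> norm (q (of_real t)) < 1) \<and> (norm (u (of_real t)) < 1/2 \<and> R + 1 \<le> t)"
    by (intro eventually_conj e1 e2 e3 eventually_ge_at_top)
  then obtain T where T: "\<And>t. T \<le> t \<Longrightarrow> norm (v (of_real t) - (- 1)) < 1"
    "\<And>t. T \<le> t \<Longrightarrow> norm (q (of_real t)) < 1" "\<And>t. T \<le> t \<Longrightarrow> norm (u (of_real t)) < 1/2" "\<And>t. T \<le> t \<Longrightarrow> R + 1 \<le> t"
    unfolding eventually_at_top_linorder by blast
  have facts: "u analytic_on {of_real t} \<and>
      deriv (deriv u) (of_real t) + deriv u (of_real t) / of_real t = PV_forcing \<alpha> \<beta> \<gamma> (of_real t) (u (of_real t)) \<and>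
      v (of_real t) = PV_of (u (of_real t))" if t: "T \<le> t" for t
  proof -
    let ?x = "complex_of_real t"
    have x: "?x \<in> {x. 0 \<le> Re x \<and> R < norm x}" "?x \<noteq> 0" using T(4)[OF t] R(1) by auto
    have v01: "v ?x \<noteq> 0" "v ?x \<noteq> 1" using T(1)[OF t] by auto
    have nice: "v nicely_meromorphic_on {x. 0 \<le> Re x \<and> R < norm x}" using R(2) by (simp add: PV_solution_on_def)
    have np: "\<not> is_pole v ?x"
    proof
      assume p: "is_pole v ?x"
      then have "\<not> v \<midarrow>?x\<rightarrow> v ?x"
        using not_tendsto_and_filterlim_at_infinity[of "at ?x" v "v ?x"] by (auto simp: is_pole_def)
      with nice x(1) v01(1) show False unfolding nicely_meromorphic_on_def by blast
    qed
    have van: "v analytic_on {?x}" by (rule nicely_meromorphic_on_imp_analytic_at[OF nice x(1) np])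
    have qan: "q analytic_on {?x}"
      unfolding q_def[abs_def] by (intro analytic_intros van) (use v01 in auto)
    have "Arcsin holomorphic_on ball 0 1"
    proof (rule holomorphic_on_Arcsin)
      fix z :: complex assume "z \<in> ball 0 1"
      then show "\<bar>Re z\<bar> < 1" using abs_Re_le_cmod[of z] by simp
    qed
    then have "Arcsin analytic_on q ` {?x}"
      using T(2)[OF t] by (auto simp: analytic_at intro!: exI[of _ "ball 0 1"])
    then have uan: "u analytic_on {?x}"
      using analytic_on_compose[OF qan] by (simp add: o_def u_def q_def[abs_def])
    have "isCont v ?x" using van by (rule analytic_at_imp_isCont)
    then have "\<forall>\<^sub>F y in nhds ?x. v y \<noteq> 1"
      using v01(2) by (intro tendsto_imp_eventually_ne[of v "v ?x"]) (auto simp: isCont_def tendsto_at_iff_tendsto_nhds)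
    then have ev: "\<forall>\<^sub>F y in nhds ?x. v y = PV_of (u y)"
      by eventually_elim (simp add: u_def PV_of_Arcsin)
    have "PV_eq \<alpha> \<beta> \<gamma> 2 v ?x" using R(2) x(1) np v01 by (auto simp: PV_solution_on_def)
    then have "deriv (deriv u) ?x + deriv u ?x / ?x = PV_forcing \<alpha> \<beta> \<gamma> ?x (u ?x)"
      using PV_of_eq_iff[OF uan _ x(2) ev] T(3)[OF t] by simp
    with uan eventually_nhds_x_imp_x[OF ev] show ?thesis by blast
  qed
  show thesis by (rule that[of T]) (use facts u0 in auto)
qed

section \<open>The tritronquee solutions and their continuation\<close>

lemma has_exp_constant_0_iff:
  assumes d: "norm d = 1"
  shows "has_exp_constant d w 0 \<longleftrightarrow> ((\<lambda>y. norm (w (d * of_real y) + 1) * sqrt y) \<longlongrightarrow> 0) at_top"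
proof -
  have eq: "norm ((w (d * of_real y) + 1) / of_real (norm (d * of_real y) powr (-1/2))) = norm (w (d * of_real y) + 1) * sqrt y"
    if "0 < y" for y
  proof -
    have n: "norm (d * of_real y) = y" using that d by (simp add: norm_mult)
    have "y powr (-1/2) = inverse (y powr (1/2))" using powr_minus[of y "1/2"] by simp
    also have "\<dots> = inverse (sqrt y)" using that by (simp add: powr_half_sqrt)
    finally have p: "y powr (-1/2) = inverse (sqrt y)" .
    have s: "0 < sqrt y" using that by simp
    show ?thesis unfolding n p norm_divide norm_of_real using s by (simp add: divide_inverse)
  qed
  have ev: "\<forall>\<^sub>F y in at_top. norm ((w (d * of_real y) + 1) / of_real (norm (d * of_real y) powr (-1/2))) = norm (w (d * of_real y) + 1) * sqrt y"
    using eventually_gt_at_top[of 0] by eventually_elim (rule eq)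
  have nz: "\<forall>\<^sub>F y in at_top. complex_of_real (norm (d * of_real y) powr (-1/2)) \<noteq> 0"
    using eventually_gt_at_top[of 0] by eventually_elim (use d in \<open>auto simp: norm_mult\<close>)
  have "has_exp_constant d w 0 \<longleftrightarrow>
      ((\<lambda>y. (w (d * of_real y) + 1) / complex_of_real (norm (d * of_real y) powr (-1/2))) \<longlongrightarrow> 0) at_top"
    unfolding has_exp_constant_def Let_def
    using smalloI_tendsto[OF _ nz] smalloD_tendsto by auto
  also have "\<dots> \<longleftrightarrow> ((\<lambda>y. norm ((w (d * of_real y) + 1) / complex_of_real (norm (d * of_real y) powr (-1/2)))) \<longlongrightarrow> 0) at_top"
    by (rule tendsto_norm_zero_iff[symmetric])
  also have "\<dots> \<longleftrightarrow> ((\<lambda>y. norm (w (d * of_real y) + 1) * sqrt y) \<longlongrightarrow> 0) at_top"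
    by (rule tendsto_cong[OF ev])
  finally show ?thesis .
qed

lemma half_plane_mono: "R \<le> R' \<Longrightarrow> half_plane m R' \<subseteq> half_plane m R"
  by (auto simp: half_plane_def)

lemma inner_of_real_mult: "m \<bullet> (of_real t * y) = t * (m \<bullet> (y::complex))"
  by (simp add: scaleR_conv_of_real[symmetric])

locale PV_problem = forced_pendulum "PV_forcing \<alpha> \<beta> \<gamma>" K for \<alpha> \<beta> \<gamma> K
begin

lemma PV_eq_of_solves:
  assumes "u analytic_on {x}" "norm (u x) \<le> 1/2" "x \<noteq> 0" "\<forall>\<^sub>F y in nhds x. w y = PV_of (u y)" "solves u x"
  shows "PV_eq \<alpha> \<beta> \<gamma> 2 w x"
  using PV_of_eq_iff[OF assms(1-4)] assms(5) unfolding solves_def by blast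

text \<open>
  Solutions without exponential terms at the axis \<open>d\<close> with \<open>m \<bullet> d > 0\<close>. By
  \<open>half_plane_solutions_agree\<close> these are restrictions of one function for each \<open>d\<close>.
\<close>
definition pure_solution :: "complex \<Rightarrow> real \<Rightarrow> (complex \<Rightarrow> complex) \<Rightarrow> bool" where
  "pure_solution m R u \<longleftrightarrow> (\<exists>M. decaying_solution (half_plane m R) M u)"

lemma pure_solution_exists:
  assumes d: "d = \<i> \<or> d = - \<i>" and m: "norm m = 1" "0 < m \<bullet> d"
  obtains R u where "1 \<le> R" "pure_solution m R u"
proof -
  have dd: "d * cnj d = 1" using d by auto
  then have m': "d * (cnj d * m) = m" by (simp flip: mult.assoc)
  have n: "norm (cnj d * m) = 1" using d m by (auto simp: norm_mult)
  have re: "0 < Re (cnj d * m)" using m(2) d by (auto simp: inner_complex_def)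
  show thesis
    by (rule half_plane_solution[OF n re d]) (use that m' in \<open>auto simp: pure_solution_def\<close>)
qed

lemma pure_solution_mono: "pure_solution m R u \<Longrightarrow> R \<le> R' \<Longrightarrow> pure_solution m R' u"
  unfolding pure_solution_def using half_plane_mono[of R R' m] decaying_solution_mono by blast

lemma pure_solution_PV_of_holomorphic:
  "pure_solution m R u \<Longrightarrow> (\<lambda>x. PV_of (u x)) holomorphic_on half_plane m R"
  unfolding pure_solution_def by (auto intro: PV_of_holomorphic dest: decaying_solutionD)

lemma pure_solutions_agree:
  assumes d: "d = \<i> \<or> d = - \<i>" and m: "norm m = 1" "0 < m \<bullet> d" and m': "norm m' = 1" "0 < m' \<bullet> d"
    and u: "pure_solution m R u" and v: "pure_solution m' R' v"
    and x: "x \<in> half_plane m R" "x \<in> half_plane m' R'"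
  shows "u x = v x"
proof -
  obtain M M' where "decaying_solution (half_plane m R) M u" "decaying_solution (half_plane m' R') M' v"
    using u v by (auto simp: pure_solution_def)
  then show ?thesis by (rule half_plane_solutions_agree[OF d m m' _ _ x])
qed

text \<open>
  The pure solution \<open>u\<close> for the axis \<open>d\<close> covers the half of the closed right half plane next to
  \<open>d\<close>. In the other half it is represented as a member \<open>f\<close> of the family over the pure solution
  for \<open>- d\<close>, which reaches the axis \<open>- d\<close>. For uniqueness, a competitor is a member of the
  family over \<open>u\<close>; as its gauged difference is \<open>c exp (- x) (1 + o(1))\<close> on the axis \<open>d\<close> and
  must be \<open>o(1)\<close> there, \<open>c\<close> vanishes.
\<close>
lemma tritronquee_solution:
  assumes d: "d = \<i> \<or> d = - \<i>"
  obtains w Rw where "0 < Rw" "PV_truncated \<alpha> \<beta> \<gamma> 2 w" "has_exp_constant d w 0"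
    "\<And>v. PV_truncated \<alpha> \<beta> \<gamma> 2 v \<Longrightarrow> has_exp_constant d v 0 \<Longrightarrow> same_germ_right v w"
    "\<And>m R' v x. norm m = 1 \<Longrightarrow> 0 < m \<bullet> d \<Longrightarrow> Rw \<le> R' \<Longrightarrow> pure_solution m R' v \<Longrightarrow> x \<in> half_plane m R'
        \<Longrightarrow> 0 < Re x \<Longrightarrow> PV_of (v x) = w x"
proof -
  have d': "- d = \<i> \<or> - d = - \<i>" using d by auto
  have d1: "norm d = 1" "d \<noteq> 0" "Re d = 0" using d by auto
  note md = mid_norm[OF d] mid_pos[OF d] and md' = mid_norm[OF d'] mid_pos[OF d']
  obtain R u where R: "1 \<le> R" and u: "pure_solution (mid d) R u"
    by (rule pure_solution_exists[OF d md(1,3)])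
  obtain R0 u' where R0: "1 \<le> R0" and u': "pure_solution (mid (- d)) R0 u'"
    by (rule pure_solution_exists[OF d' md'(1,3)])
  obtain M where du: "decaying_solution (half_plane (mid d) R) M u" using u unfolding pure_solution_def by blast
  obtain M' where du': "decaying_solution (half_plane (mid (- d)) R0) M' u'" using u' unfolding pure_solution_def by blast
  note uh = decaying_solutionD(1)[OF du] and uM = decaying_solutionD(2)[OF du] and us = decaying_solutionD(4,3)[OF du]
  note u'h = decaying_solutionD(1)[OF du'] and u'M = decaying_solutionD(2)[OF du']
  define Q1 where "Q1 = half_plane (mid d) R"
  have Q1o: "open Q1" by (simp add: Q1_def half_plane_open)
  obtain T0 where T0: "0 < T0" "\<And>t. T0 \<le> t \<Longrightarrow> cball (of_real t * 1) 1 \<subseteq> Q1"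
    unfolding Q1_def using half_plane_contains_ray[OF md(1,2)] by blast
  have real1: "of_real t \<in> Q1" "0 < t" if "T0 \<le> t" for t using T0(2)[OF that] T0(1) that by auto
  have uan: "u analytic_on {of_real t}" if "T0 \<le> t" for t
    using real1[OF that] uh Q1o by (auto simp: analytic_at Q1_def)
  have u0: "((\<lambda>t. u (of_real t)) \<longlongrightarrow> 0) at_top"
  proof (rule Lim_null_comparison)
    show "((\<lambda>t. M / t) \<longlongrightarrow> 0) at_top" by real_asymp
    show "\<forall>\<^sub>F t in at_top. norm (u (of_real t)) \<le> M / t"
      using eventually_ge_at_top[of T0] by eventually_elim (use uM real1 in \<open>force simp: Q1_def\<close>)
  qed
  have us_real: "solves u (of_real t)" if "T0 \<le> t" for t using us(1) real1[OF that] by (simp add: Q1_def)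
  obtain C R' B \<eta> T' where R': "R0 \<le> R'" "2 \<le> R'"
    and per: "recessive_perturbation (half_plane (mid (- d)) R' \<inter> {x. - 1 < Re x}) u' C B \<eta>"
    and u\<eta>: "\<And>t. T' \<le> t \<Longrightarrow> u (of_real t) = u' (of_real t) + \<eta> (of_real t) / csqrt (of_real t)"
    by (rule recessive_identification[OF d' du' uan us_real u0]) blast+
  define Q2 where "Q2 = half_plane (mid (- d)) R' \<inter> {x. - 1 < Re x}"
  note \<eta> = recessive_perturbationD[OF per, folded Q2_def]
  define f where "f x = u' x + \<eta> x / csqrt x" for x
  have Q2o: "open Q2" unfolding Q2_def by (intro open_Int half_plane_open open_halfspace_Re_gt)
  have Q2n: "R' < norm x" if "x \<in> Q2" for x
    using half_plane_norm[OF _ md'(1)] that by (auto simp: Q2_def)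
  have slit: "x \<notin> \<real>\<^sub>\<le>\<^sub>0" if "- 1 < Re x" "2 \<le> norm x" for x
  proof
    assume "x \<in> \<real>\<^sub>\<le>\<^sub>0"
    then have "norm x = - Re x" by (auto simp: complex_nonpos_Reals_iff cmod_eq_Re)
    with that show False by linarith
  qed
  have slit2: "x \<notin> \<real>\<^sub>\<le>\<^sub>0" if "x \<in> Q2" for x
    by (rule slit) (use Q2n[OF that] R' that in \<open>auto simp: Q2_def\<close>)
  have fh: "f holomorphic_on Q2"
    unfolding f_def[abs_def]
    by (intro holomorphic_intros holomorphic_on_subset[OF u'h] holomorphic_on_subset[OF \<eta>(1)])
      (use slit2 R' in \<open>auto simp: Q2_def half_plane_def\<close>)
  have fs: "solves f x" "norm (f x) \<le> 1/2" if "x \<in> Q2" for x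
    using \<eta>(2,3)[OF that] by (auto simp: f_def[abs_def])
  obtain T2 where T2: "0 < T2" "\<And>t. T2 \<le> t \<Longrightarrow> cball (of_real t * 1) 1 \<subseteq> half_plane (mid (- d)) R'"
    using half_plane_contains_ray[OF md'(1,2)] by blast
  have real2: "of_real t \<in> Q2" if "T2 \<le> t" for t using T2(2)[OF that] T2(1) that by (auto simp: Q2_def)
  have nice_of: "g nicely_meromorphic_on S" if "g holomorphic_on S'" "open S'" "S \<subseteq> S'" for g S S'
    using that analytic_on_open analytic_on_subset analytic_on_imp_nicely_meromorphic_on by blast
  have agree: "u x = f x" if x: "x \<in> Q1" "x \<in> Q2" for x
  proof (rule nicely_meromorphic_identity[of u "Q1 \<inter> Q2" f "Max {T0, T2, T'}"])
    show "u nicely_meromorphic_on Q1 \<inter> Q2" by (rule nice_of[OF uh]) (auto simp: Q1_def half_plane_open)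
    show "f nicely_meromorphic_on Q1 \<inter> Q2" by (rule nice_of[OF fh Q2o]) auto
    show "connected (Q1 \<inter> Q2)" unfolding Q1_def Q2_def
      by (intro convex_connected convex_Int half_plane_convex convex_halfspace_Re_gt)
    show "of_real t \<in> Q1 \<inter> Q2" "u (of_real t) = f (of_real t)" if "Max {T0, T2, T'} \<le> t" for t
      using real1[of t] real2[of t] u\<eta>[of t] that by (auto simp: f_def)
  qed (use x in auto)
  define w where "w x = PV_of (if x \<in> Q1 then u x else f x)" for x
  have w1: "w x = PV_of (u x)" if "x \<in> Q1" for x using that by (simp add: w_def)
  have w2: "w x = PV_of (f x)" if "x \<in> Q2" for x using agree that by (simp add: w_def)
  have wh1: "w holomorphic_on Q1"
    using PV_of_holomorphic[OF uh us(2)] holomorphic_cong[OF refl w1] by (simp add: Q1_def)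
  have wh2: "w holomorphic_on Q2"
    using PV_of_holomorphic[OF fh fs(2)] holomorphic_cong[OF refl w2] by simp
  (* The two half planes with normals mid d and mid (- d) cover the part of the right half plane outside
     the disc with radius sqrt 2 max R R', hence the set S. *)
  define Rw where "Rw = 2 * max R R'"
  have Rw: "2 \<le> Rw" "R \<le> Rw" using R R' by (auto simp: Rw_def)
  define S where "S = {x::complex. 0 \<le> Re x \<and> Rw < norm x}"
  have cover: "x \<in> Q1 \<or> x \<in> Q2" if x: "x \<in> S" for x
  proof -
    have "norm x \<le> Re x + \<bar>d \<bullet> x\<bar>"
      using cmod_le[of x] x d by (auto simp: S_def inner_complex_def)
    then have "2 * max R R' < Re x + \<bar>d \<bullet> x\<bar>" using x by (simp add: S_def Rw_def)
    moreover have "sqrt 2 < 2" using real_sqrt_less_mono[of 2 4] by simp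
    then have "sqrt 2 * max R R' \<le> 2 * max R R'" using R by (intro mult_right_mono) auto
    ultimately have "max R R' * sqrt 2 < Re x + \<bar>d \<bullet> x\<bar>" by (simp add: mult.commute)
    then have "max R R' < (Re x + \<bar>d \<bullet> x\<bar>) / sqrt 2" by (simp add: less_divide_eq)
    then show ?thesis using x
      by (cases "0 \<le> d \<bullet> x") (auto simp: Q1_def Q2_def half_plane_def mid_inner[OF d] mid_inner[OF d'] S_def)
  qed
  have wan: "w analytic_on S"
  proof -
    have "w analytic_on Q1 \<union> Q2" using wh1 wh2 Q1o Q2o by (simp add: analytic_on_Un analytic_on_open)
    then show ?thesis by (rule analytic_on_subset) (use cover in auto)
  qed
  have weq: "PV_eq \<alpha> \<beta> \<gamma> 2 w x" if x: "x \<in> S" for x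
  proof -
    have x0: "x \<noteq> 0" using x Rw by (auto simp: S_def)
    from cover[OF x] show ?thesis
    proof
      assume x: "x \<in> Q1"
      have "\<forall>\<^sub>F y in nhds x. y \<in> Q1" by (rule eventually_nhds_in_open[OF Q1o x])
      then have "\<forall>\<^sub>F y in nhds x. w y = PV_of (u y)" by eventually_elim (rule w1)
      then show ?thesis using PV_eq_of_solves[of u x w] uh us x x0 Q1o by (auto simp: analytic_at Q1_def)
    next
      assume x: "x \<in> Q2"
      have "\<forall>\<^sub>F y in nhds x. y \<in> Q2" by (rule eventually_nhds_in_open[OF Q2o x])
      then have "\<forall>\<^sub>F y in nhds x. w y = PV_of (f y)" by eventually_elim (rule w2)
      then show ?thesis using PV_eq_of_solves[of f x w] fh fs x x0 Q2o by (auto simp: analytic_at)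
    qed
  qed
  have sol: "PV_solution_on \<alpha> \<beta> \<gamma> 2 w {x. 0 \<le> Re x \<and> Rw < norm x}"
    unfolding PV_solution_on_def
    using analytic_on_imp_nicely_meromorphic_on[OF wan] weq by (auto simp: S_def)
  have cont0: "isCont PV_of 0" using PV_of_deriv(1)[of 0] by (intro DERIV_isCont) auto
  have PV0: "PV_of 0 = - 1" by (simp add: PV_of_def)
  have rays: "((\<lambda>r. w (rcis r (- \<phi>))) \<longlongrightarrow> - 1) at_top" if \<phi>: "\<bar>\<phi>\<bar> < pi / 2" for \<phi>
  proof -
    define y where "y = cis (- \<phi>)"
    have y: "norm y = 1" "0 < Re y" using \<phi> by (auto simp: y_def cos_gt_zero_pi)
    have rc: "rcis r (- \<phi>) = of_real r * y" for r by (simp add: y_def rcis_def)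
    obtain g where g: "((\<lambda>r. g (of_real r * y)) \<longlongrightarrow> 0) at_top"
      "\<forall>\<^sub>F r in at_top. w (of_real r * y) = PV_of (g (of_real r * y))"
    proof (cases "0 \<le> d \<bullet> y")
      case True
      then have "0 < mid d \<bullet> y" using y by (simp add: mid_inner[OF d])
      then obtain T where T: "0 < T" "\<And>t. T \<le> t \<Longrightarrow> cball (of_real t * y) 1 \<subseteq> Q1"
        unfolding Q1_def using half_plane_contains_ray[OF md(1)] by blast
      have inQ: "of_real t * y \<in> Q1" if "T \<le> t" for t using T(2)[OF that] by auto
      show ?thesis
      proof (rule that[of u])
        show "((\<lambda>r. u (of_real r * y)) \<longlongrightarrow> 0) at_top"
        proof (rule Lim_null_comparison)
          show "((\<lambda>t. M / t) \<longlongrightarrow> 0) at_top" by real_asymp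
          show "\<forall>\<^sub>F t in at_top. norm (u (of_real t * y)) \<le> M / t"
            using eventually_ge_at_top[of T]
          proof eventually_elim
            case (elim t)
            show ?case using uM[of "of_real t * y"] inQ[OF elim] T(1) elim y by (simp add: Q1_def norm_mult)
          qed
        qed
        show "\<forall>\<^sub>F r in at_top. w (of_real r * y) = PV_of (u (of_real r * y))"
          using eventually_ge_at_top[of T] by eventually_elim (use w1 inQ in auto)
      qed
    next
      case False
      then have "0 < mid (- d) \<bullet> y" using y by (simp add: mid_inner[OF d'])
      then obtain T where T: "0 < T" "\<And>t. T \<le> t \<Longrightarrow> cball (of_real t * y) 1 \<subseteq> half_plane (mid (- d)) R'"
        using half_plane_contains_ray[OF md'(1)] by blast
      have inQ: "of_real t * y \<in> Q2" if "T \<le> t" for t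
      proof -
        have "0 < t * Re y" using T(1) that y by simp
        then show ?thesis using T(2)[OF that] by (auto simp: Q2_def)
      qed
      show ?thesis
      proof (rule that[of f])
        show "((\<lambda>r. f (of_real r * y)) \<longlongrightarrow> 0) at_top"
        proof (rule Lim_null_comparison)
          show "((\<lambda>t. M' / t + (norm C + \<bar>B\<bar>) / sqrt t) \<longlongrightarrow> 0) at_top" by real_asymp
          show "\<forall>\<^sub>F t in at_top. norm (f (of_real t * y)) \<le> M' / t + (norm C + \<bar>B\<bar>) / sqrt t"
            using eventually_ge_at_top[of "max T 1"]
          proof eventually_elim
            case (elim t)
            let ?x = "of_real t * y"
            have t: "T \<le> t" "1 \<le> t" using elim by auto
            have n: "norm ?x = t" using t y by (simp add: norm_mult)
            note q = inQ[OF t(1)]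
            have e: "exp (- Re ?x) \<le> 1" using t y by simp
            have "norm (\<eta> ?x) \<le> norm (C * exp (- ?x)) + norm (\<eta> ?x - C * exp (- ?x))" by (rule norm_triangle_sub)
            also have "\<dots> \<le> norm C * exp (- Re ?x) + B / t * exp (- Re ?x)"
              using \<eta>(4)[OF q] unfolding n by (simp add: norm_mult norm_exp_eq_Re)
            also have "\<dots> \<le> norm C * 1 + \<bar>B\<bar> * 1"
            proof (intro add_mono mult_mono e)
              show "B / t \<le> \<bar>B\<bar>" using t frac_le[of "\<bar>B\<bar>" B 1 t] by auto
            qed auto
            finally have "norm (\<eta> ?x) \<le> norm C + \<bar>B\<bar>" by simp
            moreover have "norm (csqrt ?x) = sqrt t"
              using csqrt_norm_sq[of ?x] unfolding n by (metis norm_ge_zero real_sqrt_unique)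
            ultimately have "norm (\<eta> ?x / csqrt ?x) \<le> (norm C + \<bar>B\<bar>) / sqrt t"
              using t by (simp add: norm_divide divide_right_mono)
            moreover have "?x \<in> half_plane (mid (- d)) R0" using half_plane_mono[OF R'(1)] q by (auto simp: Q2_def)
            from u'M[OF this] have "norm (u' ?x) \<le> M' / t" unfolding n .
            ultimately show ?case
              unfolding f_def using norm_triangle_ineq[of "u' ?x" "\<eta> ?x / csqrt ?x"] by linarith
          qed
        qed
        show "\<forall>\<^sub>F r in at_top. w (of_real r * y) = PV_of (f (of_real r * y))"
          using eventually_ge_at_top[of T] by eventually_elim (use w2 inQ in auto)
      qed
    qed
    have "((\<lambda>r. PV_of (g (of_real r * y))) \<longlongrightarrow> - 1) at_top"
      using isCont_tendsto_compose[OF cont0 g(1)] by (simp add: PV0)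
    then show ?thesis
      unfolding rc by (rule Lim_transform_eventually) (use g(2) in \<open>eventually_elim, simp\<close>)
  qed
  have trunc: "PV_truncated \<alpha> \<beta> \<gamma> 2 w"
    unfolding PV_truncated_def using sol rays Rw by (intro conjI exI[of _ Rw] allI impI) auto
  obtain Td where Td: "0 < Td" "\<And>t. Td \<le> t \<Longrightarrow> cball (of_real t * d) 1 \<subseteq> Q1"
    unfolding Q1_def using half_plane_contains_ray[OF md(1,3)] by blast
  have axis1: "of_real t * d \<in> Q1" if "Td \<le> t" for t using Td(2)[OF that] by auto
  have axisM: "norm (u (of_real t * d)) \<le> M / t" if "Td \<le> t" for t
    using uM[of "of_real t * d"] axis1[OF that] d1 Td(1) that by (simp add: Q1_def norm_mult)
  obtain r where r: "0 < r" "r \<le> 1/2" "\<And>z. norm z < r \<Longrightarrow> norm z \<le> norm (PV_of z + 1)"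
    "\<And>z. norm z < r \<Longrightarrow> norm (PV_of z + 1) \<le> 3 * norm z" by (rule PV_of_linear_bounds) blast
  have expc: "has_exp_constant d w 0"
    unfolding has_exp_constant_0_iff[OF d1(1)]
  proof (rule Lim_null_comparison)
    show "((\<lambda>t. 3 * (M / t) * sqrt t) \<longlongrightarrow> 0) at_top" by real_asymp
    have "((\<lambda>t. M / t) \<longlongrightarrow> 0) at_top" by real_asymp
    then have "\<forall>\<^sub>F t in at_top. M / t < r" using r(1) by (rule order_tendstoD)
    then show "\<forall>\<^sub>F t in at_top. norm (norm (w (d * of_real t) + 1) * sqrt t) \<le> 3 * (M / t) * sqrt t"
      using eventually_ge_at_top[of Td]
    proof eventually_elim
      case (elim t)
      have "norm (PV_of (u (of_real t * d)) + 1) \<le> 3 * norm (u (of_real t * d))"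
        by (rule r(4)) (use axisM[OF elim(2)] elim(1) in linarith)
      moreover have "3 * norm (u (of_real t * d)) \<le> 3 * (M / t)"
        by (rule mult_left_mono[OF axisM[OF elim(2)]]) simp
      moreover have "w (d * of_real t) = PV_of (u (of_real t * d))"
        using w1[OF axis1[OF elim(2)]] by (simp add: mult.commute)
      ultimately have "norm (w (d * of_real t) + 1) \<le> 3 * (M / t)" by simp
      then have "norm (w (d * of_real t) + 1) * sqrt t \<le> 3 * (M / t) * sqrt t"
        by (rule mult_right_mono) (use elim(2) Td(1) in auto)
      then show ?case using elim(2) Td(1) by (simp add: abs_mult)
    qed
  qed
  have unique: "same_germ_right v w" if v: "PV_truncated \<alpha> \<beta> \<gamma> 2 v" and vc: "has_exp_constant d v 0" for v
  proof -
    obtain Rv where Rv: "0 < Rv" "PV_solution_on \<alpha> \<beta> \<gamma> 2 v {x. 0 \<le> Re x \<and> Rv < norm x}"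
      using v unfolding PV_truncated_def by blast
    have vnice: "v nicely_meromorphic_on {x. 0 \<le> Re x \<and> Rv < norm x}"
      using Rv(2) by (simp add: PV_solution_on_def)
    define p where "p x = Arcsin ((v x + 1) / (v x - 1))" for x
    obtain T1 where p: "\<And>t. T1 \<le> t \<Longrightarrow> p analytic_on {of_real t}" "\<And>t. T1 \<le> t \<Longrightarrow> solves p (of_real t)"
      "\<And>t. T1 \<le> t \<Longrightarrow> v (of_real t) = PV_of (p (of_real t))" "((\<lambda>t. p (of_real t)) \<longlongrightarrow> 0) at_top"
      using PV_truncated_lift[OF v] unfolding p_def solves_def by blast
    obtain c Rc b \<theta> Tc where Rc: "R \<le> Rc" "2 \<le> Rc"
      and per': "recessive_perturbation (half_plane (mid d) Rc \<inter> {x. - 1 < Re x}) u c b \<theta>"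
      and p\<theta>: "\<And>t. Tc \<le> t \<Longrightarrow> p (of_real t) = u (of_real t) + \<theta> (of_real t) / csqrt (of_real t)"
      "\<And>t. c = 0 \<Longrightarrow> Tc \<le> t \<Longrightarrow> p (of_real t) = u (of_real t)"
      by (rule recessive_identification[OF d du p(1,2,4)]) blast+
    have "c = 0"
    proof -
      define z where "z x = u x + \<theta> x / csqrt x" for x
      define Q where "Q = half_plane (mid d) Rc \<inter> {x. - 1 < Re x}"
      note \<theta> = recessive_perturbationD[OF per', folded Q_def]
      have Qo: "open Q" unfolding Q_def by (intro open_Int half_plane_open open_halfspace_Re_gt)
      have Qn: "Rc < norm x" if "x \<in> Q" for x
        using half_plane_norm[OF _ md(1)] that by (auto simp: Q_def)
      have "z holomorphic_on Q"
        unfolding z_def[abs_def]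
      proof (intro holomorphic_intros holomorphic_on_subset[OF uh] holomorphic_on_subset[OF \<theta>(1)])
        fix x assume x: "x \<in> Q"
        show s: "x \<notin> \<real>\<^sub>\<le>\<^sub>0" by (rule slit) (use Qn[OF x] Rc x in \<open>auto simp: Q_def\<close>)
        then show "csqrt x \<noteq> 0" by auto
      qed (use Rc in \<open>auto simp: Q_def half_plane_def\<close>)
      then have zh: "(\<lambda>x. PV_of (z x)) holomorphic_on Q"
        by (rule PV_of_holomorphic) (use \<theta>(3) in \<open>auto simp: z_def\<close>)
      define Rm where "Rm = max Rc Rv"
      define Sm where "Sm = half_plane (mid d) Rm \<inter> {x. 0 \<le> Re x}"
      have SmQ: "Sm \<subseteq> Q" by (auto simp: Sm_def Q_def half_plane_def Rm_def)
      have SmV: "Sm \<subseteq> {x. 0 \<le> Re x \<and> Rv < norm x}"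
        using half_plane_norm[OF _ md(1), of _ Rm] by (auto simp: Sm_def Rm_def)
      obtain Tr where Tr: "0 < Tr" "\<And>t. Tr \<le> t \<Longrightarrow> cball (of_real t * 1) 1 \<subseteq> half_plane (mid d) Rm"
        using half_plane_contains_ray[OF md(1,2)] by blast
      obtain Ta where Ta: "0 < Ta" "\<And>t. Ta \<le> t \<Longrightarrow> cball (of_real t * d) 1 \<subseteq> half_plane (mid d) Rm"
        using half_plane_contains_ray[OF md(1,3)] by blast
      have axis: "of_real t * d \<in> Sm" if "Ta \<le> t" for t
        using Ta(2)[OF that] d1 by (auto simp: Sm_def)
      have vz: "v x = PV_of (z x)" if x: "x \<in> Sm" for x
      proof (rule nicely_meromorphic_identity[of v Sm "\<lambda>x. PV_of (z x)" "Max {T1, Tc, Tr}"])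
        show "v nicely_meromorphic_on Sm" by (rule nicely_meromorphic_on_subset[OF vnice SmV])
        show "(\<lambda>x. PV_of (z x)) nicely_meromorphic_on Sm" by (rule nice_of[OF zh Qo SmQ])
        show "connected Sm" unfolding Sm_def
          by (intro convex_connected convex_Int half_plane_convex convex_halfspace_Re_ge)
        show "of_real t \<in> Sm" if "Max {T1, Tc, Tr} \<le> t" for t
          using Tr(2)[of t] Tr(1) that by (auto simp: Sm_def)
        show "v (of_real t) = PV_of (z (of_real t))" if "Max {T1, Tc, Tr} \<le> t" for t
          using p(3)[of t] p\<theta>(1)[of t] that by (simp add: z_def)
      qed (rule x)
      have ne: "norm (exp (- (of_real t * d))) = 1" for t
        using d1 by (simp add: norm_exp_eq_Re)
      have sq: "norm (csqrt (of_real t * d)) = sqrt t" if "0 \<le> t" for t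
      proof -
        have "(norm (csqrt (of_real t * d)))\<^sup>2 = t" using csqrt_norm_sq[of "of_real t * d"] that d1 by (simp add: norm_mult)
        then show ?thesis by (metis norm_ge_zero real_sqrt_unique)
      qed
      have \<theta>d: "norm (\<theta> (of_real t * d) - c * exp (- (of_real t * d))) \<le> b / t" if t: "Ta \<le> t" for t
      proof -
        have "norm (of_real t * d) = t" using d1 Ta(1) t by (simp add: norm_mult)
        moreover have "of_real t * d \<in> Q" using axis[OF t] SmQ by blast
        ultimately show ?thesis using \<theta>(4)[of "of_real t * d"] d1(3) by simp
      qed
      define g where "g t = norm (v (d * of_real t) + 1) * sqrt t + sqrt t * (M / t) + b / t" for t
      have vlim: "((\<lambda>t. norm (v (d * of_real t) + 1) * sqrt t) \<longlongrightarrow> 0) at_top"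
        using vc unfolding has_exp_constant_0_iff[OF d1(1)] .
      have l1: "((\<lambda>t. sqrt t * (M / t)) \<longlongrightarrow> 0) at_top" "((\<lambda>t. b / t) \<longlongrightarrow> 0) at_top" by real_asymp+
      have g0: "(g \<longlongrightarrow> 0) at_top"
        unfolding g_def using tendsto_add[OF tendsto_add[OF vlim l1(1)] l1(2)] by simp
      have "((\<lambda>t. M / t + (norm c + \<bar>b\<bar>) / sqrt t) \<longlongrightarrow> 0) at_top" by real_asymp
      then have small: "\<forall>\<^sub>F t in at_top. M / t + (norm c + \<bar>b\<bar>) / sqrt t < r" using r(1) by (rule order_tendstoD)
      have "\<forall>\<^sub>F t in at_top. norm c \<le> g t"
        using small eventually_ge_at_top[of "Max {Ta, Td, 1}"]
      proof eventually_elim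
        case (elim t)
        have t: "Ta \<le> t" "Td \<le> t" "1 \<le> t" using elim(2) by auto
        let ?x = "of_real t * d"
        have s0: "0 < sqrt t" using t by simp
        have c1: "norm c = norm (c * exp (- ?x))" using ne[of t] by (simp only: norm_mult mult_1_right)
        have "b / t \<le> \<bar>b\<bar>" using t frac_le[of "\<bar>b\<bar>" b 1 t] by auto
        then have "norm (\<theta> ?x) \<le> norm c + \<bar>b\<bar>"
          using norm_triangle_sub[of "\<theta> ?x" "c * exp (- ?x)"] \<theta>d[OF t(1)] c1 by linarith
        then have "norm (\<theta> ?x / csqrt ?x) \<le> (norm c + \<bar>b\<bar>) / sqrt t"
          using sq[of t] t by (simp add: norm_divide divide_right_mono)
        then have "norm (z ?x) < r"
          unfolding z_def using norm_triangle_ineq[of "u ?x" "\<theta> ?x / csqrt ?x"] axisM[OF t(2)] elim(1) by linarith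
        then have "norm (z ?x) \<le> norm (v ?x + 1)" using r(3) vz[OF axis[OF t(1)]] by simp
        then have zb: "norm (z ?x) \<le> norm (v (d * of_real t) + 1)" by (simp add: mult.commute)
        have "\<theta> ?x = csqrt ?x * (z ?x - u ?x)"
          using s0 sq[of t] t by (auto simp: z_def)
        then have "norm (\<theta> ?x) = sqrt t * norm (z ?x - u ?x)" using sq[of t] t by (simp add: norm_mult)
        also have "\<dots> \<le> sqrt t * (norm (v (d * of_real t) + 1) + M / t)"
          using norm_triangle_ineq4[of "z ?x" "u ?x"] zb axisM[OF t(2)] s0 by (intro mult_left_mono) auto
        finally have "norm (\<theta> ?x) \<le> norm (v (d * of_real t) + 1) * sqrt t + sqrt t * (M / t)"
          by (simp add: distrib_left mult.commute)
        moreover have "norm c \<le> norm (\<theta> ?x) + norm (\<theta> ?x - c * exp (- ?x))"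
          unfolding c1 using norm_triangle_sub[of "c * exp (- ?x)" "\<theta> ?x"] by (simp add: norm_minus_commute)
        ultimately show ?case unfolding g_def using \<theta>d[OF t(1)] by linarith
      qed
      then have "norm c \<le> 0" by (intro tendsto_lowerbound[OF g0]) auto
      then show ?thesis by simp
    qed
    define Rf where "Rf = max Rv Rw"
    define Sf where "Sf = {x::complex. 0 \<le> Re x \<and> Rf < norm x}"
    have vw: "v x = w x" if x: "x \<in> Sf" for x
    proof (rule nicely_meromorphic_identity[of v Sf w "Max {T1, Tc, T0, Rf + 1}"])
      show "v nicely_meromorphic_on Sf"
        by (rule nicely_meromorphic_on_subset[OF vnice]) (auto simp: Sf_def Rf_def)
      show "w nicely_meromorphic_on Sf"
        by (rule analytic_on_imp_nicely_meromorphic_on[OF analytic_on_subset[OF wan]]) (auto simp: Sf_def S_def Rf_def)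
      have Sf_eq: "Sf = (\<lambda>(r, \<phi>). rcis r \<phi>) ` ({Rf<..} \<times> {- (pi / 2)..pi / 2})"
      proof (intro equalityI subsetI)
        fix y assume y: "y \<in> Sf"
        have "\<bar>Arg y\<bar> \<le> pi / 2" using y Arg_Re_nonneg[of y] by (cases "y = 0") (auto simp: Sf_def)
        then show "y \<in> (\<lambda>(r, \<phi>). rcis r \<phi>) ` ({Rf<..} \<times> {- (pi / 2)..pi / 2})"
          using y by (intro image_eqI[of _ _ "(norm y, Arg y)"]) (auto simp: Sf_def rcis_cmod_Arg)
      next
        fix y assume "y \<in> (\<lambda>(r, \<phi>). rcis r \<phi>) ` ({Rf<..} \<times> {- (pi / 2)..pi / 2})"
        then obtain r \<phi> where y: "y = rcis r \<phi>" "Rf < r" "- (pi / 2) \<le> \<phi>" "\<phi> \<le> pi / 2" by auto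
        have "0 < r" using y(2) Rv(1) by (simp add: Rf_def)
        moreover have "0 \<le> cos \<phi>" using y by (intro cos_ge_zero) auto
        ultimately show "y \<in> Sf" using y by (simp add: Sf_def)
      qed
      have cont: "continuous_on ({Rf<..} \<times> {- (pi / 2)..pi / 2}) (\<lambda>(r, \<phi>). rcis r \<phi>)"
        unfolding rcis_def cis_conv_exp case_prod_unfold by (intro continuous_intros)
      show "connected Sf"
        unfolding Sf_eq
        by (intro connected_continuous_image cont connected_Times convex_connected convex_real_interval)
      show "of_real t \<in> Sf" if "Max {T1, Tc, T0, Rf + 1} \<le> t" for t
        using that Rv(1) by (auto simp: Sf_def Rf_def)
      show "v (of_real t) = w (of_real t)" if "Max {T1, Tc, T0, Rf + 1} \<le> t" for t
        using p(3)[of t] p\<theta>(2)[OF \<open>c = 0\<close>, of t] w1[OF real1(1), of t] that by simp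
    qed (rule x)
    show ?thesis
      unfolding same_germ_right_def eventually_at_infinity
      by (rule exI[of _ "Rf + 1"]) (use vw in \<open>auto simp: Sf_def\<close>)
  qed
  have compat: "PV_of (v x) = w x"
    if m: "norm m = 1" "0 < m \<bullet> d" and Rr: "Rw \<le> Rr" and v: "pure_solution m Rr v"
      and x: "x \<in> half_plane m Rr" "0 < Re x" for m Rr v x
  proof (rule analytic_continuation_open[of "half_plane m Rr \<inter> half_plane (mid d) R \<inter> {x. 0 < Re x}"
        "half_plane m Rr \<inter> {x. 0 < Re x}" "\<lambda>x. PV_of (v x)" w])
    show "open (half_plane m Rr \<inter> half_plane (mid d) R \<inter> {x. 0 < Re x})" "open (half_plane m Rr \<inter> {x. 0 < Re x})"
      by (intro open_Int half_plane_open open_halfspace_Re_gt)+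
    show "connected (half_plane m Rr \<inter> {x. 0 < Re x})"
      by (intro convex_connected convex_Int half_plane_convex convex_halfspace_Re_gt)
    show "half_plane m Rr \<inter> half_plane (mid d) R \<inter> {x. 0 < Re x} \<noteq> {}"
    proof -
      (* A direction in the interior of the right half plane that is close enough to d to have positive inner
         product with m as well. *)
      define y where "y = 2 * d + of_real (m \<bullet> d)"
      have md0: "0 < m \<bullet> d" by (rule m(2))
      have "- 1 \<le> m \<bullet> 1" using norm_cauchy_schwarz[of "- m" 1] m(1) by simp
      then have "(m \<bullet> d) * (- 1) \<le> (m \<bullet> d) * (m \<bullet> 1)" using md0 by (intro mult_left_mono) auto
      moreover have "m \<bullet> y = 2 * (m \<bullet> d) + (m \<bullet> d) * (m \<bullet> 1)"
        using inner_of_real_mult[of m 2 d] inner_of_real_mult[of m "m \<bullet> d" 1] by (simp add: y_def inner_add_right)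
      ultimately have y1: "0 < m \<bullet> y" using md0 by linarith
      have "mid d \<bullet> y = 2 * (mid d \<bullet> d) + (m \<bullet> d) * (mid d \<bullet> 1)"
        using inner_of_real_mult[of "mid d" 2 d] inner_of_real_mult[of "mid d" "m \<bullet> d" 1] by (simp add: y_def inner_add_right)
      then have y2: "0 < mid d \<bullet> y" using md0 md(2,3) by (simp add: add_pos_pos)
      have y3: "0 < Re y" using md0 d1 by (simp add: y_def)
      obtain t1 where t1: "0 < t1" "\<And>t. t1 \<le> t \<Longrightarrow> cball (of_real t * y) 1 \<subseteq> half_plane m Rr"
        using half_plane_contains_ray[OF m(1) y1] by blast
      obtain t2 where t2: "0 < t2" "\<And>t. t2 \<le> t \<Longrightarrow> cball (of_real t * y) 1 \<subseteq> half_plane (mid d) R"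
        using half_plane_contains_ray[OF md(1) y2] by blast
      have "of_real (max t1 t2) * y \<in> half_plane m Rr \<inter> half_plane (mid d) R \<inter> {x. 0 < Re x}"
        using t1(2)[of "max t1 t2"] t2(2)[of "max t1 t2"] t1(1) y3 by (auto simp: less_max_iff_disj)
      then show ?thesis by blast
    qed
    show "(\<lambda>x. PV_of (v x)) holomorphic_on half_plane m Rr \<inter> {x. 0 < Re x}"
      by (rule holomorphic_on_subset[OF pure_solution_PV_of_holomorphic[OF v]]) auto
    show "w holomorphic_on half_plane m Rr \<inter> {x. 0 < Re x}"
    proof (rule analytic_imp_holomorphic, rule analytic_on_subset[OF wan], rule subsetI)
      fix y assume y: "y \<in> half_plane m Rr \<inter> {x. 0 < Re x}"
      then show "y \<in> S" using half_plane_norm[of y m Rr] m(1) Rr by (auto simp: S_def)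
    qed
    show "PV_of (v y) = w y" if "y \<in> half_plane m Rr \<inter> half_plane (mid d) R \<inter> {x. 0 < Re x}" for y
      using pure_solutions_agree[OF d m md(1,3) v u, of y] w1[of y] that by (auto simp: Q1_def)
  qed (use x in auto)
  show thesis
    by (rule that[of Rw w]) (use Rw trunc expc unique compat in auto)
qed

text \<open>
  Two pure solutions cover the sector: the normals \<open>m1\<close> and \<open>m2\<close> are obtained by turning the
  directions of the positive and of the negative real axis by \<open>\<delta>\<close> towards \<open>d\<close>. Here
  \<open>\<tau> = 1\<close> for \<open>d = \<i>\<close> and \<open>\<tau> = - 1\<close> for \<open>d = - \<i>\<close>.
\<close>
lemma tritronquee_continues:
  fixes \<tau> \<epsilon> a b Rw :: real
  assumes \<tau>: "\<tau> = 1 \<or> \<tau> = - 1" and \<epsilon>: "0 < \<epsilon>" and Rw: "0 < Rw"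
    and ab: "\<And>\<theta>. a < \<theta> \<Longrightarrow> \<theta> < b \<Longrightarrow> - pi / 2 + \<epsilon> < \<tau> * \<theta> \<and> \<tau> * \<theta> < 3 * pi / 2 - \<epsilon>"
    and w: "\<And>m R' v x. norm m = 1 \<Longrightarrow> 0 < m \<bullet> (of_real \<tau> * \<i>) \<Longrightarrow> Rw \<le> R' \<Longrightarrow> pure_solution m R' v \<Longrightarrow> x \<in> half_plane m R'
        \<Longrightarrow> 0 < Re x \<Longrightarrow> PV_of (v x) = w x"
  shows "continues_analytically w a b"
proof -
  define d where "d = of_real \<tau> * \<i>"
  have d: "d = \<i> \<or> d = - \<i>" using \<tau> by (auto simp: d_def)
  (* The minimum takes care of large epsilon, for which the sector is small or empty. *)
  define \<delta> where "\<delta> = min (\<epsilon> / 2) (pi / 4)"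
  have "\<delta> \<le> \<epsilon> / 2" "\<delta> \<le> pi / 4" by (simp_all add: \<delta>_def)
  then have \<delta>: "0 < \<delta>" "2 * \<delta> \<le> \<epsilon>" "\<delta> < pi / 2"
    using \<epsilon> pi_gt_zero by (simp add: \<delta>_def, linarith, linarith)
  have sd: "0 < sin \<delta>" using \<delta> pi_gt_zero by (intro sin_gt_zero) auto
  define m1 where "m1 = cis (\<tau> * \<delta>)"
  define m2 where "m2 = cis (\<tau> * (pi - \<delta>))"
  have m1: "norm m1 = 1" "0 < m1 \<bullet> d" and m2: "norm m2 = 1" "0 < m2 \<bullet> d"
    using \<tau> sd by (auto simp: m1_def m2_def d_def inner_complex_def)
  obtain R1 u1 where u1: "1 \<le> R1" "pure_solution m1 R1 u1" by (rule pure_solution_exists[OF d m1])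
  obtain R2 u2 where u2: "1 \<le> R2" "pure_solution m2 R2 u2" by (rule pure_solution_exists[OF d m2])
  define R where "R = Max {R1, R2, Rw}"
  have R: "R1 \<le> R" "R2 \<le> R" "Rw \<le> R" unfolding R_def by (rule Max_ge; simp)+
  have p1: "pure_solution m1 R u1" and p2: "pure_solution m2 R u2"
    using pure_solution_mono u1 u2 R by blast+
  define H1 where "H1 = half_plane m1 R"
  define H2 where "H2 = half_plane m2 R"
  have H: "open H1" "open H2" by (auto simp: H1_def H2_def half_plane_open)
  define f where "f x = PV_of (if x \<in> H1 then u1 x else u2 x)" for x
  have f1: "f x = PV_of (u1 x)" if "x \<in> H1" for x using that by (simp add: f_def)
  have f2: "f x = PV_of (u2 x)" if "x \<in> H2" for x
    using pure_solutions_agree[OF d m1 m2 p1 p2, of x] that by (auto simp: f_def H1_def H2_def)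
  have "f holomorphic_on H1"
    using holomorphic_transform[OF pure_solution_PV_of_holomorphic[OF p1], of f] f1 by (simp add: H1_def)
  moreover have "f holomorphic_on H2"
    using holomorphic_transform[OF pure_solution_PV_of_holomorphic[OF p2], of f] f2 by (simp add: H2_def)
  ultimately have fan: "f analytic_on H1 \<union> H2" using H by (simp add: analytic_on_Un analytic_on_open)
  define Rs where "Rs = R / sin \<delta>"
  have R0: "0 < R" using R(3) Rw by linarith
  then have Rs: "0 < Rs" using sd by (simp add: Rs_def)
  have cos_ge: "sin \<delta> \<le> cos y" if "\<bar>y\<bar> \<le> pi / 2 - \<delta>" for y
  proof -
    have "cos (pi / 2 - \<delta>) \<le> cos \<bar>y\<bar>"
      using that \<delta> pi_gt_zero by (intro cos_monotone_0_pi_le) auto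
    then show ?thesis by (simp add: cos_diff)
  qed
  have inner_rcis: "cis \<alpha> \<bullet> rcis r \<theta> = r * cos (\<theta> - \<alpha>)" for \<alpha> r \<theta>
    by (simp add: inner_complex_def cos_diff algebra_simps)
  have big: "R < r * cos y" if "Rs < r" "\<bar>y\<bar> \<le> pi / 2 - \<delta>" for r y
  proof -
    have "R < r * sin \<delta>" using that(1) sd by (simp add: Rs_def divide_less_eq)
    also have "\<dots> \<le> r * cos y" using cos_ge[OF that(2)] that(1) Rs by (intro mult_left_mono) auto
    finally show ?thesis .
  qed
  have cos\<tau>: "cos (\<theta> - \<tau> * \<alpha>) = cos (\<tau> * \<theta> - \<alpha>)" for \<theta> \<alpha>
    using \<tau> cos_minus[of "\<theta> + \<alpha>"] by auto
  have cover: "sector Rs a b \<subseteq> H1 \<union> H2"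
  proof
    fix x assume "x \<in> sector Rs a b"
    then obtain r \<theta> where x: "x = rcis r \<theta>" "Rs < r" "a < \<theta>" "\<theta> < b" by (auto simp: sector_def)
    note \<phi> = ab[OF x(3,4)]
    show "x \<in> H1 \<union> H2"
    proof (cases "\<tau> * \<theta> \<le> pi / 2")
      case True
      then have "\<bar>\<tau> * \<theta> - \<delta>\<bar> \<le> pi / 2 - \<delta>" using \<phi> \<delta> by auto
      from big[OF x(2) this] have "x \<in> H1"
        by (simp add: H1_def half_plane_def m1_def x(1) inner_rcis cos\<tau>)
      then show ?thesis by simp
    next
      case False
      then have "\<bar>\<tau> * \<theta> - (pi - \<delta>)\<bar> \<le> pi / 2 - \<delta>" using \<phi> \<delta> by auto
      from big[OF x(2) this] have "x \<in> H2"
        by (simp only: H2_def half_plane_def m2_def x(1) inner_rcis cos\<tau> mem_Collect_eq)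
      then show ?thesis by simp
    qed
  qed
  have fw: "f x = w x" if x: "x \<in> sector Rs a b" "0 < Re x" for x
  proof (cases "x \<in> H1")
    case True
    then show ?thesis using w[OF m1[unfolded d_def] R(3) p1 _ x(2)] f1 by (simp add: H1_def)
  next
    case False
    then have "x \<in> H2" using cover x(1) by blast
    then show ?thesis using w[OF m2[unfolded d_def] R(3) p2 _ x(2)] f2 by (simp add: H2_def)
  qed
  show ?thesis
    unfolding continues_analytically_def
    using Rs analytic_on_subset[OF fan cover] fw by blast
qed

end

theorem corollary3p2:
  fixes \<alpha> \<beta> \<gamma> :: complex
  assumes "\<alpha> * \<beta> * \<gamma> \<noteq> 0"
  shows
    "(\<exists>w. PV_truncated \<alpha> \<beta> \<gamma> 2 w \<and> has_C_plus w 0 \<and>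
        (\<forall>v. PV_truncated \<alpha> \<beta> \<gamma> 2 v \<and> has_C_plus v 0 \<longrightarrow> same_germ_right v w) \<and>
        (\<forall>\<epsilon>>0. continues_analytically w (- pi / 2 + \<epsilon>) (3 * pi / 2 - \<epsilon>))) \<and>
     (\<exists>w. PV_truncated \<alpha> \<beta> \<gamma> 2 w \<and> has_C_minus w 0 \<and>
        (\<forall>v. PV_truncated \<alpha> \<beta> \<gamma> 2 v \<and> has_C_minus v 0 \<longrightarrow> same_germ_right v w) \<and>
        (\<forall>\<epsilon>>0. continues_analytically w (- 3 * pi / 2 + \<epsilon>) (pi / 2 - \<epsilon>)))"
proof -
  obtain K where "forced_pendulum (PV_forcing \<alpha> \<beta> \<gamma>) K" by (rule PV_forcing_forced_pendulum)
  then interpret PV_problem \<alpha> \<beta> \<gamma> K by (simp add: PV_problem_def)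
  show ?thesis
  proof
    obtain w Rw where w: "0 < Rw" "PV_truncated \<alpha> \<beta> \<gamma> 2 w" "has_C_plus w 0"
      "\<And>v. PV_truncated \<alpha> \<beta> \<gamma> 2 v \<Longrightarrow> has_C_plus v 0 \<Longrightarrow> same_germ_right v w"
      "\<And>m R' v x. norm m = 1 \<Longrightarrow> 0 < m \<bullet> \<i> \<Longrightarrow> Rw \<le> R' \<Longrightarrow> pure_solution m R' v \<Longrightarrow> x \<in> half_plane m R'
        \<Longrightarrow> 0 < Re x \<Longrightarrow> PV_of (v x) = w x"
      by (rule tritronquee_solution[of \<i>]) blast+
    have "continues_analytically w (- pi / 2 + \<epsilon>) (3 * pi / 2 - \<epsilon>)" if "0 < \<epsilon>" for \<epsilon>
      by (rule tritronquee_continues[of 1 \<epsilon> Rw]) (use that w(1,5) in auto)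
    with w(2-4) show "\<exists>w. PV_truncated \<alpha> \<beta> \<gamma> 2 w \<and> has_C_plus w 0 \<and>
        (\<forall>v. PV_truncated \<alpha> \<beta> \<gamma> 2 v \<and> has_C_plus v 0 \<longrightarrow> same_germ_right v w) \<and>
        (\<forall>\<epsilon>>0. continues_analytically w (- pi / 2 + \<epsilon>) (3 * pi / 2 - \<epsilon>))" by blast
  next
    obtain w Rw where w: "0 < Rw" "PV_truncated \<alpha> \<beta> \<gamma> 2 w" "has_C_minus w 0"
      "\<And>v. PV_truncated \<alpha> \<beta> \<gamma> 2 v \<Longrightarrow> has_C_minus v 0 \<Longrightarrow> same_germ_right v w"
      "\<And>m R' v x. norm m = 1 \<Longrightarrow> 0 < m \<bullet> (- \<i>) \<Longrightarrow> Rw \<le> R' \<Longrightarrow> pure_solution m R' v \<Longrightarrow> x \<in> half_plane m R'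
        \<Longrightarrow> 0 < Re x \<Longrightarrow> PV_of (v x) = w x"
      by (rule tritronquee_solution[of "- \<i>"]) blast+
    have "continues_analytically w (- 3 * pi / 2 + \<epsilon>) (pi / 2 - \<epsilon>)" if "0 < \<epsilon>" for \<epsilon>
      by (rule tritronquee_continues[of "- 1" \<epsilon> Rw]) (use that w(1,5) in auto)
    with w(2-4) show "\<exists>w. PV_truncated \<alpha> \<beta> \<gamma> 2 w \<and> has_C_minus w 0 \<and>
        (\<forall>v. PV_truncated \<alpha> \<beta> \<gamma> 2 v \<and> has_C_minus v 0 \<longrightarrow> same_germ_right v w) \<and>
        (\<forall>\<epsilon>>0. continues_analytically w (- 3 * pi / 2 + \<epsilon>) (pi / 2 - \<epsilon>))" by blast
  qed
qed

end
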